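(* Let $0<\lambda<\frac12$. There exist $\tilde c,c,C>0$ such that, for any $N\ge1$ and any $t$ with $\tilde c\le t\le N^{5/6}$, $$\mathbb P_\lambda^{N^2}\big[\mathsf{MeanLR}(\Gamma)\ge tN^{1/3}\big]\le Ce^{-ct^{6/5}}.$$
   Context: Model. $\mathbb N=\{0,1,2,\dots\}$. $\Lambda$ is the set of finite lattice paths in $\mathbb N^2$ (the first quadrant of $\mathbb Z^2$) which start on the $y$-axis, end on the $x$-axis, and only take unit rightward steps $(1,0)$ and unit downward steps $(0,-1)$. For $\gamma\in\Lambda$, $|\gamma|$ is its number of steps, and $\gamma$ is identified with the set of lattice points it visits. For $0<\lambda<\frac12$, $\mathbb P_\lambda$ is the probability measure on $\Lambda$ with $\mathbb P_\lambda[\gamma]=(1-2\lambda)\lambda^{|\gamma|}$. $\mathcal A(\gamma)$ is the area of the region enclosed by the graph of $\gamma$ and the two coordinate axes. For $N\in\mathbb N$, $\mathbb P_\lambda^{N^2}:=\mathbb P_\lambda[\,\cdot\mid\mathcal A(\Gamma)\ge N^2]$, where $\Gamma$ denotes the random path. Local roughness. For $\gamma\in\Lambda$, $\mathsf{Ext}(\gamma)$ is the set of non-zero extremal points of the convex hull of $\gamma\cup\{(0,0)\}$. The least concave majorant $\mathcal C(\gamma)$ is the graph of the piecewise affine function passing through all points of $\mathsf{Ext}(\gamma)$ (a finite union of line segments whose endpoints are the points of $\mathsf{Ext}(\gamma)$). For $x\in\gamma$, its local roughness is the Euclidean distance $\mathsf{LR}(x):=\mathrm d(x,\mathcal C(\gamma))$.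 $x_{\mathsf{mid}}(\gamma)$ is the point of $\mathbb N^2\cap\gamma$ closest to the line $\{y=x\}$ (the leftmost one in case of ties), and $\mathsf{MeanLR}(\gamma):=\mathsf{LR}(x_{\mathsf{mid}}(\gamma))$. *)

theory Defs
  imports "HOL-Probability.Probability"
begin

section \<open>The path model\<close>

text \<open>
  A path is the list of the lattice points it visits, in order. The one-point path at the origin
  (no steps) is included; it is needed for the weights of the measure below to sum to one.
\<close>

definition unit_step :: "nat \<times> nat \<Rightarrow> nat \<times> nat \<Rightarrow> bool" where
  "unit_step p q \<longleftrightarrow> q = (fst p + 1, snd p) \<or> p = (fst q, snd q + 1)"

definition lattice_paths :: "(nat \<times> nat) list set" where
  "lattice_paths =
     {\<gamma>. \<gamma> \<noteq> [] \<and> fst (hd \<gamma>) = 0 \<and> snd (last \<gamma>) = 0 \<and> successively unit_step \<gamma>}"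

definition num_steps :: "(nat \<times> nat) list \<Rightarrow> nat" where
  "num_steps \<gamma> = length \<gamma> - 1"

definition path_measure :: "real \<Rightarrow> (nat \<times> nat) list measure" where
  "path_measure l = point_measure lattice_paths (\<lambda>\<gamma>. ennreal ((1 - 2 * l) * l ^ num_steps \<gamma>))"


section \<open>Area\<close>

text \<open>Distances on \<open>real \<times> real\<close> are Euclidean in the library.\<close>

abbreviation real_point :: "nat \<times> nat \<Rightarrow> real \<times> real" where
  "real_point \<equiv> map_prod real real"

fun polyline :: "(real \<times> real) list \<Rightarrow> (real \<times> real) set" where
  "polyline [] = {}"
| "polyline [p] = {p}"
| "polyline (p # q # ps) = closed_segment p q \<union> polyline (q # ps)"

definition path_graph :: "(nat \<times> nat) list \<Rightarrow> (real \<times> real) set" where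
  "path_graph \<gamma> = polyline (map real_point \<gamma>)"

definition enclosed_region :: "(nat \<times> nat) list \<Rightarrow> (real \<times> real) set" where
  "enclosed_region \<gamma> = {(x, y). 0 \<le> x \<and> 0 \<le> y \<and> (\<exists>(a, b)\<in>path_graph \<gamma>. x \<le> a \<and> y \<le> b)}"

definition path_area :: "(nat \<times> nat) list \<Rightarrow> real" where
  "path_area \<gamma> = measure lborel (enclosed_region \<gamma>)"

definition large_area_measure :: "real \<Rightarrow> nat \<Rightarrow> (nat \<times> nat) list measure" where
  "large_area_measure l N =
     uniform_measure (path_measure l) {\<gamma> \<in> lattice_paths. path_area \<gamma> \<ge> (real N)\<^sup>2}"


section \<open>Local roughness\<close>

definition path_Ext :: "(nat \<times> nat) list \<Rightarrow> (real \<times> real) set" where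
  "path_Ext \<gamma> = {p. p extreme_point_of (convex hull (set (map real_point \<gamma>) \<union> {(0, 0)}))
                    \<and> p \<noteq> (0, 0)}"

text \<open>
  The extremal points are all visited by the path (lemma \<open>path_Ext_visited\<close>), so they can be listed
  in the order of the path, from left to right and top to bottom. The majorant joins
  consecutive ones; if the path ends with a vertical drop from an extremal point to the
  \<open>x\<close>-axis, that vertical segment belongs to it as well.
\<close>

definition concave_majorant :: "(nat \<times> nat) list \<Rightarrow> (real \<times> real) set" where
  "concave_majorant \<gamma> = polyline (filter (\<lambda>p. p \<in> path_Ext \<gamma>) (map real_point \<gamma>))"

definition local_roughness :: "(nat \<times> nat) list \<Rightarrow> nat \<times> nat \<Rightarrow> real" where
  "local_roughness \<gamma> x = infdist (real_point x) (concave_majorant \<gamma>)"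

definition diagonal :: "(real \<times> real) set" where
  "diagonal = {(x, y). y = x}"

definition is_mid_point :: "(nat \<times> nat) list \<Rightarrow> nat \<times> nat \<Rightarrow> bool" where
  "is_mid_point \<gamma> p \<longleftrightarrow> p \<in> set \<gamma> \<and>
     (\<forall>q\<in>set \<gamma>. infdist (real_point p) diagonal < infdist (real_point q) diagonal \<or>
        infdist (real_point p) diagonal = infdist (real_point q) diagonal \<and> fst p \<le> fst q)"

definition x_mid :: "(nat \<times> nat) list \<Rightarrow> nat \<times> nat" where
  "x_mid \<gamma> = (THE p. is_mid_point \<gamma> p)"

definition mean_LR :: "(nat \<times> nat) list \<Rightarrow> real" where
  "mean_LR \<gamma> = local_roughness \<gamma> (x_mid \<gamma>)"


section \<open>Well-definedness\<close>

lemma path_Ext_visited: "set (filter (\<lambda>p. p \<in> path_Ext \<gamma>) (map real_point \<gamma>)) = path_Ext \<gamma>"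
  using extreme_point_of_convex_hull unfolding path_Ext_def by fastforce

lemma unit_step_diff: "unit_step p q \<Longrightarrow> int (fst q) - int (snd q) = int (fst p) - int (snd p) + 1"
  by (cases p; cases q) (auto simp: unit_step_def)

lemma successively_diff_less:
  assumes "successively unit_step (p # ps)" "q \<in> set ps"
  shows "int (fst p) - int (snd p) < int (fst q) - int (snd q)"
  using assms
proof (induction ps arbitrary: p)
  case (Cons r ps)
  have "int (fst p) - int (snd p) < int (fst r) - int (snd r)"
    using Cons.prems unit_step_diff by fastforce
  then show ?case using Cons by fastforce
qed simp

lemma ex_diagonal_point:
  assumes "successively unit_step (p # ps)" "fst p \<le> snd p" "snd (last (p # ps)) = 0"
  shows "\<exists>q\<in>set (p # ps). fst q = snd q"
  using assms
proof (induction ps arbitrary: p)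
  case (Cons r ps)
  show ?case
  proof (cases "fst p = snd p")
    case False
    moreover have "int (fst r) - int (snd r) = int (fst p) - int (snd p) + 1"
      using Cons.prems unit_step_diff by simp
    ultimately have "fst r \<le> snd r" using Cons.prems(2) by linarith
    then show ?thesis using Cons.IH[of r] Cons.prems by auto
  qed auto
qed auto

lemma diagonal_point_unique:
  assumes "successively unit_step \<gamma>" "p \<in> set \<gamma>" "q \<in> set \<gamma>" "fst p = snd p" "fst q = snd q"
  shows "p = q"
  using assms
proof (induction \<gamma>)
  case (Cons r ps)
  then have "successively unit_step ps" by (cases ps) auto
  with Cons successively_diff_less[of r ps p] successively_diff_less[of r ps q] show ?case
    by auto
qed simp

lemma infdist_diagonal_eq_0: "infdist (real_point p) diagonal = 0 \<longleftrightarrow> fst p = snd p"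
proof -
  have "closed diagonal"
    unfolding diagonal_def case_prod_beta by (intro closed_Collect_eq continuous_intros)
  moreover have "(0, 0) \<in> diagonal" by (simp add: diagonal_def)
  ultimately have "infdist (real_point p) diagonal = 0 \<longleftrightarrow> real_point p \<in> diagonal"
    by (metis in_closed_iff_infdist_zero empty_iff)
  then show ?thesis by (cases p) (auto simp: diagonal_def)
qed

lemma ex1_mid_point:
  assumes "\<gamma> \<in> lattice_paths"
  shows "\<exists>!p. is_mid_point \<gamma> p"
proof -
  obtain p ps where g: "\<gamma> = p # ps"
    using assms by (auto simp: lattice_paths_def neq_Nil_conv)
  then have "successively unit_step (p # ps)" "fst p \<le> snd p" "snd (last (p # ps)) = 0"
    using assms by (simp_all add: lattice_paths_def)
  from ex_diagonal_point[OF this] obtain q where q: "q \<in> set \<gamma>" "fst q = snd q"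
    unfolding g by blast
  have suc: "successively unit_step \<gamma>" using assms by (simp add: lattice_paths_def)
  have uniq: "r = q" if "r \<in> set \<gamma>" "fst r = snd r" for r
    by (rule diagonal_point_unique[OF suc that(1) q(1) that(2) q(2)])
  have q0: "infdist (real_point q) diagonal = 0"
    by (rule infdist_diagonal_eq_0[THEN iffD2, OF q(2)])
  show ?thesis
  proof (rule ex1I[of _ q])
    have "0 < infdist (real_point r) diagonal" if "r \<in> set \<gamma>" "r \<noteq> q" for r
      using uniq[OF that(1)] that(2) infdist_diagonal_eq_0[of r]
        infdist_nonneg[of "real_point r" diagonal] by linarith
    then show "is_mid_point \<gamma> q"
      unfolding is_mid_point_def q0 using q(1) infdist_nonneg by (metis order.refl q0)
  next
    fix r assume r: "is_mid_point \<gamma> r"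
    then have "infdist (real_point r) diagonal \<le> 0"
      unfolding is_mid_point_def q0[symmetric] using q(1) by fastforce
    then have "infdist (real_point r) diagonal = 0"
      using infdist_nonneg[of "real_point r" diagonal] by linarith
    then have "fst r = snd r" by (rule infdist_diagonal_eq_0[THEN iffD1])
    then show "r = q" using uniq r unfolding is_mid_point_def by metis
  qed
qed

lemma card_paths_from:
  defines "S \<equiv> \<lambda>x n. {\<gamma>. length \<gamma> = Suc n \<and> fst (hd \<gamma>) = x \<and> snd (last \<gamma>) = 0 \<and>
                           successively unit_step \<gamma>}"
  shows "finite (S x n) \<and> card (S x n) = 2 ^ n"
proof (induction n arbitrary: x)
  case 0
  have "S x 0 = {[(x, 0)]}" by (auto simp: S_def length_Suc_conv)
  then show ?case by simp
next
  case (Suc n)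
  define f where "f \<gamma> = (x, snd (hd \<gamma>) + 1) # \<gamma>" for \<gamma> :: "(nat \<times> nat) list"
  define g where "g \<gamma> = (x, snd (hd \<gamma>)) # \<gamma>" for \<gamma> :: "(nat \<times> nat) list"
  have "S x (Suc n) = f ` S x n \<union> g ` S (x + 1) n"
  proof (intro equalityI subsetI)
    fix \<gamma> assume a: "\<gamma> \<in> S x (Suc n)"
    then obtain p q ps where g: "\<gamma> = p # q # ps" "length ps = n"
      by (auto simp: S_def length_Suc_conv)
    from a g have "fst p = x" "unit_step p q" by (auto simp: S_def)
    then have "fst q = x \<and> p = (x, snd q + 1) \<or> fst q = x + 1 \<and> p = (x, snd q)"
      by (cases p; cases q) (auto simp: unit_step_def)
    then have "\<gamma> = f (q # ps) \<and> q # ps \<in> S x n \<or> \<gamma> = g (q # ps) \<and> q # ps \<in> S (x + 1) n"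
      using a g by (auto simp: S_def f_def g_def)
    then show "\<gamma> \<in> f ` S x n \<union> g ` S (x + 1) n" by blast
  next
    fix \<gamma> assume "\<gamma> \<in> f ` S x n \<union> g ` S (x + 1) n"
    then show "\<gamma> \<in> S x (Suc n)"
      by (auto simp: S_def f_def g_def length_Suc_conv unit_step_def)
  qed
  moreover have "f ` S x n \<inter> g ` S (x + 1) n = {}"
    by (auto simp: S_def f_def g_def)
  moreover have "inj f" "inj g" by (auto simp: inj_def f_def g_def)
  ultimately show ?case
    using Suc.IH[of x] Suc.IH[of "x + 1"]
    by (simp add: card_Un_disjoint card_image inj_on_subset)
qed

lemma prob_space_path_measure:
  assumes "0 < l" "l < 1 / 2"
  shows "prob_space (path_measure l)"
proof
  define A where "A n = {\<gamma> \<in> lattice_paths. num_steps \<gamma> = n}" for n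
  have A: "A n = {\<gamma>. length \<gamma> = Suc n \<and> fst (hd \<gamma>) = 0 \<and> snd (last \<gamma>) = 0 \<and>
                  successively unit_step \<gamma>}" for n
    by (auto simp: A_def lattice_paths_def num_steps_def)
  have fin: "finite (A n)" and card: "card (A n) = 2 ^ n" for n
    using card_paths_from[of n 0] by (auto simp: A)
  have "emeasure (path_measure l) (A n) = ennreal ((1 - 2 * l) * (2 * l) ^ n)" for n
  proof -
    have "emeasure (path_measure l) (A n) = (\<Sum>\<gamma>\<in>A n. ennreal ((1 - 2 * l) * l ^ num_steps \<gamma>))"
      unfolding path_measure_def
      by (rule emeasure_point_measure_finite2) (use fin in \<open>auto simp: A_def\<close>)
    also have "\<dots> = (\<Sum>\<gamma>\<in>A n. ennreal ((1 - 2 * l) * l ^ n))"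
      by (rule sum.cong) (auto simp: A_def)
    also have "\<dots> = ennreal (\<Sum>\<gamma>\<in>A n. (1 - 2 * l) * l ^ n)"
      using assms by (intro sum_ennreal) auto
    also have "\<dots> = ennreal ((1 - 2 * l) * (2 * l) ^ n)"
      by (simp add: card power_mult_distrib mult_ac)
    finally show ?thesis .
  qed
  moreover have "(\<Sum>n. ennreal ((1 - 2 * l) * (2 * l) ^ n)) = ennreal 1"
  proof (rule suminf_ennreal_eq)
    have "(\<lambda>n. (1 - 2 * l) * (2 * l) ^ n) sums ((1 - 2 * l) * (1 / (1 - 2 * l)))"
      using assms by (intro sums_mult geometric_sums) auto
    then show "(\<lambda>n. (1 - 2 * l) * (2 * l) ^ n) sums 1" using assms by simp
  qed (use assms in auto)
  ultimately have "(\<Sum>n. emeasure (path_measure l) (A n)) = 1" by simp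
  moreover have "(\<Sum>n. emeasure (path_measure l) (A n)) = emeasure (path_measure l) (\<Union>n. A n)"
    by (rule suminf_emeasure)
       (auto simp: A_def path_measure_def sets_point_measure disjoint_family_on_def)
  moreover have "(\<Union>n. A n) = space (path_measure l)"
    by (auto simp: A_def path_measure_def space_point_measure)
  ultimately show "emeasure (path_measure l) (space (path_measure l)) = 1" by simp
qed

end

(*
Conditioning on a large area enters only through two comparisons. Adding k rightward steps at the
beginning and k downward steps at the end of a path raises the square root of its area by at least k
at the price l^(2k); deleting the last downward step and what follows it loses area O(N) and
costs a factor l/(1 - l) < 1. Hence, up to very long paths, the weight of {area >= N^2 + y} is comparable
to exp(-y/N) times the weight of {area >= N^2}, up to constants in the exponent.

Moving q rightward steps from one block of a path to another one multiplies the number of paths by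
a quotient of binomial coefficients. Moves that lose area show that the midpoint of a block
of length n rarely lies g above the chord, namely with probability at most exp(-c g^2/n), provided
that g is large compared with n^2/N. Moves that gain area show that the slope over i steps to the
left of the diagonal exceeds the slope over j steps to the right by order max(i,j)/N, except with
probability exp(-c min(i,j) max(i,j)^2/N^2).

If the local roughness at the diagonal is at least h = t N^(1/3), then some chord of the path passes h
above it. Chaining the midpoint estimate over cells of length of order sqrt(h N) moves the ends of this
chord to grid points, where the slopes contradict the second estimate. This gives exp(-c t^(3/2))
for t <= eps N^(2/3); larger t follow by monotonicity, since t^(6/5) <= N.
*)
theory Submission
  imports Defs "HOL-Real_Asymp.Real_Asymp"
begin

section \<open>Weighted counts of paths\<close>

text \<open>The scales come from balancing two effects. A conditioned path has curvature of order
  1/N, so over d steps it bends by order d^2/N, while a fluctuation g over d steps costs g^2/d in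
  the exponent. A roughness h is therefore decided at d of order sqrt(h N), where the cost h^2/d is
  of order d^3/N^2. For h = t N^(1/3) this is t^(3/2). With d = 2^r, the height appears below as a
  multiple of 4^r/N and the exponent as a multiple of 8^r/N^2.

  The obstacle is that the ends of a chord range over order N^2 pairs, too many for a union bound
  while t stays of constant order. Replacing an end by a grid point produces an error, which the
  allowance h absorbs close to the diagonal and the curvature absorbs farther out.

  Estimates are proved on one side of the diagonal and carried to the other by reflection.\<close>

locale subcritical =
  fixes l :: real
  assumes l_pos: "0 < l" and l_half: "l < 1 / 2"
begin

text \<open>
  A path with \<open>n\<close> steps is encoded by the set \<open>S \<subseteq> {..<n}\<close> of the times of its rightward steps. It starts
  at height \<open>n - card S\<close>, which is also the time at which it meets the diagonal.
\<close>

definition level :: "(nat \<Rightarrow> nat set \<Rightarrow> bool) \<Rightarrow> nat \<Rightarrow> nat set set" where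
  "level P n = {S. S \<subseteq> {..<n} \<and> P n S}"

text \<open>The path measure without its factor 1 - 2 l, written as a series over the number of
  steps so that events can be compared length by length.\<close>

definition wt :: "(nat \<Rightarrow> nat set \<Rightarrow> bool) \<Rightarrow> real" where
  "wt P = (\<Sum>n. l ^ n * real (card (level P n)))"

lemma finite_level [simp]: "finite (level P n)"
  by (rule finite_subset[of _ "Pow {..<n}"]) (auto simp: level_def)

lemma card_level_le: "card (level P n) \<le> 2 ^ n"
  using card_mono[of "Pow {..<n}" "level P n"] by (auto simp: level_def card_Pow)

lemma summable_wt: "summable (\<lambda>n. l ^ n * real (card (level P n)))"
proof (rule summable_comparison_test[OF _ summable_geometric[of "2 * l"]])
  have "norm (l ^ n * real (card (level P n))) \<le> (2 * l) ^ n" for n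
  proof -
    have "real (card (level P n)) \<le> 2 ^ n"
      using card_level_le[of P n] by (metis of_nat_le_iff of_nat_numeral of_nat_power)
    then have "l ^ n * real (card (level P n)) \<le> l ^ n * 2 ^ n"
      using l_pos by (intro mult_left_mono) auto
    then show ?thesis using l_pos by (simp add: power_mult_distrib mult.commute)
  qed
  then show "\<exists>M. \<forall>n\<ge>M. norm (l ^ n * real (card (level P n))) \<le> (2 * l) ^ n" by blast
qed (use l_pos l_half in auto)

lemma wt_nonneg [simp]: "0 \<le> wt P"
  unfolding wt_def using l_pos by (intro suminf_nonneg summable_wt) auto

lemma wt_compare:
  assumes "\<And>n. r * real (card (level P n)) \<le> real (card (level Q (n + k)))"
  shows "r * l ^ k * wt P \<le> wt Q"
proof -
  have "r * l ^ k * wt P = (\<Sum>n. r * l ^ k * (l ^ n * real (card (level P n))))"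
    unfolding wt_def by (intro suminf_mult[symmetric] summable_wt)
  also have "\<dots> \<le> (\<Sum>n. l ^ (n + k) * real (card (level Q (n + k))))"
  proof (intro suminf_le summable_mult summable_wt)
    fix n
    have "r * l ^ k * (l ^ n * real (card (level P n))) = l ^ (n + k) * (r * real (card (level P n)))"
      by (simp add: power_add mult_ac)
    also have "\<dots> \<le> l ^ (n + k) * real (card (level Q (n + k)))"
      using l_pos assms by (intro mult_left_mono) auto
    finally show "r * l ^ k * (l ^ n * real (card (level P n)))
        \<le> l ^ (n + k) * real (card (level Q (n + k)))" .
  next
    show "summable (\<lambda>n. l ^ (n + k) * real (card (level Q (n + k))))"
      using summable_ignore_initial_segment[OF summable_wt[of Q], of k] .
  qed
  also have "\<dots> \<le> wt Q"
  proof -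
    have "wt Q = (\<Sum>n. l ^ (n + k) * real (card (level Q (n + k))))
        + (\<Sum>n<k. l ^ n * real (card (level Q n)))"
      unfolding wt_def by (rule suminf_split_initial_segment[OF summable_wt])
    moreover have "0 \<le> (\<Sum>n<k. l ^ n * real (card (level Q n)))"
      using l_pos by (intro sum_nonneg) auto
    ultimately show ?thesis by linarith
  qed
  finally show ?thesis .
qed

lemma wt_inj:
  assumes "\<And>n. inj_on (f n) (level P n)"
    and "\<And>n S. S \<subseteq> {..<n} \<Longrightarrow> P n S \<Longrightarrow> f n S \<subseteq> {..<n + k} \<and> Q (n + k) (f n S)"
  shows "l ^ k * wt P \<le> wt Q"
proof -
  have "card (level P n) \<le> card (level Q (n + k))" for n
    by (rule card_inj_on_le[OF assms(1)]) (use assms(2) in \<open>auto simp: level_def\<close>)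
  then show ?thesis using wt_compare[of 1 P Q k] by simp
qed

lemma wt_mono:
  assumes "\<And>n S. S \<subseteq> {..<n} \<Longrightarrow> P n S \<Longrightarrow> Q n S"
  shows "wt P \<le> wt Q"
  using wt_inj[of "\<lambda>_ S. S" P 0 Q] assms by simp

lemma wt_disj: "wt (\<lambda>n S. P n S \<or> Q n S) \<le> wt P + wt Q"
proof -
  have "wt P + wt Q = (\<Sum>n. l ^ n * real (card (level P n)) + l ^ n * real (card (level Q n)))"
    unfolding wt_def by (intro suminf_add summable_wt)
  moreover have "wt (\<lambda>n S. P n S \<or> Q n S) \<le> \<dots>"
    unfolding wt_def
  proof (intro suminf_le summable_wt summable_add)
    fix n
    have "level (\<lambda>n S. P n S \<or> Q n S) n = level P n \<union> level Q n" by (auto simp: level_def)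
    then have "card (level (\<lambda>n S. P n S \<or> Q n S) n) \<le> card (level P n) + card (level Q n)"
      by (simp add: card_Un_le)
    then have "real (card (level (\<lambda>n S. P n S \<or> Q n S) n))
        \<le> real (card (level P n)) + real (card (level Q n))" by linarith
    then show "l ^ n * real (card (level (\<lambda>n S. P n S \<or> Q n S) n))
        \<le> l ^ n * real (card (level P n)) + l ^ n * real (card (level Q n))"
      using l_pos by (simp flip: distrib_left)
  qed
  ultimately show ?thesis by simp
qed

lemma wt_False [simp]: "wt (\<lambda>n S. False) = 0"
  by (simp add: wt_def level_def)

lemma wt_absurd:
  assumes "\<And>n S. S \<subseteq> {..<n} \<Longrightarrow> P n S \<Longrightarrow> False" "0 \<le> r"
  shows "wt P \<le> r"
  using wt_mono[of P "\<lambda>n S. False"] assms by force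

lemma wt_Ex:
  assumes "finite I"
  shows "wt (\<lambda>n S. \<exists>i\<in>I. P i n S) \<le> (\<Sum>i\<in>I. wt (P i))"
  using assms
proof (induction I rule: finite_induct)
  case (insert x F)
  have "wt (\<lambda>n S. \<exists>i\<in>insert x F. P i n S) = wt (\<lambda>n S. P x n S \<or> (\<exists>i\<in>F. P i n S))" by simp
  also have "\<dots> \<le> wt (P x) + wt (\<lambda>n S. \<exists>i\<in>F. P i n S)" by (rule wt_disj)
  finally show ?case using insert by simp
qed simp

lemma wt_pos:
  assumes "S \<subseteq> {..<n}" "P n S"
  shows "l ^ n \<le> wt P"
proof -
  have "1 \<le> card (level P n)"
    using assms by (metis (mono_tags, lifting) One_nat_def Suc_leI card_gt_0_iff emptyE finite_level level_def mem_Collect_eq)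
  then have "l ^ n * 1 \<le> l ^ n * real (card (level P n))"
    using l_pos by (intro mult_left_mono) auto
  also have "\<dots> = (\<Sum>i\<in>{n}. l ^ i * real (card (level P i)))" by simp
  also have "\<dots> \<le> wt P"
    unfolding wt_def using l_pos by (intro sum_le_suminf summable_wt) auto
  finally show ?thesis by simp
qed

lemma wt_long: "wt (\<lambda>n S. m \<le> n) \<le> (2 * l) ^ m / (1 - 2 * l)"
proof -
  have "wt (\<lambda>n S. m \<le> n) \<le> (\<Sum>n. if m \<le> n then (2 * l) ^ n else 0)"
    unfolding wt_def
  proof (intro suminf_le summable_wt)
    fix n
    show "l ^ n * real (card (level (\<lambda>n S. m \<le> n) n)) \<le> (if m \<le> n then (2 * l) ^ n else 0)"
    proof (cases "m \<le> n")
      case True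
      then have "level (\<lambda>n S. m \<le> n) n = Pow {..<n}" by (auto simp: level_def)
      then show ?thesis using True by (simp add: card_Pow power_mult_distrib mult.commute)
    qed (simp add: level_def)
  next
    show "summable (\<lambda>n. if m \<le> n then (2 * l) ^ n else 0)"
      by (rule summable_comparison_test[OF _ summable_geometric[of "2 * l"]])
         (use l_pos l_half in auto)
  qed
  also have "\<dots> = (2 * l) ^ m / (1 - 2 * l)"
  proof -
    let ?f = "\<lambda>n. if m \<le> n then (2 * l) ^ n else 0 :: real"
    have "(\<lambda>n. (2 * l) ^ m * (2 * l) ^ n) sums ((2 * l) ^ m * (1 / (1 - 2 * l)))"
      using l_pos l_half by (intro sums_mult geometric_sums) auto
    then have "(\<lambda>n. ?f (n + m)) sums ((2 * l) ^ m / (1 - 2 * l))"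
      by (simp add: power_add mult.commute)
    then have "?f sums ((2 * l) ^ m / (1 - 2 * l) + (\<Sum>i<m. ?f i))"
      using sums_iff_shift[of ?f m] by blast
    then show ?thesis by (simp add: sums_iff)
  qed
  finally show ?thesis .
qed

end

section \<open>The area in terms of the step set\<close>

text \<open>Summation over columns: the column below the rightward step at time k is as high as the
  number of downward steps still to come.\<close>

definition area :: "nat \<Rightarrow> nat set \<Rightarrow> real" where
  "area n S = (\<Sum>k\<in>S. real (card ({k..<n} - S)))"

lemma sum_card_above:
  fixes S :: "nat set"
  assumes "finite S"
  shows "2 * (\<Sum>k\<in>S. card {x\<in>S. k \<le> x}) = card S * (card S + 1)"
  using assms
proof (induction rule: finite_linorder_max_induct)
  case (insert b A)
  have "(\<Sum>k\<in>insert b A. card {x \<in> insert b A. k \<le> x})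
      = card {x \<in> insert b A. b \<le> x} + (\<Sum>k\<in>A. card {x \<in> insert b A. k \<le> x})"
    using insert by (subst sum.insert) auto
  also have "{x \<in> insert b A. b \<le> x} = {b}" using insert by auto
  also have "(\<Sum>k\<in>A. card {x \<in> insert b A. k \<le> x}) = (\<Sum>k\<in>A. card {x \<in> A. k \<le> x} + 1)"
  proof (rule sum.cong)
    fix k assume k: "k \<in> A"
    then have "{x \<in> insert b A. k \<le> x} = insert b {x \<in> A. k \<le> x}" using insert by fastforce
    then show "card {x \<in> insert b A. k \<le> x} = card {x \<in> A. k \<le> x} + 1" using insert by auto
  qed simp
  finally have "(\<Sum>k\<in>insert b A. card {x \<in> insert b A. k \<le> x})
      = 1 + ((\<Sum>k\<in>A. card {x \<in> A. k \<le> x}) + card A)"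
    by (simp only: sum.distrib) simp
  moreover have "card (insert b A) = card A + 1" using insert by auto
  ultimately show ?case using insert.IH by (simp only:) (simp add: algebra_simps)
qed simp

text \<open>The column at k has height n - k minus the number of rightward steps from time k on, and
  these numbers run through 1, ..., \<open>card S\<close>. In this form the area depends on S only
  through its cardinality and its sum, so moving steps changes it linearly.\<close>

lemma area_formula:
  assumes "S \<subseteq> {..<n}"
  shows "area n S = real (card S) * real n - real (\<Sum>S) - real (card S * (card S + 1)) / 2"
proof -
  have fin: "finite S" using assms finite_subset by blast
  have "real (card ({k..<n} - S)) = real n - real k - real (card {x\<in>S. k \<le> x})" if "k \<in> S" for k
  proof -
    have "{k..<n} - S = {k..<n} - {x\<in>S. k \<le> x}" by auto
    moreover have sub: "{x\<in>S. k \<le> x} \<subseteq> {k..<n}" using assms by auto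
    ultimately have "card ({k..<n} - S) = (n - k) - card {x\<in>S. k \<le> x}"
      using fin by (simp add: card_Diff_subset)
    moreover have "card {x\<in>S. k \<le> x} \<le> n - k" using card_mono[OF _ sub] by simp
    moreover have "k \<le> n" using that assms by auto
    ultimately show ?thesis by simp
  qed
  then have "area n S = (\<Sum>k\<in>S. real n - real k - real (card {x\<in>S. k \<le> x}))"
    unfolding area_def by (intro sum.cong) auto
  also have "\<dots> = real (card S) * real n - real (\<Sum>S) - real (\<Sum>k\<in>S. card {x\<in>S. k \<le> x})"
    by (simp add: sum_subtractf)
  also have "real (\<Sum>k\<in>S. card {x\<in>S. k \<le> x}) = real (card S * (card S + 1)) / 2"
    using arg_cong[OF sum_card_above[OF fin], of real] by (simp only: of_nat_mult of_nat_numeral)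
  finally show ?thesis .
qed

lemma card_compl:
  assumes "S \<subseteq> {..<n}"
  shows "card ({..<n} - S) = n - card S" "card S \<le> n"
  using assms card_mono[of "{..<n}" S] by (auto simp: card_Diff_subset finite_subset)

lemma area_le_rectangle:
  assumes "S \<subseteq> {..<n}"
  shows "area n S \<le> real (card S) * real (n - card S)"
proof -
  have "area n S \<le> (\<Sum>k\<in>S. real (n - card S))"
    unfolding area_def
    by (intro sum_mono of_nat_mono) (metis card_compl(1)[OF assms] Diff_mono atLeastLessThan_iff card_mono finite_Diff finite_lessThan lessThan_iff subsetI order_refl)
  then show ?thesis by simp
qed

lemma area_nonneg: "0 \<le> area n S"
  unfolding area_def by (intro sum_nonneg) auto

section \<open>Modifications that change the area\<close>

text \<open>The reflection of the path in the diagonal: time runs backwards, and the complement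
  appears because rightward and downward steps change roles.\<close>

definition mirror :: "nat \<Rightarrow> nat set \<Rightarrow> nat set" where
  "mirror n S = (\<lambda>k. n - 1 - k) ` ({..<n} - S)"

lemma mirror_subset: "mirror n S \<subseteq> {..<n}"
  by (auto simp: mirror_def)

lemma mem_mirror: "k < n \<Longrightarrow> k \<in> mirror n S \<longleftrightarrow> n - 1 - k \<notin> S"
  unfolding mirror_def
proof (safe elim!: imageE)
  assume "k < n" "n - 1 - k \<notin> S"
  then show "k \<in> (\<lambda>k. n - 1 - k) ` ({..<n} - S)"
    by (intro image_eqI[of _ _ "n - 1 - k"]) auto
qed auto

lemma mirror_mirror: "S \<subseteq> {..<n} \<Longrightarrow> mirror n (mirror n S) = S"
proof (rule set_eqI)
  fix k assume S: "S \<subseteq> {..<n}"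
  show "k \<in> mirror n (mirror n S) \<longleftrightarrow> k \<in> S"
  proof (cases "k < n")
    case True
    then have "n - 1 - (n - 1 - k) = k" "n - 1 - k < n" by auto
    then show ?thesis using True by (simp add: mem_mirror)
  next
    case False
    then show ?thesis using S mirror_subset by blast
  qed
qed

lemma inj_on_reflect: "inj_on (\<lambda>k::nat. n - 1 - k) {..<n}"
  by (auto simp: inj_on_def)

lemma card_mirror: "S \<subseteq> {..<n} \<Longrightarrow> card (mirror n S) = n - card S"
  unfolding mirror_def
  by (subst card_image, rule inj_on_subset[OF inj_on_reflect]) (auto simp: card_compl(1))

lemma area_mirror:
  assumes "S \<subseteq> {..<n}"
  shows "area n (mirror n S) = area n S"
proof -
  have fin: "finite S" using assms finite_subset by blast
  have "real (\<Sum>(mirror n S)) = (\<Sum>k\<in>{..<n} - S. real (n - 1 - k))"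
    unfolding mirror_def
    by (subst sum.reindex[OF inj_on_subset[OF inj_on_reflect]]) auto
  also have "\<dots> = (\<Sum>k\<in>{..<n} - S. real n - 1 - real k)"
    by (intro sum.cong) auto
  also have "\<dots> = (\<Sum>k<n. real n - 1 - real k) - (\<Sum>k\<in>S. real n - 1 - real k)"
    by (rule sum_diff) (use assms in auto)
  also have "(\<Sum>k<n. real n - 1 - real k) = real n * (real n - 1) / 2"
    by (induction n) (auto simp: field_simps sum.distrib sum_subtractf)
  also have "(\<Sum>k\<in>S. real n - 1 - real k) = real (card S) * (real n - 1) - real (\<Sum>S)"
    by (simp add: sum_subtractf)
  finally have s: "real (\<Sum>(mirror n S))
      = real n * (real n - 1) / 2 - (real (card S) * (real n - 1) - real (\<Sum>S))" .
  have c: "real (card (mirror n S)) = real n - real (card S)"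
    using card_mirror[OF assms] card_compl(2)[OF assms] by simp
  show ?thesis
    unfolding area_formula[OF assms] area_formula[OF mirror_subset] s of_nat_mult of_nat_add c
    by (simp add: field_simps)
qed

text \<open>The new set encodes j rightward steps, the old path, and j downward steps, the last j
  times being absent from it. The old columns grow by j, and each new one has height n -
  \<open>card S\<close> + j.\<close>

lemma area_extend:
  assumes "S \<subseteq> {..<n}"
  shows "area (n + 2 * j) ({..<j} \<union> (+) j ` S) = area n S + real j * real n + (real j)\<^sup>2"
proof -
  have fin: "finite S" using assms finite_subset by blast
  have sub: "{..<j} \<union> (+) j ` S \<subseteq> {..<n + 2 * j}" using assms by auto
  have disj: "{..<j} \<inter> (+) j ` S = {}" by auto
  have c: "card ({..<j} \<union> (+) j ` S) = j + card S"
    using fin disj by (simp add: card_Un_disjoint card_image)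
  have "\<Sum>({..<j} \<union> (+) j ` S) = \<Sum>{..<j} + (\<Sum>k\<in>S. j + k)"
    using fin disj by (subst sum.union_disjoint) (auto simp: sum.reindex)
  moreover have "real (\<Sum>{..<j}) = real j * (real j - 1) / 2"
    by (induction j) (auto simp: field_simps)
  ultimately have s: "real (\<Sum>({..<j} \<union> (+) j ` S))
      = real j * (real j - 1) / 2 + real j * real (card S) + real (\<Sum>S)"
    by (simp add: sum.distrib)
  show ?thesis
    unfolding area_formula[OF assms] area_formula[OF sub] s c of_nat_mult of_nat_add
    by (simp add: field_simps power2_eq_square)
qed

text \<open>The arithmetic-geometric mean inequality for the sides of the bounding rectangle, whose
  lengths add up to n.\<close>

lemma area_le_length:
  assumes "S \<subseteq> {..<n}"
  shows "2 * sqrt (area n S) \<le> real n"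
proof -
  have c: "card S \<le> n" by (rule card_compl(2)[OF assms])
  define a b where "a = real (card S)" and "b = real (n - card S)"
  have "4 * area n S \<le> 4 * (a * b)" using area_le_rectangle[OF assms] by (simp add: a_def b_def)
  also have "\<dots> \<le> (a + b)\<^sup>2" using zero_le_power2[of "a - b"] by (simp add: power2_eq_square algebra_simps)
  also have "a + b = real n" using c by (simp add: a_def b_def)
  finally have "sqrt (4 * area n S) \<le> real n" by (metis of_nat_0_le_iff real_le_lsqrt)
  then show ?thesis by (simp add: real_sqrt_mult)
qed

text \<open>The downward step at time m raises every column by one; the rightward steps after it run
  along the x-axis and enclose nothing.\<close>

lemma area_append_row:
  assumes "S \<subseteq> {..<m}"
  shows "area (m + Suc i) (S \<union> {Suc m..<m + Suc i}) = area m S + real (card S)"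
proof -
  have fin: "finite S" using assms finite_subset by blast
  let ?T = "S \<union> {Suc m..<m + Suc i}"
  have "area (m + Suc i) ?T = (\<Sum>k\<in>S. real (card ({k..<m + Suc i} - ?T)))
      + (\<Sum>k\<in>{Suc m..<m + Suc i}. real (card ({k..<m + Suc i} - ?T)))"
    unfolding area_def by (rule sum.union_disjoint) (use assms fin in auto)
  also have "(\<Sum>k\<in>{Suc m..<m + Suc i}. real (card ({k..<m + Suc i} - ?T))) = 0"
    by (intro sum.neutral) (auto simp: card_eq_0_iff)
  also have "(\<Sum>k\<in>S. real (card ({k..<m + Suc i} - ?T))) = (\<Sum>k\<in>S. real (card ({k..<m} - S)) + 1)"
  proof (rule sum.cong)
    fix k assume "k \<in> S"
    then have "{k..<m + Suc i} - ?T = insert m ({k..<m} - S)" using assms by fastforce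
    then show "real (card ({k..<m + Suc i} - ?T)) = real (card ({k..<m} - S)) + 1" by simp
  qed simp
  finally show ?thesis by (simp add: area_def sum.distrib)
qed

section \<open>The price of losing and of gaining area\<close>

context subcritical
begin

text \<open>The upper-bound counterpart of \<open>wt_inj\<close>: sets satisfying \<open>Q\<close>
  are covered by images of sets satisfying \<open>P\<close> that are k steps shorter.\<close>

lemma wt_shift_le:
  assumes "\<And>n S. S \<subseteq> {..<n} \<Longrightarrow> Q n S \<Longrightarrow> \<exists>m T. n = m + k \<and> T \<subseteq> {..<m} \<and> P m T \<and> S = f m T"
  shows "wt Q \<le> l ^ k * wt P"
proof -
  have low: "level Q n = {}" if "n < k" for n
    using assms[of _ n] that by (force simp: level_def)
  have "level Q (m + k) \<subseteq> f m ` level P m" for m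
  proof
    fix S assume "S \<in> level Q (m + k)"
    then obtain m' T where "m + k = m' + k" "T \<subseteq> {..<m'}" "P m' T" "S = f m' T"
      using assms[of S "m + k"] unfolding level_def by blast
    then show "S \<in> f m ` level P m" by (auto simp: level_def)
  qed
  then have c: "card (level Q (m + k)) \<le> card (level P m)" for m
    by (meson card_image_le card_mono finite_imageI finite_level order_trans)
  have "wt Q = (\<Sum>n. l ^ (n + k) * real (card (level Q (n + k))))
      + (\<Sum>n<k. l ^ n * real (card (level Q n)))"
    unfolding wt_def by (rule suminf_split_initial_segment[OF summable_wt])
  also have "(\<Sum>n<k. l ^ n * real (card (level Q n))) = 0"
    by (intro sum.neutral) (simp add: low)
  also have "(\<Sum>n. l ^ (n + k) * real (card (level Q (n + k)))) + 0
      \<le> (\<Sum>n. l ^ k * (l ^ n * real (card (level P n))))"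
    unfolding add_0_right
  proof (intro suminf_le summable_mult summable_wt)
    fix n
    have "l ^ (n + k) * real (card (level Q (n + k))) \<le> l ^ (n + k) * real (card (level P n))"
      using c[of n] l_pos by (intro mult_left_mono) auto
    then show "l ^ (n + k) * real (card (level Q (n + k))) \<le> l ^ k * (l ^ n * real (card (level P n)))"
      by (simp add: power_add mult_ac)
  qed (rule summable_ignore_initial_segment[OF summable_wt])
  also have "\<dots> = l ^ k * wt P"
    unfolding wt_def by (intro suminf_mult summable_wt)
  finally show ?thesis .
qed

text \<open>The normalisation of the conditioned measure, up to the factor 1 - 2 l. All later bounds
  are relative to it.\<close>

definition Z :: "nat \<Rightarrow> real" where
  "Z N = wt (\<lambda>n S. (real N)\<^sup>2 \<le> area n S)"

lemma wt_mirror: "wt (\<lambda>n S. P n (mirror n S)) \<le> wt P"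
proof -
  have "inj_on (mirror n) (level (\<lambda>n S. P n (mirror n S)) n)" for n
    by (rule inj_on_inverseI[of _ "mirror n"]) (auto simp: mirror_mirror level_def)
  from wt_inj[OF this, of 0 P] show ?thesis using mirror_subset by simp
qed

text \<open>Already the N by N square contributes this much.\<close>

lemma Z_lower: "l ^ (2 * N) \<le> Z N"
proof -
  have "area (2 * N) {..<N} = (\<Sum>k<N. real N)"
    unfolding area_def
  proof (rule sum.cong)
    fix k assume "k \<in> {..<N}"
    then have "{k..<2 * N} - {..<N} = {N..<2 * N}" by auto
    then show "real (card ({k..<2 * N} - {..<N})) = real N" by simp
  qed simp
  then show ?thesis
    unfolding Z_def by (intro wt_pos[of "{..<N}"]) (auto simp: power2_eq_square)
qed

lemma Z_pos: "0 < Z N"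
  using Z_lower[of N] l_pos by (meson less_le_trans zero_less_power)

lemma wt_le_Z: "wt (\<lambda>n S. (real N)\<^sup>2 \<le> area n S \<and> P n S) \<le> Z N"
  unfolding Z_def by (rule wt_mono) auto

text \<open>The extension by k steps at both ends gains k n + k^2. As n is at least twice the square
  root of the area, this completes the square.\<close>

lemma wt_smaller_area:
  assumes "k \<le> N"
  shows "l ^ (2 * k) * wt (\<lambda>n S. (real N - real k)\<^sup>2 \<le> area n S) \<le> Z N"
  unfolding Z_def
proof (rule wt_inj[where f = "\<lambda>n S. {..<k} \<union> (+) k ` S"])
  show "inj_on (\<lambda>S. {..<k} \<union> (+) k ` S) (level P n)" for n P
  proof (rule inj_on_inverseI[of _ "\<lambda>T. {i. i + k \<in> T}"])
    fix S show "{i. i + k \<in> {..<k} \<union> (+) k ` S} = S" by (auto simp: add.commute)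
  qed
  fix n S assume S: "S \<subseteq> {..<n}" and A: "(real N - real k)\<^sup>2 \<le> area n S"
  have sub: "{..<k} \<union> (+) k ` S \<subseteq> {..<n + 2 * k}" using S by auto
  have "real N - real k \<le> sqrt (area n S)" using A by (rule real_le_rsqrt)
  then have "(real N)\<^sup>2 \<le> (sqrt (area n S) + real k)\<^sup>2" by (intro power_mono) auto
  also have "\<dots> = area n S + real k * (2 * sqrt (area n S)) + (real k)\<^sup>2"
    using area_nonneg[of n S] by (simp add: power2_sum)
  also have "\<dots> \<le> area n S + real k * real n + (real k)\<^sup>2"
    using area_le_length[OF S] by (simp add: mult_left_mono)
  finally show "{..<k} \<union> (+) k ` S \<subseteq> {..<n + 2 * k} \<and>
      (real N)\<^sup>2 \<le> area (n + 2 * k) ({..<k} \<union> (+) k ` S)"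
    using sub by (simp add: area_extend[OF S])
qed

lemma wt_area_loss:
  assumes "1 \<le> N" "0 \<le> y"
  shows "wt (\<lambda>n S. (real N)\<^sup>2 - y \<le> area n S) \<le> exp (2 * ln (1 / l) * (y / N + 1)) * Z N"
proof -
  \<comment> \<open>For k <= N, lowering N by k lowers its square by at least k N, so y / N rounded
    up is enough. The cap at N serves losses beyond N^2, where the enlarged event contains every
    path.\<close>
  define k where "k = min N (nat \<lceil>y / N\<rceil>)"
  have k: "k \<le> N" by (simp add: k_def)
  have k_le: "real k \<le> y / N + 1"
  proof -
    have "0 \<le> y / N" using assms by simp
    then have "real (nat \<lceil>y / N\<rceil>) \<le> y / N + 1" by linarith
    then show ?thesis by (simp add: k_def min_def)
  qed
  have imp: "(real N - real k)\<^sup>2 \<le> area n S" if "(real N)\<^sup>2 - y \<le> area n S" for n S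
  proof (cases "k = N")
    case False
    then have "y / N \<le> real k" unfolding k_def by linarith
    then have "y \<le> real k * real N" using assms by (simp add: field_simps)
    moreover have "real k * real k \<le> real k * real N" using k by (intro mult_left_mono) auto
    ultimately show ?thesis using that by (simp add: power2_eq_square algebra_simps)
  qed (simp add: area_nonneg)
  have "l ^ (2 * k) * wt (\<lambda>n S. (real N)\<^sup>2 - y \<le> area n S)
      \<le> l ^ (2 * k) * wt (\<lambda>n S. (real N - real k)\<^sup>2 \<le> area n S)"
    using l_pos imp by (intro mult_left_mono wt_mono) auto
  also have "\<dots> \<le> Z N" by (rule wt_smaller_area[OF k])
  finally have "wt (\<lambda>n S. (real N)\<^sup>2 - y \<le> area n S) \<le> 1 / l ^ (2 * k) * Z N"
    using l_pos by (simp add: field_simps)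
  also have "1 / l ^ (2 * k) = exp (2 * ln (1 / l) * real k)"
  proof -
    have "2 * ln (1 / l) * real k = ln (1 / l) * real (2 * k)" by simp
    then have "exp (2 * ln (1 / l) * real k) = exp (ln (1 / l)) ^ (2 * k)"
      by (simp only: exp_of_nat2_mult)
    also have "exp (ln (1 / l)) = 1 / l" using l_pos by (intro exp_ln) auto
    finally show ?thesis by (simp add: power_one_over)
  qed
  also have "exp (2 * ln (1 / l) * real k) * Z N \<le> exp (2 * ln (1 / l) * (y / N + 1)) * Z N"
    using k_le l_pos l_half Z_pos[of N] by (intro mult_right_mono) (auto simp: ln_div)
  finally show ?thesis .
qed

text \<open>The sum of l^(i + 1) over all i, that is, the weight of one downward step with any
  number of rightward steps behind it. It is below 1 because l < 1/2.\<close>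

definition rho :: real where "rho = l / (1 - l)"

lemma rho: "0 < rho" "rho < 1"
  using l_pos l_half by (auto simp: rho_def)

text \<open>Cutting the path at its last downward step removes the bottom row, whose length
  \<open>card T\<close> is at most M thanks to the bound on the number of steps. The removed piece
  is determined by its number i of rightward steps.\<close>

lemma wt_remove_row:
  assumes "0 \<le> x" "1 \<le> M"
  shows "wt (\<lambda>n S. x + real M \<le> area n S \<and> n \<le> M) \<le> rho * wt (\<lambda>n S. x \<le> area n S \<and> n \<le> M)"
proof -
  define Q where "Q i n S \<longleftrightarrow> (\<exists>m T. n = m + Suc i \<and> T \<subseteq> {..<m} \<and> (x \<le> area m T \<and> m \<le> M)
      \<and> S = T \<union> {Suc m..<m + Suc i})" for i n S
  have "\<exists>i\<in>{..<M}. Q i n S" if S: "S \<subseteq> {..<n}" and A: "x + real M \<le> area n S" and n: "n \<le> M" for n S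
  proof -
    have "{..<n} - S \<noteq> {}"
    proof
      assume "{..<n} - S = {}"
      then have "card S = n" using S by (metis Diff_eq_empty_iff card_lessThan subset_antisym)
      then have "area n S \<le> 0" using area_le_rectangle[OF S] by simp
      then show False using A assms by linarith
    qed
    then obtain m where m: "m \<in> {..<n} - S" "\<And>k. k \<in> {..<n} - S \<Longrightarrow> k \<le> m"
      using Max_in[of "{..<n} - S"] Max_ge[of "{..<n} - S"] by blast
    define T i where "T = S \<inter> {..<m}" and "i = n - Suc m"
    have ni: "n = m + Suc i" using m by (auto simp: i_def)
    have ST: "S = T \<union> {Suc m..<m + Suc i}"
    proof (rule set_eqI)
      fix k
      have "k \<in> S" if "Suc m \<le> k" "k < n" using m(2)[of k] that by force
      moreover have "k \<noteq> m" if "k \<in> S" using m(1) that by auto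
      moreover have "k < n" if "k \<in> S" using S that by auto
      ultimately show "k \<in> S \<longleftrightarrow> k \<in> T \<union> {Suc m..<m + Suc i}"
        unfolding T_def ni by auto
    qed
    have T: "T \<subseteq> {..<m}" by (auto simp: T_def)
    have "card T \<le> M" using card_compl(2)[OF T] ni n by linarith
    moreover have "area n S = area m T + real (card T)"
      using area_append_row[OF T, of i] ST ni by metis
    ultimately have "x \<le> area m T" using A by linarith
    moreover have "i < M" "m \<le> M" using ni n by auto
    ultimately show ?thesis using ni ST T unfolding Q_def by blast
  qed
  then have "wt (\<lambda>n S. x + real M \<le> area n S \<and> n \<le> M) \<le> wt (\<lambda>n S. \<exists>i\<in>{..<M}. Q i n S)"
    by (intro wt_mono) auto
  also have "\<dots> \<le> (\<Sum>i<M. wt (Q i))" by (rule wt_Ex) simp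
  also have "\<dots> \<le> (\<Sum>i<M. l ^ Suc i * wt (\<lambda>n S. x \<le> area n S \<and> n \<le> M))"
  proof (rule sum_mono)
    fix i
    show "wt (Q i) \<le> l ^ Suc i * wt (\<lambda>n S. x \<le> area n S \<and> n \<le> M)"
      by (rule wt_shift_le[where f = "\<lambda>m T. T \<union> {Suc m..<m + Suc i}"]) (simp add: Q_def)
  qed
  also have "\<dots> = l * (\<Sum>i<M. l ^ i) * wt (\<lambda>n S. x \<le> area n S \<and> n \<le> M)"
    by (simp add: sum_distrib_left sum_distrib_right)
  also have "\<dots> \<le> rho * wt (\<lambda>n S. x \<le> area n S \<and> n \<le> M)"
  proof (rule mult_right_mono)
    have "(\<Sum>i<M. l ^ i) = (1 - l ^ M) / (1 - l)"
      using l_half by (subst sum_gp_strict) auto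
    also have "\<dots> \<le> 1 / (1 - l)" using l_pos l_half by (intro divide_right_mono) auto
    finally have "l * (\<Sum>i<M. l ^ i) \<le> l * (1 / (1 - l))"
      using l_pos by (intro mult_left_mono) auto
    then show "l * (\<Sum>i<M. l ^ i) \<le> rho" by (simp add: rho_def)
  qed simp
  finally show ?thesis .
qed

lemma wt_remove_rows:
  assumes "0 \<le> x" "1 \<le> M"
  shows "wt (\<lambda>n S. x + real j * real M \<le> area n S \<and> n \<le> M)
    \<le> rho ^ j * wt (\<lambda>n S. x \<le> area n S \<and> n \<le> M)"
proof (induction j)
  case (Suc j)
  have "wt (\<lambda>n S. x + real (Suc j) * real M \<le> area n S \<and> n \<le> M)
      = wt (\<lambda>n S. (x + real j * real M) + real M \<le> area n S \<and> n \<le> M)"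
    by (simp add: algebra_simps)
  also have "\<dots> \<le> rho * wt (\<lambda>n S. x + real j * real M \<le> area n S \<and> n \<le> M)"
    using assms by (intro wt_remove_row) auto
  also have "\<dots> \<le> rho * (rho ^ j * wt (\<lambda>n S. x \<le> area n S \<and> n \<le> M))"
    using Suc rho by (intro mult_left_mono) auto
  finally show ?case by simp
qed simp

lemma wt_area_gain:
  assumes "0 \<le> y" "1 \<le> M"
  shows "wt (\<lambda>n S. (real N)\<^sup>2 + y \<le> area n S \<and> n \<le> M) \<le> exp (ln (1 / rho) * (1 - y / M)) * Z N"
proof -
  define j where "j = nat \<lfloor>y / M\<rfloor>"
  have "0 \<le> y / M" using assms by simp
  then have j: "real j \<le> y / M" "y / M - 1 \<le> real j" unfolding j_def by linarith+
  then have "real j * real M \<le> y" using assms by (simp add: field_simps)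
  then have "wt (\<lambda>n S. (real N)\<^sup>2 + y \<le> area n S \<and> n \<le> M)
      \<le> wt (\<lambda>n S. (real N)\<^sup>2 + real j * real M \<le> area n S \<and> n \<le> M)"
    by (intro wt_mono) auto
  also have "\<dots> \<le> rho ^ j * wt (\<lambda>n S. (real N)\<^sup>2 \<le> area n S \<and> n \<le> M)"
    using assms by (intro wt_remove_rows) auto
  also have "\<dots> \<le> rho ^ j * Z N" using rho wt_le_Z by (intro mult_left_mono) auto
  also have "rho ^ j = exp (ln rho * real j)"
    using rho by (simp add: exp_of_nat2_mult)
  also have "\<dots> * Z N \<le> exp (ln (1 / rho) * (1 - y / M)) * Z N"
  proof (rule mult_right_mono)
    have "ln (1 / rho) * (y / M - 1) \<le> ln (1 / rho) * real j"
      using j rho by (intro mult_left_mono) auto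
    then show "exp (ln rho * real j) \<le> exp (ln (1 / rho) * (1 - y / M))"
      using rho by (simp add: ln_div algebra_simps)
  qed (use Z_pos[of N] in auto)
  finally show ?thesis .
qed

lemma ex_length_cutoff:
  "\<exists>K::nat. 1 \<le> K \<and> (\<forall>N\<ge>1. wt (\<lambda>n S. K * N < n) \<le> exp (- real N) / (1 - 2 * l) * Z N)"
proof -
  have "(\<lambda>k. (2 * l) ^ k) \<longlonglongrightarrow> 0" using l_pos l_half by (intro LIMSEQ_realpow_zero) auto
  \<comment> \<open>The factor l^2 is matched to the lower bound l^(2 N) for \<open>Z N\<close>, and
    exp (-1) leaves a decay exp (-N) to spare.\<close>
  moreover have "0 < l\<^sup>2 * exp (- 1)" using l_pos by simp
  ultimately have "\<forall>\<^sub>F k in sequentially. (2 * l) ^ k < l\<^sup>2 * exp (- 1)"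
    by (rule order_tendstoD(2))
  then obtain K where K: "1 \<le> K" "(2 * l) ^ K < l\<^sup>2 * exp (- 1)"
    unfolding eventually_sequentially by (metis max.cobounded1 max.cobounded2)
  have "wt (\<lambda>n S. K * N < n) \<le> exp (- real N) / (1 - 2 * l) * Z N" for N
  proof -
    have "wt (\<lambda>n S. K * N < n) \<le> wt (\<lambda>n S. K * N \<le> n)" by (rule wt_mono) auto
    also have "\<dots> \<le> (2 * l) ^ (K * N) / (1 - 2 * l)" by (rule wt_long)
    also have "(2 * l) ^ (K * N) = ((2 * l) ^ K) ^ N" by (simp add: power_mult)
    also have "\<dots> \<le> (l\<^sup>2 * exp (- 1)) ^ N" using K l_pos by (intro power_mono) auto
    also have "\<dots> = l ^ (2 * N) * exp (- real N)"
      by (simp add: power_mult_distrib power_mult exp_of_nat_mult[symmetric])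
    also have "\<dots> \<le> Z N * exp (- real N)" by (intro mult_right_mono Z_lower) auto
    finally show ?thesis using l_half by (simp add: divide_right_mono mult.commute)
  qed
  then show ?thesis using K by blast
qed

end

section \<open>Exchanging steps between two blocks\<close>

text \<open>Factor by factor in the product formula: A - i >= A - q >= r B >= r (B - i) for i <
  q.\<close>

lemma binomial_ratio_le:
  fixes r :: real
  assumes "0 \<le> r" "r * real B \<le> real A - real q"
  shows "r ^ q * real (B choose q) \<le> real (A choose q)"
proof (cases "q \<le> B")
  case True
  have qA: "q \<le> A" using assms mult_nonneg_nonneg[of r "real B"] by linarith
  have "r ^ q * real (B choose q) = (\<Prod>i = 0..<q. r * (real (B - i) / real (q - i)))"
    using True by (simp only: binomial_altdef_of_nat prod.distrib) simp
  also have "\<dots> \<le> (\<Prod>i = 0..<q. real (A - i) / real (q - i))"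
  proof (rule prod_mono, intro conjI)
    fix i assume i: "i \<in> {0..<q}"
    show "0 \<le> r * (real (B - i) / real (q - i))" using assms by simp
    have "r * real (B - i) \<le> r * real B" using assms by (intro mult_left_mono) auto
    also have "\<dots> \<le> real (A - i)" using assms i qA by (simp add: of_nat_diff)
    finally show "r * (real (B - i) / real (q - i)) \<le> real (A - i) / real (q - i)"
      by (simp add: divide_right_mono)
  qed
  also have "\<dots> = real (A choose q)" using qA by (simp only: binomial_altdef_of_nat)
  finally show ?thesis .
qed (simp add: binomial_eq_0)

text \<open>
  Double counting of the moves from \<open>S\<close> to \<open>(S - T) \<union> U\<close>: the binomial coefficients in the last
  assumption count the moves that end in a given set.
\<close>

lemma exchange_count:
  fixes X Y :: "nat set set" and I J I' J' :: "nat set \<Rightarrow> nat set" and r :: real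
  assumes X: "finite X" and Y: "finite Y" and r: "0 < r"
    and fin: "\<And>S. S \<in> X \<Longrightarrow> finite S \<and> finite (I S) \<and> finite (J S) \<and> I S \<inter> J S = {}"
    and moves: "\<And>S T U. S \<in> X \<Longrightarrow> (T, U) \<in> moves S \<Longrightarrow>
      T \<subseteq> S \<inter> I S \<and> card T = p \<and> U \<subseteq> J S - S \<and> card U = q"
    and target: "\<And>S T U. S \<in> X \<Longrightarrow> (T, U) \<in> moves S \<Longrightarrow>
      (S - T) \<union> U \<in> Y \<and> I' ((S - T) \<union> U) = I S \<and> J' ((S - T) \<union> U) = J S"
    and many: "\<And>S. S \<in> X \<Longrightarrow>
      r * real ((card (I S - S) + p choose p) * (card (J S \<inter> S) + q choose q)) \<le> real (card (moves S))"
  shows "r * real (card X) \<le> real (card Y)"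
proof -
  define g where "g = (\<lambda>(S :: nat set, T, U). (S - T) \<union> U)"
  define R where "R = (SIGMA S:X. moves S)"
  \<comment> \<open>The number of candidates for a reverse move: T is chosen among the absent times
    of the first block, U among the present times of the second. \<open>I'\<close> and
    \<open>J'\<close> recover the blocks from the modified set, whose cardinality may have
    changed.\<close>
  define d where "d S = real ((card (I' S - S) choose p) * (card (J' S \<inter> S) choose q))" for S
  have fin_moves: "finite (moves S)" if "S \<in> X" for S
  proof (rule finite_subset)
    show "moves S \<subseteq> Pow S \<times> Pow (J S)" using moves[OF that] by fastforce
  qed (use fin[OF that] in auto)
  have finR: "finite R" unfolding R_def using X fin_moves by auto
  have d_eq: "d ((S - T) \<union> U)
      = real ((card (I S - S) + p choose p) * (card (J S \<inter> S) + q choose q))"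
    if "S \<in> X" "(T, U) \<in> moves S" for S T U
  proof -
    note m = moves[OF that] and f = fin[OF that(1)] and t = target[OF that]
    have f': "finite T" "finite U" using m f by (meson finite_Diff finite_Int finite_subset)+
    have "I S - ((S - T) \<union> U) = (I S - S) \<union> T" "J S \<inter> ((S - T) \<union> U) = (J S \<inter> S) \<union> U"
      using m f by auto
    moreover have "card ((I S - S) \<union> T) = card (I S - S) + p"
      using m f f' by (subst card_Un_disjoint) auto
    moreover have "card ((J S \<inter> S) \<union> U) = card (J S \<inter> S) + q"
      using m f f' by (subst card_Un_disjoint) auto
    ultimately show ?thesis using t by (simp add: d_def)
  qed
  have pos: "0 < real (card (moves S))" if "S \<in> X" for S
  proof -
    have "0 < r * real ((card (I S - S) + p choose p) * (card (J S \<inter> S) + q choose q))"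
      using r by (simp add: zero_less_binomial)
    then show ?thesis using many[OF that] by linarith
  qed
  \<comment> \<open>Every S spreads mass 1 evenly over its moves; the mass arriving at a single
    target is then bounded.\<close>
  have "(\<Sum>S\<in>X. 1) = (\<Sum>S\<in>X. \<Sum>m\<in>moves S. 1 / real (card (moves S)))"
    using pos by (intro sum.cong) auto
  then have "real (card X) = (\<Sum>S\<in>X. \<Sum>m\<in>moves S. 1 / real (card (moves S)))" by simp
  also have "\<dots> = (\<Sum>(S, m)\<in>R. 1 / real (card (moves S)))"
    unfolding R_def using X fin_moves by (subst sum.Sigma) auto
  also have "\<dots> \<le> (\<Sum>x\<in>R. 1 / (r * d (g x)))"
  proof (rule sum_mono, clarify)
    fix S T U assume "(S, T, U) \<in> R"
    then have S: "S \<in> X" "(T, U) \<in> moves S" by (auto simp: R_def)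
    have "0 < r * d (g (S, T, U))"
      unfolding g_def using d_eq[OF S] r by (simp add: zero_less_binomial)
    then show "1 / real (card (moves S)) \<le> 1 / (r * d (g (S, T, U)))"
      using many[OF S(1)] d_eq[OF S] by (intro divide_left_mono) (auto simp: g_def intro!: mult_pos_pos pos[OF S(1)])
  qed
  also have "\<dots> = (\<Sum>y\<in>g ` R. \<Sum>x\<in>{x \<in> R. g x = y}. 1 / (r * d (g x)))"
    by (rule sum.image_gen[OF finR])
  also have "\<dots> \<le> (\<Sum>y\<in>g ` R. 1 / r)"
  proof (rule sum_mono)
    fix y assume "y \<in> g ` R"
    then obtain S0 T0 U0 where y: "(S0, T0, U0) \<in> R" "y = (S0 - T0) \<union> U0" by (auto simp: g_def)
    let ?A = "{T. T \<subseteq> I' y - y \<and> card T = p} \<times> {U. U \<subseteq> J' y \<inter> y \<and> card U = q}"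
    have S0: "S0 \<in> X" "(T0, U0) \<in> moves S0" using y by (auto simp: R_def)
    have fy: "finite (I' y)" "finite (J' y)" using target[OF S0] fin[OF S0(1)] y by auto
    have dpos: "0 < d y" using d_eq[OF S0] y(2) by (simp add: zero_less_binomial)
    \<comment> \<open>Target and move determine the source, which is the target without U and with T
      restored.\<close>
    have "inj_on snd {x \<in> R. g x = y}"
    proof (rule inj_onI)
      fix x1 x2 assume x: "x1 \<in> {x \<in> R. g x = y}" "x2 \<in> {x \<in> R. g x = y}" "snd x1 = snd x2"
      obtain S1 T U where x1: "x1 = (S1, T, U)" by (cases x1)
      then obtain S2 where x2: "x2 = (S2, T, U)" using x(3) by (cases x2) auto
      have R: "S1 \<in> X" "(T, U) \<in> moves S1" "S2 \<in> X" "(T, U) \<in> moves S2"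
        using x x1 x2 by (auto simp: R_def)
      have "T \<subseteq> S1" "U \<inter> S1 = {}" "T \<subseteq> S2" "U \<inter> S2 = {}"
        using moves[OF R(1,2)] moves[OF R(3,4)] by auto
      moreover have "S1 - T \<union> U = S2 - T \<union> U" using x x1 x2 by (simp add: g_def)
      ultimately show "x1 = x2" using x1 x2 by auto
    qed
    moreover have "snd ` {x \<in> R. g x = y} \<subseteq> ?A"
    proof
      fix z assume "z \<in> snd ` {x \<in> R. g x = y}"
      then obtain S T U where a: "(S, T, U) \<in> R" "g (S, T, U) = y" and z: "z = (T, U)" by force
      then have S: "S \<in> X" "(T, U) \<in> moves S" by (auto simp: R_def)
      have y': "y = (S - T) \<union> U" using a by (simp add: g_def)
      have "I' y = I S" "J' y = J S" using target[OF S] y' by auto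
      then show "z \<in> ?A" using moves[OF S] fin[OF S(1)] y' z by auto
    qed
    moreover have "finite ?A" using fy by auto
    ultimately have "card {x \<in> R. g x = y} \<le> card ?A"
      by (rule card_inj_on_le)
    also have "real (card ?A) = d y"
      using fy unfolding card_cartesian_product d_def
      by (simp only: n_subsets finite_Diff finite_Int disj_not1 simp_thms)
    finally have c: "real (card {x \<in> R. g x = y}) \<le> d y" by simp
    have "(\<Sum>x\<in>{x \<in> R. g x = y}. 1 / (r * d (g x))) = real (card {x \<in> R. g x = y}) * (1 / (r * d y))"
      by simp
    also have "\<dots> \<le> d y * (1 / (r * d y))"
      using c r dpos by (intro mult_right_mono) auto
    also have "\<dots> = 1 / r" using dpos by simp
    finally show "(\<Sum>x\<in>{x \<in> R. g x = y}. 1 / (r * d (g x))) \<le> 1 / r" .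
  qed
  also have "\<dots> \<le> real (card Y) / r"
  proof -
    have "g ` R \<subseteq> Y" using target by (auto simp: g_def R_def)
    then have "card (g ` R) \<le> card Y" by (rule card_mono[OF Y])
    then show ?thesis using r by (simp add: divide_right_mono)
  qed
  finally show ?thesis using r by (simp add: field_simps)
qed

lemma area_exchange:
  assumes "S \<subseteq> {..<n}" "T \<subseteq> S" "U \<subseteq> {..<n} - S" "card U = card T"
  shows "area n ((S - T) \<union> U) = area n S + real (\<Sum>T) - real (\<Sum>U)"
    and "card ((S - T) \<union> U) = card S"
proof -
  have fin: "finite S" "finite T" "finite U"
    using assms by (meson finite_Diff finite_lessThan finite_subset)+
  have sub: "(S - T) \<union> U \<subseteq> {..<n}" using assms by auto
  have disj: "(S - T) \<inter> U = {}" using assms by auto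
  have "card T \<le> card S" using assms fin by (simp add: card_mono)
  then show c: "card ((S - T) \<union> U) = card S"
    using fin assms disj by (simp add: card_Un_disjoint card_Diff_subset)
  have "\<Sum>((S - T) \<union> U) = \<Sum>(S - T) + \<Sum>U" using fin disj by (intro sum.union_disjoint) auto
  moreover have "\<Sum>S = \<Sum>(S - T) + \<Sum>T" using fin assms by (intro sum.subset_diff) auto
  ultimately have s: "real (\<Sum>((S - T) \<union> U)) = real (\<Sum>S) - real (\<Sum>T) + real (\<Sum>U)" by simp
  show "area n ((S - T) \<union> U) = area n S + real (\<Sum>T) - real (\<Sum>U)"
    unfolding area_formula[OF assms(1)] area_formula[OF sub] c s by simp
qed

lemma exp_half_le:
  fixes y :: real
  assumes "0 \<le> y" "y \<le> 1"
  shows "exp (y / 2) \<le> 1 + y"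
proof -
  have "exp (y / 2) \<le> 1 + y / 2 + (y / 2)\<^sup>2" using assms by (intro exp_bound) auto
  also have "(y / 2)\<^sup>2 \<le> y / 2"
    using assms mult_left_mono[of y 1 y] by (simp add: power2_eq_square field_simps)
  finally show ?thesis by simp
qed

section \<open>Bulging blocks and steep blocks\<close>

context subcritical
begin

text \<open>The first half of the block has g more rightward steps than the second, so the path
  bulges above its chord. Moving q of them to the second half loses at most 2 m q of area and
  multiplies the number of paths by at least exp (g^2 / (16 m)). Up to a constant factor, the price
  of the lost area is at most half of this exponent, which is what the lower bound on g in terms of
  m^2 / N ensures.\<close>

lemma wt_mid_large:
  fixes g :: real
  assumes N: "1 \<le> N" and g: "4 \<le> g" "32 * ln (1 / l) * (real m)\<^sup>2 / N \<le> g"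
  shows "wt (\<lambda>n S. (real N)\<^sup>2 \<le> area n S \<and> n - card S + x + 2 * m \<le> n \<and>
      real (card ({n - card S + x + m..<n - card S + x + 2 * m} \<inter> S)) + g
        \<le> real (card ({n - card S + x..<n - card S + x + m} \<inter> S)))
    \<le> exp (2 * ln (1 / l)) * exp (- g\<^sup>2 / (32 * real m)) * Z N"
    (is "wt ?P \<le> _")
proof -
  \<comment> \<open>With q <= g / 4, a gap of g / 2 remains after the move, as required for the
    ratio t = 1 + g / (2 m) below. The assumption 4 <= g keeps the rounded value above g /
    8.\<close>
  define q where "q = nat \<lfloor>g / 4\<rfloor>"
  have q: "real q \<le> g / 4" "g / 8 \<le> real q"
  proof -
    have "1 \<le> \<lfloor>g / 4\<rfloor>" using g by simp
    then have "1 \<le> real q" "g / 4 - 1 \<le> real q" "real q \<le> g / 4" unfolding q_def by linarith+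
    then show "real q \<le> g / 4" "g / 8 \<le> real q" by linarith+
  qed
  define y where "y = 2 * real m * real q"
  define r where "r = exp (g\<^sup>2 / (16 * real m))"
  have "r * real (card (level ?P n)) \<le> real (card (level (\<lambda>n S. (real N)\<^sup>2 - y \<le> area n S) (n + 0)))" for n
  proof -
    \<comment> \<open>The blocks are placed relative to the time n - \<open>card S\<close> of the
      diagonal, which an exchange preserves; so the modified set shows the same blocks.\<close>
    define I J where "I S = {n - card S + x..<n - card S + x + m}"
      and "J S = {n - card S + x + m..<n - card S + x + 2 * m}" for S :: "nat set"
    define moves where "moves S = {T. T \<subseteq> S \<inter> I S \<and> card T = q} \<times> {U. U \<subseteq> J S - S \<and> card U = q}" for S
    show ?thesis
    proof (rule exchange_count[where I = I and J = J and I' = I and J' = J and moves = moves and p = q and q = q])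
      fix S assume S: "S \<in> level ?P n"
      then have sub: "S \<subseteq> {..<n}" and A: "(real N)\<^sup>2 \<le> area n S"
        and dom: "n - card S + x + 2 * m \<le> n"
        and gap: "real (card (J S \<inter> S)) + g \<le> real (card (I S \<inter> S))"
        by (auto simp: level_def I_def J_def)
      have finS: "finite S" using sub finite_subset by blast
      show fin: "finite S \<and> finite (I S) \<and> finite (J S) \<and> I S \<inter> J S = {}"
        using finS by (auto simp: I_def J_def)
      have cI: "card (I S \<inter> S) + card (I S - S) = m"
        using card_Int_Diff[of "I S" S] fin by (simp add: I_def)
      have cJ: "card (J S \<inter> S) + card (J S - S) = m"
        using card_Int_Diff[of "J S" S] fin by (simp add: J_def)
      have gm: "g \<le> real m" using cI gap by linarith
      have m: "0 < real m" using gm g by linarith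
      define t where "t = 1 + g / (2 * m)"
      have t1: "1 \<le> t" using m g by (simp add: t_def)
      have b1: "t ^ q * real (card (J S \<inter> S) + q choose q) \<le> real (card (S \<inter> I S) choose q)"
      proof (rule binomial_ratio_le)
        have le: "real (card (J S \<inter> S) + q) \<le> m" using gap cI q(1) g(1) by linarith
        have "t * real (card (J S \<inter> S) + q) = real (card (J S \<inter> S) + q) + g / (2 * m) * real (card (J S \<inter> S) + q)"
          by (simp add: t_def algebra_simps)
        also have "\<dots> \<le> real (card (J S \<inter> S) + q) + g / (2 * m) * m"
          using le g m by (intro add_left_mono mult_left_mono) auto
        also have "\<dots> \<le> real (card (S \<inter> I S)) - real q"
          using gap q m by (simp add: Int_commute)
        finally show "t * real (card (J S \<inter> S) + q) \<le> real (card (S \<inter> I S)) - real q" .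
      qed (use t1 in auto)
      have b2: "t ^ q * real (card (I S - S) + q choose q) \<le> real (card (J S - S) choose q)"
      proof (rule binomial_ratio_le)
        have le: "real (card (I S - S) + q) \<le> m" using gap cI q(1) g(1) by linarith
        have "t * real (card (I S - S) + q) = real (card (I S - S) + q) + g / (2 * m) * real (card (I S - S) + q)"
          by (simp add: t_def algebra_simps)
        also have "\<dots> \<le> real (card (I S - S) + q) + g / (2 * m) * m"
          using le g m by (intro add_left_mono mult_left_mono) auto
        also have "\<dots> \<le> real (card (J S - S)) - real q"
          using gap q m cI cJ by simp
        finally show "t * real (card (I S - S) + q) \<le> real (card (J S - S)) - real q" .
      qed (use t1 in auto)
      have rt: "r \<le> t ^ q * t ^ q"
      proof -
        have "exp (g / (4 * m)) \<le> t"
          using exp_half_le[of "g / (2 * m)"] g gm m by (simp add: t_def field_simps)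
        then have "exp (g / (4 * m)) ^ (2 * q) \<le> t ^ (2 * q)" by (intro power_mono) auto
        moreover have "r \<le> exp (g / (4 * m)) ^ (2 * q)"
        proof -
          have "g\<^sup>2 / (16 * real m) \<le> g / (4 * m) * real (2 * q)"
            using q g m mult_left_mono[of "g / 8" "real q" g] by (simp add: field_simps power2_eq_square)
          then show ?thesis unfolding r_def by (simp flip: exp_of_nat2_mult)
        qed
        ultimately show ?thesis by (simp add: mult_2 power_add)
      qed
      have "r * real ((card (I S - S) + q choose q) * (card (J S \<inter> S) + q choose q))
          \<le> (t ^ q * t ^ q) * real ((card (I S - S) + q choose q) * (card (J S \<inter> S) + q choose q))"
        using rt by (intro mult_right_mono) auto
      also have "\<dots> = (t ^ q * real (card (I S - S) + q choose q)) * (t ^ q * real (card (J S \<inter> S) + q choose q))"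
        by simp
      also have "\<dots> \<le> real (card (J S - S) choose q) * real (card (S \<inter> I S) choose q)"
        using b1 b2 t1 by (intro mult_mono) auto
      also have "\<dots> = real (card (moves S))"
        using fin unfolding moves_def card_cartesian_product
        by (simp only: n_subsets finite_Diff finite_Int simp_thms of_nat_mult) simp
      finally show "r * real ((card (I S - S) + q choose q) * (card (J S \<inter> S) + q choose q)) \<le> real (card (moves S))" .
      fix T U assume TU: "(T, U) \<in> moves S"
      then have T: "T \<subseteq> S \<inter> I S" "card T = q" and U: "U \<subseteq> J S - S" "card U = q"
        by (auto simp: moves_def)
      then show "T \<subseteq> S \<inter> I S \<and> card T = q \<and> U \<subseteq> J S - S \<and> card U = q" by simp
      have Un: "U \<subseteq> {..<n} - S" using U dom by (auto simp: J_def)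
      have TS: "T \<subseteq> S" using T by auto
      note ex = area_exchange[OF sub TS Un, unfolded T U, OF refl]
      let ?lo = "n - card S + x"
      have "\<And>i. i \<in> T \<Longrightarrow> ?lo \<le> i" using T(1) unfolding I_def by auto
      then have "card T * ?lo \<le> \<Sum>T" using sum_bounded_below[of T ?lo "\<lambda>i. i"] by simp
      moreover have "\<Sum>U \<le> card U * (?lo + 2 * m)"
      proof -
        have "\<And>i. i \<in> U \<Longrightarrow> i \<le> ?lo + 2 * m" using U(1) unfolding J_def by fastforce
        then show ?thesis using sum_bounded_above[of U "\<lambda>i. i" "?lo + 2 * m"] by simp
      qed
      ultimately have "\<Sum>U \<le> \<Sum>T + 2 * m * q" using T U by (simp add: algebra_simps)
      then have "real (\<Sum>U) \<le> real (\<Sum>T + 2 * m * q)" by (rule of_nat_mono)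
      then have "real (\<Sum>U) \<le> real (\<Sum>T) + y" by (simp add: y_def)
      then have "(real N)\<^sup>2 - y \<le> area n (S - T \<union> U)" using ex(1) A by linarith
      moreover have "S - T \<union> U \<subseteq> {..<n}" using sub Un by auto
      ultimately show "S - T \<union> U \<in> level (\<lambda>n S. (real N)\<^sup>2 - y \<le> area n S) (n + 0) \<and>
          I (S - T \<union> U) = I S \<and> J (S - T \<union> U) = J S"
        using ex(2) by (simp add: level_def I_def J_def)
    qed (auto simp: r_def)
  qed
  from wt_compare[of r ?P _ 0, OF this]
  have "r * wt ?P \<le> wt (\<lambda>n S. (real N)\<^sup>2 - y \<le> area n S)" by simp
  also have "\<dots> \<le> exp (2 * ln (1 / l) * (y / N + 1)) * Z N"
    using N by (intro wt_area_loss) (auto simp: y_def)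
  finally have le: "r * wt ?P \<le> exp (2 * ln (1 / l) * (y / N + 1)) * Z N" .
  have "wt ?P = exp (- (g\<^sup>2 / (16 * real m))) * (r * wt ?P)" by (simp add: r_def exp_minus)
  also have "\<dots> \<le> exp (- (g\<^sup>2 / (16 * real m))) * (exp (2 * ln (1 / l) * (y / N + 1)) * Z N)"
    using le by (intro mult_left_mono) auto
  also have "\<dots> = exp (2 * ln (1 / l) * (y / N + 1) - g\<^sup>2 / (16 * real m)) * Z N"
    by (simp add: exp_diff exp_minus field_simps)
  also have "\<dots> \<le> exp (2 * ln (1 / l) + (- g\<^sup>2 / (32 * real m))) * Z N"
  proof (intro mult_right_mono)
    have L: "0 < ln (1 / l)" using l_pos l_half by (simp add: ln_div)
    have "2 * ln (1 / l) * (y / N) \<le> g\<^sup>2 / (32 * m)"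
    proof (cases "m = 0")
      case False
      then have m: "0 < real m" by simp
      have "2 * ln (1 / l) * (y / N) = ln (1 / l) * 4 * real m * real q / N" by (simp add: y_def)
      also have "\<dots> \<le> ln (1 / l) * 4 * real m * (g / 4) / N"
        using L q N by (intro divide_right_mono mult_left_mono) auto
      also have "\<dots> = (32 * ln (1 / l) * (real m)\<^sup>2 / N) * (g / (32 * real m))"
        using m N by (simp add: field_simps power2_eq_square)
      also have "\<dots> \<le> g * (g / (32 * real m))"
        using g m by (intro mult_right_mono) auto
      finally show ?thesis by (simp add: power2_eq_square)
    qed (simp add: y_def)
    moreover have "g\<^sup>2 / (16 * real m) = g\<^sup>2 / (32 * m) + g\<^sup>2 / (32 * m)" by (simp add: field_simps)
    ultimately have "2 * ln (1 / l) * (y / N) - g\<^sup>2 / (16 * real m) \<le> - g\<^sup>2 / (32 * m)" by simp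
    then show "exp (2 * ln (1 / l) * (y / N + 1) - g\<^sup>2 / (16 * real m)) \<le> exp (2 * ln (1 / l) + (- g\<^sup>2 / (32 * real m)))"
      by (simp add: algebra_simps)
  qed (use Z_pos[of N] in auto)
  also have "\<dots> = exp (2 * ln (1 / l)) * exp (- g\<^sup>2 / (32 * real m)) * Z N"
    by (simp only: exp_add)
  finally show ?thesis .
qed

text \<open>For g < 4 the exponent is at most 1 in absolute value, and the additional factor exp 1
  makes the bound trivial.\<close>

lemma wt_mid:
  fixes g :: real
  assumes N: "1 \<le> N" and m: "1 \<le> m" and g: "0 \<le> g" "32 * ln (1 / l) * (real m)\<^sup>2 / N \<le> g"
  shows "wt (\<lambda>n S. (real N)\<^sup>2 \<le> area n S \<and> n - card S + x + 2 * m \<le> n \<and>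
      real (card ({n - card S + x + m..<n - card S + x + 2 * m} \<inter> S)) + g
        \<le> real (card ({n - card S + x..<n - card S + x + m} \<inter> S)))
    \<le> exp (2 * ln (1 / l) + 1) * exp (- g\<^sup>2 / (32 * real m)) * Z N"
    (is "wt ?P \<le> _")
proof (cases "4 \<le> g")
  case True
  have "wt ?P \<le> exp (2 * ln (1 / l)) * exp (- g\<^sup>2 / (32 * real m)) * Z N"
    using wt_mid_large[OF N True g(2)] .
  also have "\<dots> \<le> exp (2 * ln (1 / l) + 1) * exp (- g\<^sup>2 / (32 * real m)) * Z N"
    using Z_pos[of N] by (intro mult_right_mono) auto
  finally show ?thesis .
next
  case False
  have "g\<^sup>2 \<le> 4\<^sup>2" using False g by (intro power_mono) auto
  then have "g\<^sup>2 / (32 * m) \<le> 1" using m by (simp add: field_simps)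
  moreover have "0 < ln (1 / l)" using l_pos l_half by (simp add: ln_div)
  ultimately have "0 \<le> (2 * ln (1 / l) + 1) + - g\<^sup>2 / (32 * m)" by simp
  then have "1 \<le> exp (2 * ln (1 / l) + 1) * exp (- g\<^sup>2 / (32 * real m))"
    by (simp only: one_le_exp_iff flip: exp_add)
  then have "1 * Z N \<le> exp (2 * ln (1 / l) + 1) * exp (- g\<^sup>2 / (32 * real m)) * Z N"
    using Z_pos[of N] by (intro mult_right_mono) auto
  moreover have "wt ?P \<le> Z N" by (rule wt_le_Z)
  ultimately show ?thesis by simp
qed

text \<open>Here steps are turned instead of exchanged: q downward steps shortly before the diagonal
  become rightward, and q downward steps are appended at the end. Where rightward steps are rare,
  each turned step multiplies the number of paths by at least e / l and costs only l; the condition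
  on \<eta> says exactly that this ratio is available.\<close>

lemma wt_steep:
  fixes \<eta> :: real
  assumes \<eta>: "0 < \<eta>" "exp 1 * (3 * \<eta>) \<le> l * (1 - 3 * \<eta>)"
  shows "wt (\<lambda>n S. (real N)\<^sup>2 \<le> area n S \<and> m \<le> n - card S \<and>
      real (card ({n - card S - m..<n - card S} \<inter> S)) \<le> 2 * \<eta> * real m)
    \<le> exp 1 * exp (- \<eta> * m) * Z N"
    (is "wt ?P \<le> _")
proof -
  define q where "q = nat \<lfloor>\<eta> * m\<rfloor>"
  have q: "real q \<le> \<eta> * m" "\<eta> * m - 1 \<le> real q" using \<eta> unfolding q_def by (simp, linarith)
  define t where "t = exp 1 / l"
  have t: "0 < t" using l_pos by (simp add: t_def)
  have t\<eta>: "t * (3 * \<eta>) \<le> 1 - 3 * \<eta>" using \<eta> l_pos by (simp add: t_def field_simps)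
  have "t ^ q * real (card (level ?P n)) \<le> real (card (level (\<lambda>n S. (real N)\<^sup>2 \<le> area n S) (n + q)))" for n
  proof -
    define J where "J S = {n - card S - m..<n - card S}" for S :: "nat set"
    \<comment> \<open>Both the length and the number of rightward steps grow by q, so the path meets
      the diagonal at the same time and \<open>J'\<close> finds the old block.\<close>
    define J' where "J' S = {n + q - card S - m..<n + q - card S}" for S :: "nat set"
    define moves where "moves S = {{} :: nat set} \<times> {U. U \<subseteq> J S - S \<and> card U = q}" for S
    show ?thesis
    proof (rule exchange_count[where I = "\<lambda>_. {}" and J = J and I' = "\<lambda>_. {}" and J' = J'
          and moves = moves and p = 0 and q = q])
      fix S assume S: "S \<in> level ?P n"
      then have sub: "S \<subseteq> {..<n}" and A: "(real N)\<^sup>2 \<le> area n S"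
        and dom: "m \<le> n - card S" and few: "real (card (J S \<inter> S)) \<le> 2 * \<eta> * real m"
        by (auto simp: level_def J_def)
      have finS: "finite S" using sub finite_subset by blast
      then show "finite S \<and> finite ({} :: nat set) \<and> finite (J S) \<and> {} \<inter> J S = {}"
        by (simp add: J_def)
      have cJ: "card (J S \<inter> S) + card (J S - S) = m"
      proof -
        have "card (J S) = m" using dom unfolding J_def card_atLeastLessThan by arith
        then show ?thesis using card_Int_Diff[of "J S" S] by (simp add: J_def)
      qed
      have "t ^ q * real (card (J S \<inter> S) + q choose q) \<le> real (card (J S - S) choose q)"
      proof (rule binomial_ratio_le)
        have "real (card (J S \<inter> S) + q) \<le> 3 * \<eta> * m" using few q by simp
        then have "t * real (card (J S \<inter> S) + q) \<le> t * (3 * \<eta> * m)"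
          using t by (intro mult_left_mono) auto
        also have "\<dots> = (t * (3 * \<eta>)) * m" by simp
        also have "\<dots> \<le> (1 - 3 * \<eta>) * m" using t\<eta> by (intro mult_right_mono) auto
        also have "\<dots> \<le> real (card (J S - S)) - real q"
          using few q cJ by (simp add: algebra_simps)
        finally show "t * real (card (J S \<inter> S) + q) \<le> real (card (J S - S)) - real q" .
      qed (use t in auto)
      then show "t ^ q * real ((card ({} - S) + 0 choose 0) * (card (J S \<inter> S) + q choose q)) \<le> real (card (moves S))"
        by (simp add: moves_def card_cartesian_product n_subsets J_def)
      fix T U assume TU: "(T, U) \<in> moves S"
      then have T: "T = {}" and U: "U \<subseteq> J S - S" "card U = q"
        by (auto simp: moves_def)
      then show "T \<subseteq> S \<inter> {} \<and> card T = 0 \<and> U \<subseteq> J S - S \<and> card U = q" by simp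
      have "J S \<subseteq> {..<n}" by (auto simp: J_def)
      then have Un: "U \<subseteq> {..<n} - S" using U by blast
      have fU: "finite U" using Un by (meson finite_Diff finite_lessThan finite_subset)
      have cSU: "card (S \<union> U) = card S + q"
        using fU finS Un U by (subst card_Un_disjoint) auto
      have sub': "S \<union> U \<subseteq> {..<n + q}" using sub Un by auto
      have sSU: "\<Sum>(S \<union> U) = \<Sum>S + \<Sum>U" using fU finS Un by (intro sum.union_disjoint) auto
      have "\<And>i. i \<in> U \<Longrightarrow> i \<le> n" using Un by fastforce
      then have "\<Sum>U \<le> card U * n" using sum_bounded_above[of U "\<lambda>i. i" n] by simp
      then have "real (\<Sum>U) \<le> real q * real n" using U by (metis of_nat_le_iff of_nat_mult)
      \<comment> \<open>The area changes by q n minus the sum of U, plus q (q - 1) / 2; both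
        contributions are nonnegative.\<close>
      moreover have "real q \<le> real q * real q" using mult_le_mono[of q q 0 q] by (cases q) auto
      ultimately have "area n S \<le> area (n + q) (S \<union> U)"
        unfolding area_formula[OF sub] area_formula[OF sub'] cSU sSU
        by (simp add: field_simps)
      then show "S - T \<union> U \<in> level (\<lambda>n S. (real N)\<^sup>2 \<le> area n S) (n + q) \<and> {} = {} \<and> J' (S - T \<union> U) = J S"
        using sub' A T cSU by (simp add: level_def J_def J'_def)
    qed (use t in auto)
  qed
  from wt_compare[of "t ^ q" ?P _ q, OF this]
  have "(t * l) ^ q * wt ?P \<le> Z N" by (simp add: Z_def power_mult_distrib)
  then have le: "exp (real q) * wt ?P \<le> Z N" using l_pos by (simp add: t_def flip: exp_of_nat2_mult)
  have "wt ?P = exp (- real q) * (exp (real q) * wt ?P)" by (simp add: exp_minus)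
  also have "\<dots> \<le> exp (- real q) * Z N" using le by (intro mult_left_mono) auto
  also have "\<dots> \<le> exp (1 + - \<eta> * m) * Z N" using q Z_pos[of N] by (intro mult_right_mono) auto
  also have "exp (1 + - \<eta> * m) = exp 1 * exp (- \<eta> * m)" by (rule exp_add)
  finally show ?thesis .
qed

end

section \<open>Slopes at the diagonal\<close>

text \<open>The reflection i -> d - 1 - i sends a p-subset with sum below the mean p (d - 1) / 2 to
  one above it. Restricting a move to subsets of large sum thus guarantees a gain of area at the
  price of a factor 2 only.\<close>

lemma binomial_le_twice_high:
  "d choose p \<le> 2 * card {T. T \<subseteq> {..<d} \<and> card T = p \<and> p * (d - 1) \<le> 2 * \<Sum>T}"
proof -
  define A where "A = {T. T \<subseteq> {..<d} \<and> card T = p}"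
  define H where "H = {T. T \<subseteq> {..<d} \<and> card T = p \<and> p * (d - 1) \<le> 2 * \<Sum>T}"
  define f where "f = image (\<lambda>i. d - 1 - i)"
  have finA: "finite A" by (rule finite_subset[of _ "Pow {..<d}"]) (auto simp: A_def)
  have HA: "H \<subseteq> A" by (auto simp: A_def H_def)
  have "card (A - H) \<le> card H"
  proof (rule card_inj_on_le)
    show "inj_on f (A - H)"
    proof (rule inj_on_inverseI[of _ f])
      fix T assume "T \<in> A - H"
      then have "\<And>i. i \<in> T \<Longrightarrow> d - 1 - (d - 1 - i) = i" by (auto simp: A_def)
      then show "f (f T) = T" by (force simp: f_def image_image)
    qed
    show "f ` (A - H) \<subseteq> H"
    proof
      fix y assume "y \<in> f ` (A - H)"
      then obtain T where y: "y = f T" and "T \<in> A - H" by blast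
      then have T: "T \<subseteq> {..<d}" "card T = p" "2 * \<Sum>T < p * (d - 1)"
        unfolding A_def H_def by auto
      have inj: "inj_on (\<lambda>i. d - 1 - i) T" by (rule inj_on_subset[OF inj_on_reflect T(1)])
      have "\<Sum>(f T) + \<Sum>T = (\<Sum>i\<in>T. (d - 1 - i) + i)"
        unfolding f_def sum.distrib by (subst sum.reindex[OF inj]) simp
      also have "\<dots> = (\<Sum>i\<in>T. d - 1)" using T by (intro sum.cong) auto
      also have "\<dots> = p * (d - 1)" using T by simp
      finally have "p * (d - 1) \<le> 2 * \<Sum>(f T)" using T by linarith
      moreover have "card (f T) = p" unfolding f_def using T inj by (simp add: card_image)
      moreover have "f T \<subseteq> {..<d}" using T by (auto simp: f_def)
      ultimately show "y \<in> H" using y by (simp add: H_def)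
    qed
    show "finite H" using HA finA finite_subset by blast
  qed
  moreover have "card A = card H + card (A - H)"
    using HA finA by (metis card_Diff_subset card_mono finite_subset le_add_diff_inverse)
  moreover have "card A = d choose p" by (simp add: A_def n_subsets)
  ultimately show ?thesis by (simp add: H_def)
qed

text \<open>Counted from 0, the i-th element of X is at least lo + i, so the increasing enumeration
  of X transports the bound from an initial segment.\<close>

lemma binomial_le_twice_high_subsets:
  fixes X :: "nat set"
  assumes fin: "finite X" and lo: "\<And>x. x \<in> X \<Longrightarrow> lo \<le> x"
  shows "card X choose p
    \<le> 2 * card {T. T \<subseteq> X \<and> card T = p \<and> p * (card X - 1) + 2 * p * lo \<le> 2 * \<Sum>T}"
    (is "_ \<le> 2 * card ?H")
proof -
  obtain h where h: "bij_betw h {..<card X} X" "strict_mono_on {..<card X} h"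
    using ex_bij_betw_strict_mono_card[OF fin] by blast
  have h_ge: "lo + i \<le> h i" if "i < card X" for i
    using that
  proof (induction i)
    case 0
    then show ?case using h lo by (auto simp: bij_betw_def)
  next
    case (Suc i)
    then have "h i < h (Suc i)" using h(2) by (auto simp: strict_mono_on_def)
    then show ?case using Suc by simp
  qed
  let ?L = "{T. T \<subseteq> {..<card X} \<and> card T = p \<and> p * (card X - 1) \<le> 2 * \<Sum>T}"
  have "card ?L \<le> card ?H"
  proof (rule card_inj_on_le)
    have inj: "inj_on h {..<card X}" using h by (auto simp: bij_betw_def)
    show "inj_on (image h) ?L"
      by (rule inj_on_subset[OF inj_on_image_Pow[OF inj]]) auto
    show "(`) h ` ?L \<subseteq> ?H"
    proof
      fix y assume "y \<in> (`) h ` ?L"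
      then obtain T where y: "y = h ` T" and T: "T \<subseteq> {..<card X}" "card T = p" "p * (card X - 1) \<le> 2 * \<Sum>T"
        by auto
      have injT: "inj_on h T" by (rule inj_on_subset[OF inj T(1)])
      have "p * lo + \<Sum>T = (\<Sum>i\<in>T. lo + i)" using T by (simp add: sum.distrib)
      also have "\<dots> \<le> (\<Sum>i\<in>T. h i)" using T h_ge by (intro sum_mono) auto
      also have "\<dots> = \<Sum>(h ` T)" by (simp add: sum.reindex[OF injT])
      finally have "p * (card X - 1) + 2 * p * lo \<le> 2 * \<Sum>(h ` T)" using T by simp
      moreover have "h ` T \<subseteq> X" using T h by (auto simp: bij_betw_def)
      moreover have "card (h ` T) = p" using T injT by (simp add: card_image)
      ultimately show "y \<in> ?H" using y by simp
    qed
    show "finite ?H" by (rule finite_subset[of _ "Pow X"]) (use fin in auto)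
  qed
  then show ?thesis using binomial_le_twice_high[of "card X" p] by linarith
qed

section \<open>Step counts on the two sides of the diagonal\<close>

text \<open>The profile of the path in turned coordinates, with the number of steps as time and the
  number of rightward steps as height, seen from the diagonal point. Divided by v it is a slope,
  which for a concave profile decreases in v.\<close>

definition right_steps :: "nat \<Rightarrow> nat set \<Rightarrow> nat \<Rightarrow> nat" where
  "right_steps n S v = card ({n - card S..<n - card S + v} \<inter> S)"

definition left_steps :: "nat \<Rightarrow> nat set \<Rightarrow> nat \<Rightarrow> nat" where
  "left_steps n S v = card ({n - card S - v..<n - card S} \<inter> S)"

lemma card_mirror_block:
  assumes "lo \<le> hi" "hi \<le> n"
  shows "card ({n - hi..<n - lo} \<inter> mirror n S) = card ({lo..<hi} - S)"
proof -
  have "{n - hi..<n - lo} \<inter> mirror n S = (\<lambda>k. n - 1 - k) ` ({lo..<hi} - S)" (is "?A = ?B")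
  proof (intro equalityI subsetI)
    fix k assume k: "k \<in> ?A"
    then have "k < n" by auto
    then have "n - 1 - k \<in> {lo..<hi} - S" "k = n - 1 - (n - 1 - k)"
      using k assms by (auto simp: mem_mirror)
    then show "k \<in> ?B" by blast
  next
    fix k assume "k \<in> ?B"
    then show "k \<in> ?A" using assms unfolding mirror_def by auto
  qed
  moreover have "inj_on (\<lambda>k. n - 1 - k) ({lo..<hi} - S)"
    by (rule inj_on_subset[OF inj_on_reflect[of n]]) (use assms in auto)
  ultimately show ?thesis by (simp add: card_image)
qed

lemma left_steps_mirror:
  assumes "S \<subseteq> {..<n}" "v \<le> card S"
  shows "real (left_steps n (mirror n S) v) = real v - real (right_steps n S v)"
proof -
  have c: "card S \<le> n" by (rule card_compl(2)[OF assms(1)])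
  let ?b = "n - card S"
  have e: "n - card (mirror n S) = n - ?b" "n - card (mirror n S) - v = n - (?b + v)"
    using c assms(2) card_mirror[OF assms(1)] by auto
  have "left_steps n (mirror n S) v = card ({?b..<?b + v} - S)"
    unfolding left_steps_def unfolding e(2) unfolding e(1) using c assms(2) by (intro card_mirror_block) auto
  moreover have "card ({?b..<?b + v} \<inter> S) + card ({?b..<?b + v} - S) = v"
    using card_Int_Diff[of "{?b..<?b + v}" S] by simp
  ultimately show ?thesis by (simp add: right_steps_def)
qed

lemma right_steps_mirror:
  assumes "S \<subseteq> {..<n}" "v \<le> n - card S"
  shows "real (right_steps n (mirror n S) v) = real v - real (left_steps n S v)"
proof -
  have c: "card (mirror n S) = n - card S" by (rule card_mirror[OF assms(1)])
  show ?thesis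
    using left_steps_mirror[OF mirror_subset, of v n S] assms
    by (simp add: mirror_mirror[OF assms(1)] c)
qed

lemma exp_neg_twice_le:
  fixes z :: real
  assumes "0 \<le> z" "z \<le> 1 / 2"
  shows "exp (- 2 * z) \<le> 1 - z"
proof -
  have "1 \<le> (1 + 2 * z) * (1 - z)"
    using assms mult_left_mono[of "2 * z" 1 z] by (simp add: algebra_simps)
  also have "\<dots> \<le> exp (2 * z) * (1 - z)"
    using assms exp_ge_add_one_self[of "2 * z"] by (intro mult_right_mono) auto
  finally show ?thesis by (simp add: exp_minus field_simps)
qed

text \<open>The odds on the two sides of the diagonal cancel for \<omega> = 0. In general the
  product regroups into (s - \<omega>) / (s + \<omega>) for s = p and s = 1 - p, each bounded
  separately.\<close>

lemma odds_product_ge: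
  fixes p \<omega> \<eta> :: real
  assumes "0 < \<eta>" "\<eta> \<le> p" "p \<le> 1 - \<eta>" "0 \<le> \<omega>" "\<omega> \<le> \<eta> / 4"
  shows "exp (- 8 * \<omega> / \<eta>) \<le> (p - \<omega>) / (1 - p + \<omega>) * ((1 - p - \<omega>) / (p + \<omega>))"
proof -
  have one: "exp (- 4 * \<omega> / \<eta>) \<le> (s - \<omega>) / (s + \<omega>)" if s: "\<eta> \<le> s" for s
  proof -
    have "exp (- 4 * \<omega> / \<eta>) = exp (- 2 * (2 * \<omega> / \<eta>))" by simp
    also have "\<dots> \<le> 1 - 2 * \<omega> / \<eta>" using assms by (intro exp_neg_twice_le) (auto simp: field_simps)
    also have "2 * \<omega> / (s + \<omega>) \<le> 2 * \<omega> / \<eta>" using assms s by (intro divide_left_mono) auto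
    then have "1 - 2 * \<omega> / \<eta> \<le> 1 - 2 * \<omega> / (s + \<omega>)" by simp
    also have "\<dots> = (s - \<omega>) / (s + \<omega>)" using assms s by (simp add: field_simps)
    finally show ?thesis .
  qed
  have "exp (- 8 * \<omega> / \<eta>) = exp (- 4 * \<omega> / \<eta>) * exp (- 4 * \<omega> / \<eta>)"
    by (simp flip: exp_add)
  also have "\<dots> \<le> ((p - \<omega>) / (p + \<omega>)) * ((1 - p - \<omega>) / (1 - p + \<omega>))"
    using one[of p] one[of "1 - p"] assms by (intro mult_mono) (auto intro!: divide_nonneg_nonneg)
  finally show ?thesis by (simp add: mult.commute)
qed

context subcritical
begin

text \<open>If the slope on the left hardly exceeds the slope on the right, q rightward steps can be
  carried from the right block over the diagonal into the left one with little loss in number, as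
  the odds on both sides nearly cancel. The carried steps gain area of order q \<eta> j, which
  \<open>wt_area_gain\<close> penalises. Slopes are kept away from 0 and 1 so that the odds stay
  bounded.\<close>

lemma wt_flip_core:
  fixes \<theta> \<eta> :: real
  assumes N: "1 \<le> N" and K: "1 \<le> K" and ij: "1 \<le> i" "i \<le> j"
    and \<eta>: "0 < \<eta>" "\<eta> \<le> 1" and \<theta>: "0 < \<theta>" "8 * \<theta> * K \<le> \<eta>" "64 * \<theta> * K \<le> ln (1 / rho) * \<eta>\<^sup>2"
  shows "wt (\<lambda>n S. (real N)\<^sup>2 \<le> area n S \<and> n \<le> K * N \<and> i \<le> n - card S \<and> j \<le> card S \<and>
      real (left_steps n S i) / i \<le> real (right_steps n S j) / j + \<theta> * j / N \<and>
      \<eta> \<le> real (right_steps n S j) / j \<and> real (right_steps n S j) / j \<le> 1 - \<eta>)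
    \<le> 2 * exp (2 * ln (1 / rho)) * exp (- (ln (1 / rho) * \<theta> * \<eta> / (4 * real K)) * (i * (real j)\<^sup>2 / (real N)\<^sup>2)) * Z N"
    (is "wt ?P \<le> ?rhs")
proof (cases "j \<le> K * N")
  case False
  have "?P n S \<Longrightarrow> False" if "S \<subseteq> {..<n}" for n S
    using False card_compl(2)[OF that] by auto
  then show ?thesis using Z_pos[of N] by (intro wt_absurd) (blast, simp)
next
  case True
  \<comment> \<open>q is the number of rightward steps that a slope difference \<theta> j / N makes
    over i steps. Half of \<omega> is reserved for the assumed slope difference, the other half for
    the q moved steps.\<close>
  define q where "q = nat \<lfloor>\<theta> * i * j / N\<rfloor>"
  define \<omega> where "\<omega> = 2 * \<theta> * j / N"
  have N0: "0 < real N" using N by simp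
  have L: "0 < ln (1 / rho)" using rho by simp
  have j0: "0 < real j" and i0: "0 < real i" using ij by auto
  have q: "real q \<le> \<theta> * i * j / N" "\<theta> * i * j / N - 1 \<le> real q"
  proof -
    have "0 \<le> \<theta> * i * j / N" using \<theta> by simp
    then show "real q \<le> \<theta> * i * j / N" "\<theta> * i * j / N - 1 \<le> real q" unfolding q_def by linarith+
  qed
  have jKN: "real j \<le> real K * real N" using True by (metis of_nat_le_iff of_nat_mult)
  have \<omega>: "0 \<le> \<omega>" "\<omega> \<le> \<eta> / 4"
  proof -
    show "0 \<le> \<omega>" using \<theta> by (simp add: \<omega>_def)
    have "\<omega> \<le> 2 * \<theta> * K" using jKN \<theta> N0 mult_left_mono[OF jKN, of "2 * \<theta>"] by (simp add: \<omega>_def field_simps)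
    then show "\<omega> \<le> \<eta> / 4" using \<theta> by simp
  qed
  have qi: "real q \<le> \<omega> / 2 * i" using q(1) by (simp add: \<omega>_def mult_ac)
  have qj: "real q \<le> \<omega> / 2 * j"
  proof -
    have "\<omega> / 2 * i \<le> \<omega> / 2 * j" using \<omega> ij by (intro mult_left_mono) auto
    then show ?thesis using qi by linarith
  qed
  \<comment> \<open>The gained area: the removed steps lie on average at least (p j - 1) / 2 after
    the diagonal time, the added ones at least 1 before it.\<close>
  define y where "y = real q * (\<eta> * j / 2)"
  have y0: "0 \<le> y" using \<eta> by (simp add: y_def)
  define e where "e = exp (- 8 * \<omega> / \<eta>)"
  define r where "r = e ^ q / 2"
  let ?Q = "\<lambda>n S. (real N)\<^sup>2 + y \<le> area n S \<and> n \<le> K * N"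
  have "r * real (card (level ?P n)) \<le> real (card (level ?Q (n + 0)))" for n
  proof -
    define I J where "I S = {n - card S..<n - card S + j}"
      and "J S = {n - card S - i..<n - card S}" for S :: "nat set"
    define high where "high S = {T. T \<subseteq> I S \<inter> S \<and> card T = q \<and>
        q * (card (I S \<inter> S) - 1) + 2 * q * (n - card S) \<le> 2 * \<Sum>T}" for S
    define moves where "moves S = high S \<times> {U. U \<subseteq> J S - S \<and> card U = q}" for S
    show ?thesis
    proof (rule exchange_count[where I = I and J = J and I' = I and J' = J
          and moves = moves and p = q and q = q])
      fix S assume S: "S \<in> level ?P n"
      define p where "p = real (card (I S \<inter> S)) / j"
      have sub: "S \<subseteq> {..<n}" and A: "(real N)\<^sup>2 \<le> area n S" and nK: "n \<le> K * N"
        and dom: "i \<le> n - card S" "j \<le> card S"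
        and pL: "real (card (J S \<inter> S)) / i \<le> p + \<omega> / 2"
        and p: "\<eta> \<le> p" "p \<le> 1 - \<eta>"
        using S by (auto simp: level_def I_def J_def p_def \<omega>_def left_steps_def right_steps_def)
      have finS: "finite S" using sub finite_subset by blast
      have cS: "card S \<le> n" by (rule card_compl(2)[OF sub])
      show fin: "finite S \<and> finite (I S) \<and> finite (J S) \<and> I S \<inter> J S = {}"
        using finS by (auto simp: I_def J_def)
      have cJ: "card (J S \<inter> S) + card (J S - S) = i"
      proof -
        have "card (J S) = i" using dom unfolding J_def card_atLeastLessThan by arith
        then show ?thesis using card_Int_Diff[of "J S" S] by (simp add: J_def)
      qed
      have cI: "card (I S \<inter> S) + card (I S - S) = j"
        using card_Int_Diff[of "I S" S] by (simp add: I_def)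
      have uR: "real (card (I S \<inter> S)) = p * j" using j0 by (simp add: p_def)
      have dR: "real (card (I S - S)) = (1 - p) * j" using cI uR by (simp add: algebra_simps flip: of_nat_add)
      have uL: "real (card (J S \<inter> S)) \<le> (p + \<omega> / 2) * i" using pL i0 by (simp add: field_simps)
      have dL: "(1 - p - \<omega> / 2) * i \<le> real (card (J S - S))" using cJ uL by (simp add: algebra_simps flip: of_nat_add)
      define t1 t2 where "t1 = (p - \<omega>) / (1 - p + \<omega>)" and "t2 = (1 - p - \<omega>) / (p + \<omega>)"
      have t: "0 \<le> t1" "0 \<le> t2" using p \<omega> \<eta> by (auto simp: t1_def t2_def)
      have b1: "t1 ^ q * real (card (I S - S) + q choose q) \<le> real (card (I S \<inter> S) choose q)"
      proof (rule binomial_ratio_le[OF t(1)])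
        have "real (card (I S - S) + q) \<le> (1 - p + \<omega>) * j" using dR qj \<omega> j0 by (simp add: algebra_simps)
        then have "t1 * real (card (I S - S) + q) \<le> t1 * ((1 - p + \<omega>) * j)"
          using t by (intro mult_left_mono) auto
        also have "\<dots> = (p - \<omega>) * j" using p \<omega> \<eta> by (simp add: t1_def)
        also have "\<dots> \<le> real (card (I S \<inter> S)) - real q" using uR qj \<omega> j0 by (simp add: algebra_simps)
        finally show "t1 * real (card (I S - S) + q) \<le> real (card (I S \<inter> S)) - real q" .
      qed
      have b2: "t2 ^ q * real (card (J S \<inter> S) + q choose q) \<le> real (card (J S - S) choose q)"
      proof (rule binomial_ratio_le[OF t(2)])
        have "real (card (J S \<inter> S) + q) \<le> (p + \<omega>) * i" using uL qi by (simp add: algebra_simps)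
        then have "t2 * real (card (J S \<inter> S) + q) \<le> t2 * ((p + \<omega>) * i)"
          using t by (intro mult_left_mono) auto
        also have "\<dots> = (1 - p - \<omega>) * i" using p \<omega> \<eta> by (simp add: t2_def)
        also have "\<dots> \<le> real (card (J S - S)) - real q" using dL qi by (simp add: algebra_simps)
        finally show "t2 * real (card (J S \<inter> S) + q) \<le> real (card (J S - S)) - real q" .
      qed
      have high: "real (card (I S \<inter> S) choose q) / 2 \<le> real (card (high S))"
      proof -
        have "card (I S \<inter> S) choose q \<le> 2 * card (high S)"
          unfolding high_def using fin by (intro binomial_le_twice_high_subsets) (auto simp: I_def)
        then have "real (card (I S \<inter> S) choose q) \<le> real (2 * card (high S))" by (rule of_nat_mono)
        then show ?thesis by simp
      qed
      have "e ^ q \<le> (t1 * t2) ^ q"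
        unfolding e_def t1_def t2_def using odds_product_ge[OF \<eta>(1) p \<omega>] by (intro power_mono) auto
      then have "r * real ((card (I S - S) + q choose q) * (card (J S \<inter> S) + q choose q))
          \<le> (t1 * t2) ^ q / 2 * real ((card (I S - S) + q choose q) * (card (J S \<inter> S) + q choose q))"
        unfolding r_def by (intro mult_right_mono) auto
      also have "\<dots> = (t1 ^ q * real (card (I S - S) + q choose q)) / 2 * (t2 ^ q * real (card (J S \<inter> S) + q choose q))"
        by (simp add: power_mult_distrib)
      also have "\<dots> \<le> real (card (I S \<inter> S) choose q) / 2 * real (card (J S - S) choose q)"
        using b1 b2 t by (intro mult_mono divide_right_mono) auto
      also have "\<dots> \<le> real (card (high S)) * real (card (J S - S) choose q)"
        using high by (intro mult_right_mono) auto
      also have "\<dots> = real (card (moves S))"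
        using fin unfolding moves_def card_cartesian_product
        by (simp only: n_subsets finite_Diff simp_thms of_nat_mult)
      finally show "r * real ((card (I S - S) + q choose q) * (card (J S \<inter> S) + q choose q)) \<le> real (card (moves S))" .
      fix T U assume TU: "(T, U) \<in> moves S"
      then have T: "T \<subseteq> I S \<inter> S" "card T = q" "q * (card (I S \<inter> S) - 1) + 2 * q * (n - card S) \<le> 2 * \<Sum>T"
        and U: "U \<subseteq> J S - S" "card U = q"
        by (auto simp: moves_def high_def)
      then show "T \<subseteq> S \<inter> I S \<and> card T = q \<and> U \<subseteq> J S - S \<and> card U = q" by auto
      have "J S \<subseteq> {..<n}" using cS by (auto simp: J_def)
      then have Un: "U \<subseteq> {..<n} - S" using U by blast
      have TS: "T \<subseteq> S" using T by auto
      note ex = area_exchange[OF sub TS Un, unfolded T(2) U(2), OF refl]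
      have "\<And>x. x \<in> U \<Longrightarrow> x \<le> n - card S - 1" using U(1) unfolding J_def by fastforce
      then have "\<Sum>U \<le> q * (n - card S - 1)"
        using sum_bounded_above[of U "\<lambda>i. i" "n - card S - 1"] U by simp
      then have "real (\<Sum>U) \<le> real (q * (n - card S - 1))" by (rule of_nat_mono)
      then have U_le: "real (\<Sum>U) \<le> real q * (real (n - card S) - 1)"
      proof -
        have "real (n - card S - 1) = real (n - card S) - 1" using dom ij by (subst of_nat_diff) auto
        then show ?thesis using \<open>real (\<Sum>U) \<le> real (q * (n - card S - 1))\<close> by (simp only: of_nat_mult)
      qed
      have "real (q * (card (I S \<inter> S) - 1) + 2 * q * (n - card S)) \<le> real (2 * \<Sum>T)"
        using T(3) by (rule of_nat_mono)
      then have "real q * real (card (I S \<inter> S) - 1) + 2 * real q * real (n - card S) \<le> 2 * real (\<Sum>T)"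
        by simp
      moreover have "real q * (p * j - 1) \<le> real q * real (card (I S \<inter> S) - 1)"
        using uR by (intro mult_left_mono) linarith+
      moreover have "real q * (\<eta> * j) \<le> real q * (p * j)"
        using p by (intro mult_left_mono mult_right_mono) auto
      ultimately have "real (\<Sum>U) + y \<le> real (\<Sum>T)"
        using U_le by (simp add: y_def algebra_simps)
      then have "(real N)\<^sup>2 + y \<le> area n (S - T \<union> U)" using ex(1) A by linarith
      moreover have "S - T \<union> U \<subseteq> {..<n}" using sub Un by auto
      ultimately show "S - T \<union> U \<in> level ?Q (n + 0) \<and>
          I (S - T \<union> U) = I S \<and> J (S - T \<union> U) = J S"
        using ex(2) nK by (simp add: level_def I_def J_def)
    qed (auto simp: r_def e_def)
  qed
  from wt_compare[of r ?P ?Q 0, OF this]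
  have "r * wt ?P \<le> wt ?Q" by simp
  also have "\<dots> \<le> exp (ln (1 / rho) * (1 - y / real (K * N))) * Z N"
    using y0 K N by (intro wt_area_gain) auto
  finally have le: "r * wt ?P \<le> exp (ln (1 / rho) * (1 - y / real (K * N))) * Z N" .
  have r_eq: "r = exp (- (8 * \<omega> / \<eta> * q)) / 2"
    unfolding r_def e_def by (simp add: exp_of_nat2_mult[symmetric])
  have "wt ?P = 2 * exp (8 * \<omega> / \<eta> * q) * (r * wt ?P)"
    unfolding r_eq by (simp add: exp_minus)
  also have "\<dots> \<le> 2 * exp (8 * \<omega> / \<eta> * q) * (exp (ln (1 / rho) * (1 - y / real (K * N))) * Z N)"
    using le by (intro mult_left_mono) auto
  also have "\<dots> = 2 * exp (8 * \<omega> / \<eta> * q + ln (1 / rho) * (1 - y / real (K * N))) * Z N"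
    by (simp add: exp_add)
  also have "\<dots> \<le> 2 * exp (2 * ln (1 / rho) + - (ln (1 / rho) * \<theta> * \<eta> / (4 * real K)) * (i * (real j)\<^sup>2 / (real N)\<^sup>2)) * Z N"
  proof -
    define X where "X = i * (real j)\<^sup>2 / (real N)\<^sup>2"
    define D where "D = ln (1 / rho)"
    have D0: "0 < D" using L by (simp add: D_def)
    have K0: "0 < real K" using K by simp
    have X0: "0 \<le> X" by (simp add: X_def)
    \<comment> \<open>The loss in number is quadratic in \<theta>, the gain from the area linear.
      The second upper bound on \<theta> makes the loss at most half of the gain.\<close>
    have "8 * \<omega> / \<eta> * q \<le> 8 * \<omega> / \<eta> * (\<theta> * i * j / N)"
      using q \<omega> \<eta> by (intro mult_left_mono) auto
    also have "\<dots> = 16 * \<theta> / \<eta> * (\<theta> * X)" by (simp add: \<omega>_def X_def power2_eq_square mult_ac)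
    also have "\<dots> \<le> D * \<eta> / (4 * real K) * (\<theta> * X)"
      using \<theta> \<eta> K0 X0 by (intro mult_right_mono) (auto simp: field_simps power2_eq_square D_def)
    finally have 1: "8 * \<omega> / \<eta> * q \<le> D * \<eta> * \<theta> / (4 * real K) * X" by (simp add: mult_ac)
    have "(\<theta> * i * j / N - 1) * (\<eta> * j / 2) \<le> y"
      unfolding y_def using q \<eta> by (intro mult_right_mono) auto
    then have "(\<theta> * i * j / N - 1) * (\<eta> * j / 2) / (K * N) \<le> y / (K * N)"
      using N0 K0 by (intro divide_right_mono) auto
    moreover have "(\<theta> * i * j / N - 1) * (\<eta> * j / 2) / (K * N) = \<theta> * \<eta> / (2 * K) * X - \<eta> / 2 * (j / (K * N))"
      using N0 K0 by (simp add: X_def field_simps power2_eq_square)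
    moreover have "\<eta> / 2 * (j / (K * N)) \<le> 1 * 1"
      using \<eta> jKN N0 K0 by (intro mult_mono) (auto simp: field_simps)
    ultimately have "\<theta> * \<eta> / (2 * K) * X - 1 \<le> y / (K * N)" by linarith
    then have "D * (\<theta> * \<eta> / (2 * K) * X - 1) \<le> D * (y / (K * N))"
      using D0 by (intro mult_left_mono) auto
    then have "8 * \<omega> / \<eta> * q + D * (1 - y / real (K * N)) \<le> 2 * D + - (D * \<theta> * \<eta> / (4 * real K)) * X"
      using 1 by (simp add: algebra_simps)
    then show ?thesis
      using Z_pos[of N] unfolding D_def X_def by (intro mult_right_mono mult_left_mono) auto
  qed
  also have "\<dots> = ?rhs" by (simp only: exp_add mult.assoc)
  finally show ?thesis .
qed

end

context subcritical
begin

text \<open>Extreme slopes are left to \<open>wt_steep\<close>: a right slope below \<eta> forces a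
  left slope of at most 2 \<eta>, and a right slope above 1 - \<eta> makes the reflected path steep
  just before the diagonal.\<close>

lemma wt_flip_short:
  assumes K: "1 \<le> K"
  shows "\<exists>\<theta> c C :: real. 0 < \<theta> \<and> 0 < c \<and> 0 < C \<and> (\<forall>N i j. 1 \<le> N \<longrightarrow> 1 \<le> i \<longrightarrow> i \<le> j \<longrightarrow>
    wt (\<lambda>n S. (real N)\<^sup>2 \<le> area n S \<and> n \<le> K * N \<and> i \<le> n - card S \<and> j \<le> card S \<and>
      real (left_steps n S i) / i \<le> real (right_steps n S j) / j + \<theta> * j / N)
    \<le> C * exp (- c * (i * (real j)\<^sup>2 / (real N)\<^sup>2)) * Z N)"
proof -
  define D where "D = ln (1 / rho)"
  have D: "0 < D" using rho by (simp add: D_def)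
  have K0: "0 < real K" using K by simp
  \<comment> \<open>Small enough for \<open>wt_steep\<close>: with exp 1 <= 3 the left side there is
    at most 9 l / 20.\<close>
  define \<eta> where "\<eta> = l / 20"
  have \<eta>: "0 < \<eta>" "\<eta> \<le> 1" using l_pos l_half by (auto simp: \<eta>_def)
  have \<eta>3: "exp 1 * (3 * \<eta>) \<le> l * (1 - 3 * \<eta>)"
  proof -
    have "exp 1 * (3 * \<eta>) \<le> 3 * (3 * \<eta>)" using exp_le \<eta> by (intro mult_right_mono) auto
    also have "\<dots> = l * (9 / 20)" by (simp add: \<eta>_def)
    also have "\<dots> \<le> l * (1 - 3 * \<eta>)" using l_pos l_half by (intro mult_left_mono) (auto simp: \<eta>_def)
    finally show ?thesis .
  qed
  define \<theta> where "\<theta> = min (\<eta> / (8 * K)) (D * \<eta>\<^sup>2 / (64 * K))"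
  have \<theta>0: "0 < \<theta>" using \<eta> D K0 by (simp add: \<theta>_def)
  have \<theta>1: "8 * \<theta> * K \<le> \<eta>"
    using K0 by (simp add: \<theta>_def min_def field_simps)
  have \<theta>2: "64 * \<theta> * K \<le> D * \<eta>\<^sup>2"
    using K0 by (simp add: \<theta>_def min_def field_simps)
  define c where "c = min (D * \<theta> * \<eta> / (4 * real K)) (\<eta> / (real K)\<^sup>2)"
  have c: "0 < c" "c \<le> D * \<theta> * \<eta> / (4 * real K)" "c \<le> \<eta> / (real K)\<^sup>2"
    using \<eta> \<theta>0 D K0 by (auto simp: c_def)
  define C where "C = 2 * exp (2 * D) + 2 * exp 1"
  have C: "0 < C" by (simp add: C_def add_pos_pos)
  show ?thesis
  proof (intro exI conjI allI impI)
    show "0 < \<theta>" "0 < c" "0 < C" by fact+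
    fix N i j :: nat assume N: "1 \<le> N" and i: "1 \<le> i" and ij: "i \<le> j"
    define X where "X = i * (real j)\<^sup>2 / (real N)\<^sup>2"
    have X0: "0 \<le> X" by (simp add: X_def)
    have N0: "0 < real N" using N by simp
    let ?A = "\<lambda>n S. (real N)\<^sup>2 \<le> area n S \<and> n \<le> K * N \<and> i \<le> n - card S \<and> j \<le> card S \<and>
      real (left_steps n S i) / i \<le> real (right_steps n S j) / j + \<theta> * j / N"
    let ?B = "\<lambda>n S. (real N)\<^sup>2 \<le> area n S \<and> n \<le> K * N \<and> i \<le> n - card S \<and> j \<le> card S \<and>
      real (left_steps n S i) / i \<le> real (right_steps n S j) / j + \<theta> * j / N \<and>
      \<eta> \<le> real (right_steps n S j) / j \<and> real (right_steps n S j) / j \<le> 1 - \<eta>"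
    let ?E = "\<lambda>m n S. (real N)\<^sup>2 \<le> area n S \<and> m \<le> n - card S \<and>
      real (card ({n - card S - m..<n - card S} \<inter> S)) \<le> 2 * \<eta> * real m"
    show "wt ?A \<le> C * exp (- c * (i * (real j)\<^sup>2 / (real N)\<^sup>2)) * Z N"
    proof (cases "j \<le> K * N")
      case False
      have "?A n S \<Longrightarrow> False" if "S \<subseteq> {..<n}" for n S
        using False card_compl(2)[OF that] by auto
      then show ?thesis using Z_pos[of N] C by (intro wt_absurd) (blast, simp)
    next
      case True
      then have jKN: "real j \<le> real K * real N" by (metis of_nat_le_iff of_nat_mult)
      have \<theta>j: "\<theta> * j / N \<le> \<eta>"
      proof -
        have "\<theta> * j / N \<le> \<theta> * K" using jKN \<theta>0 N0 mult_left_mono[OF jKN, of \<theta>] by (simp add: field_simps)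
        then show ?thesis using \<theta>1 \<eta> by simp
      qed
      have "?B n S \<or> ?E i n S \<or> ?E j n (mirror n S)" if sub: "S \<subseteq> {..<n}" and A: "?A n S" for n S
      proof (cases "\<eta> \<le> real (right_steps n S j) / j")
        case lo: True
        show ?thesis
        proof (cases "real (right_steps n S j) / j \<le> 1 - \<eta>")
          case False
          have j0: "0 < real j" using i ij by simp
          have "real (left_steps n (mirror n S) j) = real j - real (right_steps n S j)"
            using sub A by (intro left_steps_mirror) auto
          also have "\<dots> \<le> \<eta> * j" using False j0 by (simp add: field_simps)
          also have "\<dots> \<le> 2 * \<eta> * j" using \<eta> by simp
          finally have "real (left_steps n (mirror n S) j) \<le> 2 * \<eta> * j" .
          moreover have "n - card (mirror n S) = card S"
            using card_mirror[OF sub] card_compl(2)[OF sub] by simp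
          ultimately show ?thesis using A area_mirror[OF sub] by (simp add: left_steps_def)
        qed (use A lo in simp)
      next
        case False
        have i0: "0 < real i" using i by simp
        have "real (left_steps n S i) / i \<le> 2 * \<eta>" using A False \<theta>j by linarith
        then have "real (left_steps n S i) \<le> 2 * \<eta> * i" using i0 by (simp add: field_simps)
        then show ?thesis using A by (simp add: left_steps_def)
      qed
      then have "wt ?A \<le> wt (\<lambda>n S. ?B n S \<or> (?E i n S \<or> ?E j n (mirror n S)))" by (intro wt_mono) blast
      also have "\<dots> \<le> wt ?B + wt (\<lambda>n S. ?E i n S \<or> ?E j n (mirror n S))" by (rule wt_disj)
      also have "\<dots> \<le> wt ?B + (wt (?E i) + wt (\<lambda>n S. ?E j n (mirror n S)))"
        by (intro add_left_mono wt_disj)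
      also have "\<dots> \<le> wt ?B + (wt (?E i) + wt (?E j))"
        by (intro add_left_mono wt_mirror)
      also have "\<dots> \<le> 2 * exp (2 * D) * exp (- c * X) * Z N
          + (exp 1 * exp (- c * X) * Z N + exp 1 * exp (- c * X) * Z N)"
      proof (intro add_mono)
        have "wt ?B \<le> 2 * exp (2 * D) * exp (- (D * \<theta> * \<eta> / (4 * real K)) * X) * Z N"
          unfolding D_def X_def
          by (rule wt_flip_core[OF N K i ij \<eta> \<theta>0 \<theta>1 \<theta>2[unfolded D_def]])
        also have "\<dots> \<le> 2 * exp (2 * D) * exp (- c * X) * Z N"
          using mult_right_mono[OF c(2) X0] Z_pos[of N] by (intro mult_right_mono mult_left_mono) auto
        finally show "wt ?B \<le> 2 * exp (2 * D) * exp (- c * X) * Z N" .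
        have steep: "wt (?E m) \<le> exp 1 * exp (- c * X) * Z N" if m: "X \<le> (real K)\<^sup>2 * m" for m
        proof -
          have "c * X \<le> \<eta> / (real K)\<^sup>2 * ((real K)\<^sup>2 * m)"
            using c m X0 \<eta> by (intro mult_mono) auto
          also have "\<dots> = \<eta> * m" using K0 by simp
          finally have cX: "c * X \<le> \<eta> * m" .
          have "wt (?E m) \<le> exp 1 * exp (- \<eta> * m) * Z N" by (rule wt_steep[OF \<eta>(1) \<eta>3])
          also have "\<dots> \<le> exp 1 * exp (- c * X) * Z N"
            using cX Z_pos[of N] by (intro mult_right_mono mult_left_mono) auto
          finally show ?thesis .
        qed
        \<comment> \<open>Because j <= K N, the exponent X is at most K^2 i, so the decay in i
          provided by \<open>wt_steep\<close> suffices.\<close>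
        have "(real j)\<^sup>2 \<le> (real K * real N)\<^sup>2" using jKN by (intro power_mono) auto
        then have "i * (real j)\<^sup>2 \<le> i * (real K * real N)\<^sup>2" by (intro mult_left_mono) auto
        then have Xi: "X \<le> (real K)\<^sup>2 * i" using N0 by (simp add: X_def field_simps power_mult_distrib)
        also have "\<dots> \<le> (real K)\<^sup>2 * j" using ij by (intro mult_left_mono) auto
        finally have Xj: "X \<le> (real K)\<^sup>2 * j" .
        show "wt (?E i) \<le> exp 1 * exp (- c * X) * Z N" by (rule steep[OF Xi])
        show "wt (?E j) \<le> exp 1 * exp (- c * X) * Z N" by (rule steep[OF Xj])
      qed
      also have "\<dots> = C * exp (- c * X) * Z N" by (simp add: C_def algebra_simps)
      finally show ?thesis by (simp add: X_def)
    qed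
  qed
qed

text \<open>Reflection interchanges i and j and replaces each slope by one minus that slope, which
  reverses the inequality twice and reduces i > j to the other case.\<close>

lemma wt_flip:
  assumes K: "1 \<le> K"
  shows "\<exists>\<theta> c C :: real. 0 < \<theta> \<and> 0 < c \<and> 0 < C \<and> (\<forall>N i j. 1 \<le> N \<longrightarrow> 1 \<le> i \<longrightarrow> 1 \<le> j \<longrightarrow>
    wt (\<lambda>n S. (real N)\<^sup>2 \<le> area n S \<and> n \<le> K * N \<and> i \<le> n - card S \<and> j \<le> card S \<and>
      real (left_steps n S i) / i \<le> real (right_steps n S j) / j + \<theta> * real (max i j) / real N)
    \<le> C * exp (- c * (real (min i j) * (real (max i j))\<^sup>2 / (real N)\<^sup>2)) * Z N)"
proof -
  let ?A = "\<lambda>\<theta> N i j n S. (real N)\<^sup>2 \<le> area n S \<and> n \<le> K * N \<and> i \<le> n - card S \<and> j \<le> card S \<and>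
      real (left_steps n S i) / i \<le> real (right_steps n S j) / j + \<theta> * real (max i j) / real N"
  obtain \<theta> c C :: real where pos: "0 < \<theta>" "0 < c" "0 < C" and short': "\<forall>N i j. 1 \<le> N \<longrightarrow> 1 \<le> i \<longrightarrow> i \<le> j \<longrightarrow>
    wt (\<lambda>n S. (real N)\<^sup>2 \<le> area n S \<and> n \<le> K * N \<and> i \<le> n - card S \<and> j \<le> card S \<and>
      real (left_steps n S i) / i \<le> real (right_steps n S j) / j + \<theta> * j / N)
    \<le> C * exp (- c * (i * (real j)\<^sup>2 / (real N)\<^sup>2)) * Z N"
    using wt_flip_short[OF K] by (elim exE conjE)
  note short = short'[rule_format]
  have "wt (?A \<theta> N i j) \<le> C * exp (- c * (real (min i j) * (real (max i j))\<^sup>2 / (real N)\<^sup>2)) * Z N"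
    if N: "1 \<le> N" and i: "1 \<le> i" and j: "1 \<le> j" for N i j
  proof (cases "i \<le> j")
    case True
    then show ?thesis using short[OF N i True] by (simp add: max_def min_def)
  next
    case False
    have "?A \<theta> N j i n (mirror n S)" if sub: "S \<subseteq> {..<n}" and A: "?A \<theta> N i j n S" for n S
    proof -
      have b: "n - card (mirror n S) = card S" "card (mirror n S) = n - card S"
        using card_mirror[OF sub] card_compl(2)[OF sub] by auto
      have "real (left_steps n (mirror n S) j) = real j - real (right_steps n S j)"
        "real (right_steps n (mirror n S) i) = real i - real (left_steps n S i)"
        using sub A by (auto intro: left_steps_mirror right_steps_mirror)
      moreover have "(real j - real (right_steps n S j)) / j = 1 - real (right_steps n S j) / j"
        "(real i - real (left_steps n S i)) / i = 1 - real (left_steps n S i) / i"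
        using i j by (simp_all add: diff_divide_distrib)
      ultimately show ?thesis using A b area_mirror[OF sub] by (simp add: max.commute)
    qed
    then have "wt (?A \<theta> N i j) \<le> wt (\<lambda>n S. ?A \<theta> N j i n (mirror n S))" by (intro wt_mono) blast
    also have "\<dots> \<le> wt (?A \<theta> N j i)" by (rule wt_mirror)
    also have "\<dots> \<le> C * exp (- c * (j * (real i)\<^sup>2 / (real N)\<^sup>2)) * Z N"
      using short[OF N j, of i] False by (simp add: max_def)
    finally show ?thesis using False by (simp add: max_def min_def)
  qed
  then show ?thesis using pos by (intro exI[of _ \<theta>] exI[of _ c] exI[of _ C] conjI allI impI)
qed

end

section \<open>Fluctuations inside a dyadic block\<close>

text \<open>A point is compared with the chord of its half of the interval, and the midpoint with
  the chord of the whole. The midpoint enters with weight at most 1, and \<open>G s\<close> bounds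
  twice its excess, so each scale contributes at most \<open>G s / 2\<close>.\<close>

lemma dyadic_chain:
  fixes f G :: "nat \<Rightarrow> real"
  assumes "\<And>s m. s < r \<Longrightarrow> m < 2 ^ (r - Suc s) \<Longrightarrow>
      2 * f (x + 2 * m * 2 ^ s + 2 ^ s) \<le> f (x + 2 * m * 2 ^ s) + f (x + 2 * m * 2 ^ s + 2 * 2 ^ s) + G s"
    and "\<And>s. 0 \<le> G s" and "v \<le> 2 ^ r"
  shows "f (x + v) \<le> f x + v / 2 ^ r * (f (x + 2 ^ r) - f x) + (\<Sum>s<r. G s) / 2"
  using assms(1,3)
proof (induction r arbitrary: x v)
  case 0
  then consider "v = 0" | "v = 1" by fastforce
  then show ?case by cases simp_all
next
  case (Suc r)
  have mid: "2 * f (x + 2 ^ r) \<le> f x + f (x + 2 ^ Suc r) + G r"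
  proof -
    have "2 * f (x + 2 * 0 * 2 ^ r + 2 ^ r)
        \<le> f (x + 2 * 0 * 2 ^ r) + f (x + 2 * 0 * 2 ^ r + 2 * 2 ^ r) + G r"
      by (rule Suc.prems(1)) simp_all
    then show ?thesis by (simp only: mult_zero_left mult_zero_right add_0_right power_Suc)
  qed
  have sub: "2 ^ (r - Suc s) * 2 = (2::nat) ^ (Suc r - Suc s)" if "s < r" for s
  proof -
    have "Suc r - Suc s = Suc (r - Suc s)" using that by arith
    then show ?thesis by simp
  qed
  show ?case
  proof (cases "v \<le> 2 ^ r")
    case True
    have "f (x + v) \<le> f x + v / 2 ^ r * (f (x + 2 ^ r) - f x) + (\<Sum>s<r. G s) / 2"
    proof (rule Suc.IH[OF _ True])
      fix s m :: nat assume "s < r" "m < 2 ^ (r - Suc s)"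
      then show "2 * f (x + 2 * m * 2 ^ s + 2 ^ s)
          \<le> f (x + 2 * m * 2 ^ s) + f (x + 2 * m * 2 ^ s + 2 * 2 ^ s) + G s"
        using Suc.prems(1)[of s m] sub[of s] by simp
    qed
    also have "v / 2 ^ r * (f (x + 2 ^ r) - f x)
        \<le> v / 2 ^ r * ((f x + f (x + 2 ^ Suc r) + G r) / 2 - f x)"
      using mid by (intro mult_left_mono) auto
    also have "\<dots> = v / 2 ^ Suc r * (f (x + 2 ^ Suc r) - f x) + v / 2 ^ r * (G r / 2)"
      by (simp add: field_simps)
    also have "v / 2 ^ r * (G r / 2) \<le> 1 * (G r / 2)"
      using True assms(2)[of r] by (intro mult_right_mono) (auto simp: field_simps simp flip: of_nat_power)
    finally show ?thesis by (simp add: field_simps)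
  next
    case False
    define w where "w = v - 2 ^ r"
    have v: "v = 2 ^ r + w" and w: "w \<le> 2 ^ r" using False Suc.prems(2) by (auto simp: w_def)
    have w1: "real w / 2 ^ r \<le> 1" using w by (simp add: field_simps flip: of_nat_power)
    have "f (x + 2 ^ r + w) \<le> f (x + 2 ^ r) + w / 2 ^ r * (f (x + 2 ^ r + 2 ^ r) - f (x + 2 ^ r)) + (\<Sum>s<r. G s) / 2"
    proof (rule Suc.IH[OF _ w])
      fix s m :: nat assume sm: "s < r" "m < 2 ^ (r - Suc s)"
      have p: "(2::nat) ^ r = 2 * 2 ^ (r - Suc s) * 2 ^ s"
        using sm(1) by (simp flip: power_add power_Suc)
      have "x + 2 * (m + 2 ^ (r - Suc s)) * 2 ^ s = x + 2 ^ r + 2 * m * 2 ^ s"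
        unfolding p by (simp add: algebra_simps)
      note e = this
      have "m + 2 ^ (r - Suc s) < 2 ^ (Suc r - Suc s)"
        using sm(2) sub[OF sm(1)] by linarith
      then show "2 * f (x + 2 ^ r + 2 * m * 2 ^ s + 2 ^ s)
          \<le> f (x + 2 ^ r + 2 * m * 2 ^ s) + f (x + 2 ^ r + 2 * m * 2 ^ s + 2 * 2 ^ s) + G s"
        using Suc.prems(1)[of s "m + 2 ^ (r - Suc s)", unfolded e] sm(1) by (simp only: less_SucI)
    qed
    then have "f (x + v) \<le> (1 - w / 2 ^ r) * f (x + 2 ^ r) + w / 2 ^ r * f (x + 2 ^ Suc r) + (\<Sum>s<r. G s) / 2"
      by (simp add: v algebra_simps mult_2)
    also have "(1 - w / 2 ^ r) * f (x + 2 ^ r)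
        \<le> (1 - w / 2 ^ r) * ((f x + f (x + 2 ^ Suc r) + G r) / 2)"
      using mid w1 by (intro mult_left_mono) auto
    also have "\<dots> = (1 - w / 2 ^ r) * ((f x + f (x + 2 ^ Suc r)) / 2) + (1 - w / 2 ^ r) * (G r / 2)"
      by (simp add: field_simps)
    also have "(1 - w / 2 ^ r) * (G r / 2) \<le> 1 * (G r / 2)"
      using assms(2)[of r] by (intro mult_right_mono) auto
    finally have "f (x + v) \<le> (1 - w / 2 ^ r) * ((f x + f (x + 2 ^ Suc r)) / 2) + w / 2 ^ r * f (x + 2 ^ Suc r)
        + (\<Sum>s<Suc r. G s) / 2"
      by (simp add: field_simps)
    also have "(1 - w / 2 ^ r) * ((f x + f (x + 2 ^ Suc r)) / 2) + w / 2 ^ r * f (x + 2 ^ Suc r)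
        = f x + v / 2 ^ Suc r * (f (x + 2 ^ Suc r) - f x)"
      by (simp add: v field_simps)
    finally show ?thesis .
  qed
qed

lemma right_steps_add:
  "right_steps n S (v + w)
    = right_steps n S v + card ({n - card S + v..<n - card S + v + w} \<inter> S)"
proof -
  have "{n - card S..<n - card S + (v + w)} \<inter> S
      = ({n - card S..<n - card S + v} \<inter> S) \<union> ({n - card S + v..<n - card S + v + w} \<inter> S)"
    by auto
  then show ?thesis unfolding right_steps_def by (simp add: card_Un_disjoint disjoint_iff)
qed

lemma summable_dyadic_tail: "summable (\<lambda>k. 2 ^ k * exp (- ((9 / 8) ^ k) / 2) :: real)"
proof (rule summable_comparison_test_ev[OF _ summable_geometric[of "1 / 2 :: real"]])
  have "\<forall>\<^sub>F k :: nat in sequentially. 2 ^ k * exp (- ((9 / 8) ^ k) / 2) \<le> (1 / 2 :: real) ^ k"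
    by real_asymp
  then show "\<forall>\<^sub>F k in sequentially. norm (2 ^ k * exp (- ((9 / 8) ^ k) / 2) :: real) \<le> (1 / 2) ^ k"
    by simp
qed simp

context subcritical
begin

lemma ln_inverse_pos: "0 < ln (1 / l)"
  using l_pos l_half by (simp add: ln_div)

text \<open>Chaining: the largest height above the chord of a cell has the same kind of Gaussian
  tail as the height at its midpoint. The condition on err asks that it dominate the natural bend of
  the cell, of order 4^r / N.\<close>

lemma wt_cell:
  "\<exists>B::real. 0 < B \<and> (\<forall>N r x err. 1 \<le> N \<longrightarrow> 16 * ln (1 / l) * 4 ^ r / N \<le> err \<longrightarrow>
    wt (\<lambda>n S. (real N)\<^sup>2 \<le> area n S \<and> x + 2 ^ r \<le> card S \<and> (\<exists>v\<le>2 ^ r.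
        real (right_steps n S x) + v / 2 ^ r * (real (right_steps n S (x + 2 ^ r)) - real (right_steps n S x)) + err
          < real (right_steps n S (x + v))))
    \<le> B * exp (- err\<^sup>2 / (128 * 2 ^ r)) * Z N)"
proof -
  define C where "C = exp (2 * ln (1 / l) + 1)"
  define B0 where "B0 = (\<Sum>k. 2 ^ k * exp (- ((9 / 8) ^ k) / 2) :: real)"
  have B0: "0 \<le> B0" unfolding B0_def by (intro suminf_nonneg summable_dyadic_tail) auto
  define B where "B = C * B0 + exp 1"
  have C0: "0 < C" by (simp add: C_def)
  have B: "0 < B" using C0 B0 by (simp add: B_def add_nonneg_pos)
  have "wt (\<lambda>n S. (real N)\<^sup>2 \<le> area n S \<and> x + 2 ^ r \<le> card S \<and> (\<exists>v\<le>2 ^ r.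
        real (right_steps n S x) + v / 2 ^ r * (real (right_steps n S (x + 2 ^ r)) - real (right_steps n S x)) + err
          < real (right_steps n S (x + v)))) \<le> B * exp (- err\<^sup>2 / (128 * 2 ^ r)) * Z N"
    (is "wt ?P \<le> _")
    if N: "1 \<le> N" and err: "16 * ln (1 / l) * 4 ^ r / N \<le> err" for N r x err
  proof -
    define y where "y = err\<^sup>2 / (64 * 2 ^ r)"
    have y0: "0 \<le> y" by (simp add: y_def)
    have y_half: "- err\<^sup>2 / (128 * 2 ^ r) = - y / 2" by (simp add: y_def)
    have err0: "0 \<le> err"
    proof -
      have "0 \<le> 16 * ln (1 / l) * 4 ^ r / N" using ln_inverse_pos by simp
      then show ?thesis using err by linarith
    qed
    show ?thesis
    proof (cases "1 \<le> y")
      case False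
      then have "0 \<le> 1 + - y / 2" by simp
      then have "1 \<le> exp 1 * exp (- y / 2)" by (simp only: one_le_exp_iff flip: exp_add)
      also have "\<dots> \<le> B * exp (- y / 2)"
        using C0 B0 by (intro mult_right_mono) (auto simp: B_def)
      finally have "1 * Z N \<le> B * exp (- y / 2) * Z N" using Z_pos[of N] by (intro mult_right_mono) auto
      moreover have "wt ?P \<le> Z N" by (rule wt_le_Z)
      ultimately show ?thesis unfolding y_half by simp
    next
      case True
      \<comment> \<open>The ratio 3/4 keeps the sum of all \<open>G s\<close> below 2 err. It also
        exceeds 1 / sqrt 2, so the exponents grow by the factor (3/4)^2 * 2 = 9/8 with each halving,
        which beats the doubling of the number of intervals.\<close>
      define G where "G s = err / 2 * (3 / 4) ^ (r - Suc s)" for s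
      have G0: "0 \<le> G s" for s using err0 by (simp add: G_def)
      have sumG: "(\<Sum>s<r. G s) / 2 \<le> err"
      proof -
        have "(\<Sum>s<r. G s) = err / 2 * (\<Sum>s<r. (3 / 4) ^ (r - Suc s))"
          by (simp add: G_def sum_distrib_left)
        also have "(\<Sum>s<r. (3 / 4) ^ (r - Suc s)) = (\<Sum>k<r. (3 / 4 :: real) ^ k)"
          by (rule sum.nat_diff_reindex)
        also have "\<dots> \<le> 4"
          by (subst sum_gp_strict) auto
        finally show ?thesis using err0 by (simp add: mult_left_mono)
      qed
      let ?Q = "\<lambda>s m n S. (real N)\<^sup>2 \<le> area n S \<and> n - card S + (x + 2 * m * 2 ^ s) + 2 * 2 ^ s \<le> n \<and>
          real (card ({n - card S + (x + 2 * m * 2 ^ s) + 2 ^ s..<n - card S + (x + 2 * m * 2 ^ s) + 2 * 2 ^ s} \<inter> S)) + G s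
            \<le> real (card ({n - card S + (x + 2 * m * 2 ^ s)..<n - card S + (x + 2 * m * 2 ^ s) + 2 ^ s} \<inter> S))"
      have "\<exists>s\<in>{..<r}. \<exists>m\<in>{..<2 ^ (r - Suc s)}. ?Q s m n S" if sub: "S \<subseteq> {..<n}" and P: "?P n S" for n S
      proof (rule ccontr)
        assume neg: "\<not> ?thesis"
        have A: "(real N)\<^sup>2 \<le> area n S" and dom: "x + 2 ^ r \<le> card S" using P by auto
        have c: "card S \<le> n" by (rule card_compl(2)[OF sub])
        have "real (right_steps n S (x + v)) \<le> real (right_steps n S x)
            + v / 2 ^ r * (real (right_steps n S (x + 2 ^ r)) - real (right_steps n S x)) + (\<Sum>s<r. G s) / 2"
          if v: "v \<le> 2 ^ r" for v
        proof (rule dyadic_chain[where f = "\<lambda>v. real (right_steps n S v)", OF _ G0 v])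
          fix s m :: nat assume sm: "s < r" "m < 2 ^ (r - Suc s)"
          let ?z = "x + 2 * m * 2 ^ s"
          have "Suc m * (2 * 2 ^ s) \<le> 2 ^ (r - Suc s) * (2 * 2 ^ s)"
            using sm by (intro mult_right_mono) auto
          also have "\<dots> = 2 ^ r" using sm(1) by (simp flip: power_add power_Suc)
          finally have "?z + 2 * 2 ^ s \<le> x + 2 ^ r" by (simp add: algebra_simps)
          then have "n - card S + ?z + 2 * 2 ^ s \<le> n" using dom c by linarith
          moreover have "\<not> ?Q s m n S" using neg sm by blast
          ultimately have "real (card ({n - card S + ?z..<n - card S + ?z + 2 ^ s} \<inter> S))
              < real (card ({n - card S + ?z + 2 ^ s..<n - card S + ?z + 2 * 2 ^ s} \<inter> S)) + G s"
            using A by force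
          moreover have "right_steps n S (?z + 2 ^ s)
              = right_steps n S ?z + card ({n - card S + ?z..<n - card S + ?z + 2 ^ s} \<inter> S)"
            by (rule right_steps_add)
          moreover have "right_steps n S (?z + 2 * 2 ^ s)
              = right_steps n S (?z + 2 ^ s) + card ({n - card S + ?z + 2 ^ s..<n - card S + ?z + 2 * 2 ^ s} \<inter> S)"
            using right_steps_add[of n S "?z + 2 ^ s" "2 ^ s"] by (simp add: mult_2 add.assoc)
          ultimately show "2 * real (right_steps n S (?z + 2 ^ s))
              \<le> real (right_steps n S ?z) + real (right_steps n S (?z + 2 * 2 ^ s)) + G s"
            by simp
        qed
        then show False using P sumG by force
      qed
      then have "wt ?P \<le> wt (\<lambda>n S. \<exists>s\<in>{..<r}. \<exists>m\<in>{..<2 ^ (r - Suc s)}. ?Q s m n S)"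
        by (intro wt_mono) blast
      also have "\<dots> \<le> (\<Sum>s<r. wt (\<lambda>n S. \<exists>m\<in>{..<2 ^ (r - Suc s)}. ?Q s m n S))"
        by (rule wt_Ex) simp
      also have "\<dots> \<le> (\<Sum>s<r. C * Z N * exp (- y / 2) * (2 ^ (r - Suc s) * exp (- ((9 / 8) ^ (r - Suc s)) / 2)))"
      proof (rule sum_mono)
        fix s assume s: "s \<in> {..<r}"
        let ?k = "r - Suc s"
        have r_eq: "r = Suc (s + ?k)" using s by auto
        have two: "(2::real) ^ r = 2 * 2 ^ s * 2 ^ ?k" by (subst r_eq) (simp add: power_add)
        have four: "(4::real) ^ r = 4 * (2 ^ s)\<^sup>2 * 4 ^ ?k"
          by (subst r_eq) (simp add: power_add power2_eq_square flip: power_mult_distrib)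
        have G_ge: "32 * ln (1 / l) * (real (2 ^ s))\<^sup>2 / N \<le> G s"
        proof -
          have "1 \<le> (3::real) ^ ?k" by simp
          then have "(32 * ln (1 / l) * (2 ^ s)\<^sup>2 / N) * 1 \<le> (32 * ln (1 / l) * (2 ^ s)\<^sup>2 / N) * 3 ^ ?k"
            using ln_inverse_pos by (intro mult_left_mono) auto
          also have "\<dots> = 16 * ln (1 / l) * 4 ^ r / N / 2 * (3 / 4) ^ ?k"
            unfolding four by (simp add: power_divide)
          also have "\<dots> \<le> G s"
            unfolding G_def using err by (intro mult_right_mono divide_right_mono) auto
          finally show ?thesis by simp
        qed
        have exps: "exp (- (G s)\<^sup>2 / (32 * real (2 ^ s))) \<le> exp (- y / 2) * exp (- ((9 / 8) ^ ?k) / 2)"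
        proof -
          have "(G s)\<^sup>2 / (32 * real (2 ^ s)) = y * (9 / 8) ^ ?k"
          proof -
            have "(9 / 8 :: real) ^ ?k = ((3 / 4) ^ ?k)\<^sup>2 * 2 ^ ?k"
              by (simp add: power2_eq_square flip: power_mult_distrib)
            then show ?thesis unfolding G_def y_def two
              by (simp add: power_mult_distrib power2_eq_square)
          qed
          \<comment> \<open>One half of the exponent keeps the decay in y, the other makes the sum
            over scales converge; the case assumption 1 <= y enters here.\<close>
          moreover have "y / 2 + (9 / 8) ^ ?k / 2 \<le> y * (9 / 8) ^ ?k"
          proof -
            have "1 \<le> (9 / 8 :: real) ^ ?k" by simp
            then have "y * 1 \<le> y * (9 / 8) ^ ?k" "1 * (9 / 8) ^ ?k \<le> y * (9 / 8) ^ ?k"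
              using True by (auto intro: mult_left_mono mult_right_mono)
            then show ?thesis by linarith
          qed
          ultimately show ?thesis by (simp flip: exp_add)
        qed
        have "wt (\<lambda>n S. \<exists>m\<in>{..<2 ^ ?k}. ?Q s m n S) \<le> (\<Sum>m<2 ^ ?k. wt (?Q s m))"
          by (rule wt_Ex) simp
        also have "\<dots> \<le> (\<Sum>m<(2::nat) ^ ?k. C * exp (- (G s)\<^sup>2 / (32 * real (2 ^ s))) * Z N)"
        proof (rule sum_mono)
          fix m
          show "wt (?Q s m) \<le> C * exp (- (G s)\<^sup>2 / (32 * real (2 ^ s))) * Z N"
            unfolding C_def by (rule wt_mid[OF N _ G0 G_ge]) simp
        qed
        also have "\<dots> = 2 ^ ?k * (C * Z N) * exp (- (G s)\<^sup>2 / (32 * real (2 ^ s)))"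
          by simp
        also have "\<dots> \<le> 2 ^ ?k * (C * Z N) * (exp (- y / 2) * exp (- ((9 / 8) ^ ?k) / 2))"
          using exps C0 Z_pos[of N] by (intro mult_left_mono) auto
        finally show "wt (\<lambda>n S. \<exists>m\<in>{..<2 ^ ?k}. ?Q s m n S)
            \<le> C * Z N * exp (- y / 2) * (2 ^ ?k * exp (- ((9 / 8) ^ ?k) / 2))"
          by (simp add: mult_ac)
      qed
      also have "\<dots> = C * Z N * exp (- y / 2) * (\<Sum>s<r. 2 ^ (r - Suc s) * exp (- ((9 / 8) ^ (r - Suc s)) / 2))"
        by (simp add: sum_distrib_left)
      also have "(\<Sum>s<r. 2 ^ (r - Suc s) * exp (- ((9 / 8) ^ (r - Suc s)) / 2))
          = (\<Sum>k<r. 2 ^ k * exp (- ((9 / 8) ^ k) / 2) :: real)"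
        by (rule sum.nat_diff_reindex)
      also have "C * Z N * exp (- y / 2) * \<dots> \<le> C * Z N * exp (- y / 2) * B0"
        unfolding B0_def using C0 Z_pos[of N]
        by (intro mult_left_mono sum_le_suminf summable_dyadic_tail) auto
      also have "\<dots> = (C * B0) * exp (- y / 2) * Z N" by simp
      also have "\<dots> \<le> B * exp (- y / 2) * Z N"
        using Z_pos[of N] by (intro mult_right_mono) (auto simp: B_def)
      finally show ?thesis unfolding y_half .
    qed
  qed
  then show ?thesis using B by (intro exI[of _ B] conjI allI impI)
qed

end

section \<open>Chords over the diagonal\<close>

text \<open>Seen from the origin, no point of a chord is steeper than the steeper of its two ends.
  This moves a point inside a cell to an end of that cell.\<close>

lemma interpolation_le_max_ratio:
  fixes p q w A B :: real
  assumes "0 < p" "0 < q" "0 \<le> w" "w \<le> 1"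
  shows "A + w * (B - A) \<le> max (A / p) (B / q) * (p + w * (q - p))"
proof -
  define m where "m = max (A / p) (B / q)"
  have "A / p \<le> m" "B / q \<le> m" by (auto simp: m_def)
  then have "A \<le> m * p" "B \<le> m * q" using assms by (simp_all add: divide_le_eq)
  then have "(1 - w) * A + w * B \<le> (1 - w) * (m * p) + w * (m * q)"
    using assms by (intro add_mono mult_left_mono) auto
  then show ?thesis by (simp add: m_def[symmetric] algebra_simps)
qed

text \<open>Since \<tau> >= 1, the ratio of the geometric series is at most exp (-a), so that the
  prefactor is uniform in \<tau>.\<close>

lemma sum_exp_le:
  fixes a \<tau> :: real
  assumes "0 < a" "1 \<le> \<tau>" "A \<subseteq> {1..m}"
  shows "(\<Sum>k\<in>A. exp (- a * \<tau> * real k)) \<le> exp (- a * \<tau>) / (1 - exp (- a))"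
proof -
  define x where "x = exp (- a * \<tau>)"
  have a: "exp (- a) < 1" using assms by simp
  have "- a * \<tau> \<le> - a" using assms mult_left_mono[of 1 \<tau> a] by simp
  then have x: "0 < x" "x \<le> exp (- a)" "x < 1" using a by (auto simp: x_def intro: le_less_trans)
  have "(\<Sum>k\<in>A. exp (- a * \<tau> * real k)) \<le> (\<Sum>k=1..m. exp (- a * \<tau> * real k))"
    using assms by (intro sum_mono2) auto
  also have "\<dots> = (\<Sum>k=1..m. x ^ k)" by (simp only: x_def exp_of_nat2_mult)
  also have "\<dots> = x * (\<Sum>k<m. x ^ k)"
    by (induction m) (auto simp: algebra_simps)
  also have "(\<Sum>k<m. x ^ k) = (1 - x ^ m) / (1 - x)"
    using x by (subst sum_gp_strict) auto
  also have "x * ((1 - x ^ m) / (1 - x)) \<le> x * (1 / (1 - exp (- a)))"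
    using x a by (intro mult_left_mono frac_le) auto
  finally show ?thesis by (simp add: x_def)
qed

text \<open>Used with x = d, whose cube dominates N^2 and thereby the number of pairs of distant
  chord ends.\<close>

lemma cube_exp_le:
  fixes a x :: real
  assumes "0 < a" "0 \<le> x"
  shows "x ^ 3 * exp (- a * x) \<le> (6 / a) ^ 3 * exp (- (a / 2) * x)"
proof -
  have "a * x / 6 \<le> exp (a * x / 6)" using exp_ge_add_one_self[of "a * x / 6"] by linarith
  then have "(a * x / 6) ^ 3 \<le> exp (a * x / 6) ^ 3" using assms by (intro power_mono) auto
  also have "\<dots> = exp (a / 2 * x)" by (simp flip: exp_of_nat_mult)
  finally have "(6 / a) ^ 3 * (a * x / 6) ^ 3 \<le> (6 / a) ^ 3 * exp (a / 2 * x)"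
    using assms by (intro mult_left_mono) auto
  moreover have "(6 / a) ^ 3 * (a * x / 6) ^ 3 = x ^ 3"
    using assms by (simp flip: power_mult_distrib)
  ultimately have "x ^ 3 * exp (- a * x) \<le> (6 / a) ^ 3 * exp (a / 2 * x) * exp (- a * x)"
    by (intro mult_right_mono) auto
  also have "\<dots> = (6 / a) ^ 3 * exp (- (a / 2) * x)"
    by (simp add: mult.assoc flip: exp_add)
  finally show ?thesis .
qed

text \<open>Multiplied out, the inequality says that the chord from the point i steps before the
  diagonal to the point j steps after it crosses the diagonal at a first coordinate exceeding that
  of the path by at least h / 2. Written with slopes, it grants each end an allowance of its
  own.\<close>

definition chord_gap :: "real \<Rightarrow> nat \<Rightarrow> nat set \<Rightarrow> bool" where
  "chord_gap h n S \<longleftrightarrow> (\<exists>i j. 1 \<le> i \<and> i \<le> n - card S \<and> 1 \<le> j \<and> j \<le> card S \<and>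
     real (left_steps n S i) / i + h / (2 * i) \<le> real (right_steps n S j) / j - h / (2 * j))"

text \<open>Multiples of d at first, every integer from k d on. Distant ends are not thinned out:
  once k d is of order N, the slope estimate decays exponentially in d there, which outweighs the
  number of pairs.\<close>

definition grid :: "nat \<Rightarrow> nat \<Rightarrow> nat \<Rightarrow> nat \<Rightarrow> nat set" where
  "grid d L k M = (\<lambda>i. i * d) ` {L..k} \<union> {k * d..M}"

text \<open>
  The error \<open>e * g\<close> is compensated by the curvature: slopes at distance \<open>g\<close> from the diagonal
  have changed by an amount proportional to \<open>g\<close>.
\<close>

definition tame :: "nat set \<Rightarrow> real \<Rightarrow> real \<Rightarrow> nat \<Rightarrow> nat set \<Rightarrow> bool" where
  "tame G h e n S \<longleftrightarrow> (\<forall>v. 1 \<le> v \<longrightarrow> v \<le> card S \<longrightarrow> (\<exists>g\<in>G. g \<le> card S \<and>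
     real (right_steps n S v) / v - h / (2 * v) \<le> real (right_steps n S g) / g + e * g))"

text \<open>Division by v turns height errors into slope errors. The error h / 2 next to the
  diagonal is covered by h / (2 v), the error e (k d)^2 in a later cell becomes at most e k d, and
  beyond k1 d every v is itself in the grid.\<close>

lemma tameI:
  assumes d: "1 \<le> d" and L: "1 \<le> L" "L \<le> k1" and S: "k1 * d \<le> card S" "card S \<le> M"
    and e: "0 \<le> e"
    and near: "\<And>v. v \<le> L * d \<Longrightarrow> real (right_steps n S v)
      \<le> v / real (L * d) * real (right_steps n S (L * d)) + h / 2"
    and far: "\<And>k v. L \<le> k \<Longrightarrow> k < k1 \<Longrightarrow> v \<le> d \<Longrightarrow> real (right_steps n S (k * d + v))
      \<le> real (right_steps n S (k * d)) + v / d * (real (right_steps n S (k * d + d)) - real (right_steps n S (k * d)))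
        + e * (real (k * d))\<^sup>2"
  shows "tame (grid d L k1 M) h e n S"
  unfolding tame_def
proof (intro allI impI)
  fix v assume v: "1 \<le> v" "v \<le> card S"
  have v0: "0 < real v" using v by simp
  have d0: "0 < real d" using d by simp
  consider "v \<le> L * d" | "L * d < v" "v < k1 * d" | "k1 * d \<le> v" by linarith
  then show "\<exists>g\<in>grid d L k1 M. g \<le> card S \<and>
     real (right_steps n S v) / v - h / (2 * v) \<le> real (right_steps n S g) / g + e * g"
  proof cases
    case 1
    have "real (right_steps n S v) / v \<le> (v / real (L * d) * real (right_steps n S (L * d)) + h / 2) / v"
      using near[OF 1] v0 by (intro divide_right_mono) auto
    also have "\<dots> = real (right_steps n S (L * d)) / real (L * d) + h / (2 * v)"
      using v0 by (simp add: add_divide_distrib)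
    finally have "real (right_steps n S v) / v - h / (2 * v)
        \<le> real (right_steps n S (L * d)) / real (L * d) + e * real (L * d)"
      using e by (simp add: add_increasing2)
    moreover have "L * d \<le> k1 * d" using L by (intro mult_right_mono) auto
    then have "L * d \<le> card S" using S by linarith
    moreover have "L * d \<in> grid d L k1 M" using L by (auto simp: grid_def)
    ultimately show ?thesis by blast
  next
    case 2
    define k where "k = v div d"
    define w where "w = v mod d"
    have vk: "v = k * d + w" by (simp add: k_def w_def)
    have w: "w \<le> d" using d by (simp add: w_def less_imp_le)
    have k: "L \<le> k" "k < k1"
      using 2 d by (auto simp: k_def less_eq_div_iff_mult_less_eq div_less_iff_less_mult)
    have kd: "0 < real (k * d)" using k L d by simp
    have "0 < (k + 1) * d" using d by simp
    then have kd1: "0 < real ((k + 1) * d)" by (simp only: of_nat_0_less_iff)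
    let ?m = "max (real (right_steps n S (k * d)) / real (k * d)) (real (right_steps n S ((k + 1) * d)) / real ((k + 1) * d))"
    have "real (right_steps n S v) \<le> real (right_steps n S (k * d))
        + w / d * (real (right_steps n S ((k + 1) * d)) - real (right_steps n S (k * d))) + e * (real (k * d))\<^sup>2"
      using far[OF k w] by (simp add: vk algebra_simps)
    also have "real (right_steps n S (k * d))
        + w / d * (real (right_steps n S ((k + 1) * d)) - real (right_steps n S (k * d)))
        \<le> ?m * (real (k * d) + w / d * (real ((k + 1) * d) - real (k * d)))"
      using w d0 by (intro interpolation_le_max_ratio kd kd1) auto
    also have "real (k * d) + w / d * (real ((k + 1) * d) - real (k * d)) = real v"
      using d0 by (simp add: vk algebra_simps)
    finally have le: "real (right_steps n S v) \<le> ?m * v + e * (real (k * d))\<^sup>2" by simp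
    have "e * (real (k * d))\<^sup>2 \<le> e * (real (k * d) * v)"
      using e kd unfolding power2_eq_square by (intro mult_left_mono) (auto simp: vk)
    then have "real (right_steps n S v) \<le> (?m + e * real (k * d)) * v"
      using le by (simp add: algebra_simps)
    then have "real (right_steps n S v) / v \<le> ?m + e * real (k * d)"
      using v0 by (simp add: divide_le_eq)
    moreover have "0 \<le> h / (2 * v)"
    proof -
      have "0 \<le> h" using near[of 0] by (simp add: right_steps_def)
      then show ?thesis by simp
    qed
    ultimately have *: "real (right_steps n S v) / v - h / (2 * v) \<le> ?m + e * real (k * d)" by linarith
    have in_grid: "k * d \<in> grid d L k1 M" "(k + 1) * d \<in> grid d L k1 M"
      unfolding grid_def using k by (intro UnI1 imageI; simp)+
    have "k * d \<le> k1 * d" "(k + 1) * d \<le> k1 * d" using k by (auto intro: mult_right_mono simp del: mult_Suc)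
    then have le_card: "k * d \<le> card S" "(k + 1) * d \<le> card S" using S by linarith+
    show ?thesis
    proof (cases "?m = real (right_steps n S (k * d)) / real (k * d)")
      case True
      then show ?thesis using * in_grid(1) le_card(1) by (intro bexI[of _ "k * d"]) auto
    next
      case False
      then have "?m = real (right_steps n S ((k + 1) * d)) / real ((k + 1) * d)" by linarith
      moreover have "e * real (k * d) \<le> e * real ((k + 1) * d)" using e by (intro mult_left_mono) auto
      ultimately show ?thesis using * in_grid(2) le_card(2) by (intro bexI[of _ "(k + 1) * d"]) auto
    qed
  next
    case 3
    have "0 \<le> h" using near[of 0] by (simp add: right_steps_def)
    then have "real (right_steps n S v) / v - h / (2 * v) \<le> real (right_steps n S v) / v + e * v"
      using e by (simp add: add_increasing2 order.trans[of _ "real (right_steps n S v) / v"])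
    moreover have "v \<in> grid d L k1 M" using 3 v S by (auto simp: grid_def)
    ultimately show ?thesis using v by blast
  qed
qed

context subcritical
begin

text \<open>One long cell at the diagonal has error h / 2, the cells of length 2^r farther out have
  error e (k d)^2 with d = 2^r. Each must dominate the bend of its cell: this is the origin of h and
  of the condition linking e and u. The resulting exponents are a1 \<tau> and a2 \<tau> k^4.\<close>

lemma wt_not_tame:
  fixes B h e a1 a2 \<tau> :: real
  assumes cell: "\<And>N r x err. 1 \<le> N \<Longrightarrow> 16 * ln (1 / l) * 4 ^ r / N \<le> err \<Longrightarrow>
    wt (\<lambda>n S. (real N)\<^sup>2 \<le> area n S \<and> x + 2 ^ r \<le> card S \<and> (\<exists>v\<le>2 ^ r.
        real (right_steps n S x) + v / 2 ^ r * (real (right_steps n S (x + 2 ^ r)) - real (right_steps n S x)) + err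
          < real (right_steps n S (x + v))))
    \<le> B * exp (- err\<^sup>2 / (128 * 2 ^ r)) * Z N"
    and B: "0 < B" and N: "1 \<le> N" and K: "1 \<le> K" and k1: "2 ^ u \<le> k1" "k1 * 2 ^ r * K \<le> N"
    and e: "0 < e" "16 * ln (1 / l) \<le> e * 4 ^ u * N"
    and h: "h = 32 * ln (1 / l) * 4 ^ u * 4 ^ r / N"
    and \<tau>: "\<tau> = 8 ^ r / (real N)\<^sup>2" "1 \<le> \<tau>"
    and a1: "a1 = 2 * (ln (1 / l))\<^sup>2 * 8 ^ u" and a2: "a2 = (e * N)\<^sup>2 / 128"
  shows "wt (\<lambda>n S. (real N)\<^sup>2 \<le> area n S \<and> n \<le> K * N \<and> \<not> tame (grid (2 ^ r) (2 ^ u) k1 (K * N)) h e n S)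
    \<le> (B * exp (- a1 * \<tau>) + B * (exp (- a2 * \<tau>) / (1 - exp (- a2)))) * Z N"
    (is "wt ?P \<le> _")
proof -
  define d :: nat where "d = 2 ^ r"
  define L :: nat where "L = 2 ^ u"
  have N0: "0 < real N" using N by simp
  let ?C = "\<lambda>x r err n S. (real N)\<^sup>2 \<le> area n S \<and> x + 2 ^ r \<le> card S \<and> (\<exists>v\<le>2 ^ r.
        real (right_steps n S x) + v / 2 ^ r * (real (right_steps n S (x + 2 ^ r)) - real (right_steps n S x)) + err
          < real (right_steps n S (x + v)))"
  have "?C 0 (r + u) (h / 2) n S \<or> (\<exists>k\<in>{L..<k1}. ?C (k * d) r (e * (real (k * d))\<^sup>2) n S)"
    if sub: "S \<subseteq> {..<n}" and P: "?P n S" for n S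
  proof (rule ccontr)
    assume neg: "\<not> ?thesis"
    have c: "card S \<le> n" by (rule card_compl(2)[OF sub])
    have A: "(real N)\<^sup>2 \<le> area n S" and nK: "n \<le> K * N" using P by auto
    \<comment> \<open>The bounding rectangle has area at most \<open>card S\<close> times K N, so
      the path continues for at least N / K steps after the diagonal and reaches the last multiple
      in the grid.\<close>
    have "real N * real N \<le> real (card S) * real (n - card S)"
      using A area_le_rectangle[OF sub] by (simp add: power2_eq_square)
    also have "\<dots> \<le> real (card S) * (real K * real N)"
      using nK by (intro mult_left_mono) (auto simp flip: of_nat_mult)
    finally have "real N \<le> real (card S) * real K" using N0 by simp
    then have "N \<le> card S * K" by (metis of_nat_le_iff of_nat_mult)
    moreover have "k1 * d * K \<le> N" using k1 by (simp add: d_def)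
    ultimately have "k1 * d * K \<le> card S * K" by linarith
    then have kd: "k1 * d \<le> card S" using K unfolding mult_le_cancel2 by linarith
    have Ld: "L * d = 2 ^ (r + u)" by (simp add: L_def d_def power_add)
    have "L * d \<le> k1 * d" using k1 by (intro mult_right_mono) (auto simp: L_def)
    then have Lc: "2 ^ (r + u) \<le> card S" using kd Ld by linarith
    have "tame (grid d L k1 (K * N)) h e n S"
    proof (rule tameI)
      fix v assume v: "v \<le> L * d"
      have "\<not> ?C 0 (r + u) (h / 2) n S" using neg by blast
      then have "real (right_steps n S (0 + v)) \<le> real (right_steps n S 0)
          + v / 2 ^ (r + u) * (real (right_steps n S (0 + 2 ^ (r + u))) - real (right_steps n S 0)) + h / 2"
        using A Lc v unfolding Ld by (auto simp: not_less)
      moreover have "right_steps n S 0 = 0" by (simp add: right_steps_def)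
      moreover have "real L * real d = 2 ^ (r + u)" by (simp add: L_def d_def power_add)
      ultimately show "real (right_steps n S v) \<le> v / real (L * d) * real (right_steps n S (L * d)) + h / 2"
        unfolding Ld by simp
    next
      fix k v assume k: "L \<le> k" "k < k1" and v: "v \<le> d"
      have "\<not> ?C (k * d) r (e * (real (k * d))\<^sup>2) n S" using neg k by (meson atLeastLessThan_iff)
      moreover have "k * d + 2 ^ r \<le> card S"
      proof -
        have "(k + 1) * d \<le> k1 * d" using k by (intro mult_right_mono) auto
        then show ?thesis using kd by (simp add: d_def)
      qed
      ultimately show "real (right_steps n S (k * d + v))
        \<le> real (right_steps n S (k * d)) + v / d * (real (right_steps n S (k * d + d)) - real (right_steps n S (k * d)))
        + e * (real (k * d))\<^sup>2"
        using A v by (auto simp: not_less d_def)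
    qed (use kd c nK k1 e in \<open>auto simp: d_def L_def\<close>)
    then show False using P by (simp add: d_def L_def)
  qed
  then have "wt ?P \<le> wt (\<lambda>n S. ?C 0 (r + u) (h / 2) n S \<or> (\<exists>k\<in>{L..<k1}. ?C (k * d) r (e * (real (k * d))\<^sup>2) n S))"
    by (intro wt_mono) blast
  also have "\<dots> \<le> wt (?C 0 (r + u) (h / 2)) + wt (\<lambda>n S. \<exists>k\<in>{L..<k1}. ?C (k * d) r (e * (real (k * d))\<^sup>2) n S)"
    by (rule wt_disj)
  also have "wt (\<lambda>n S. \<exists>k\<in>{L..<k1}. ?C (k * d) r (e * (real (k * d))\<^sup>2) n S)
      \<le> (\<Sum>k\<in>{L..<k1}. wt (?C (k * d) r (e * (real (k * d))\<^sup>2)))"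
    by (rule wt_Ex) simp
  also have "(\<Sum>k\<in>{L..<k1}. wt (?C (k * d) r (e * (real (k * d))\<^sup>2)))
      \<le> (\<Sum>k\<in>{L..<k1}. B * exp (- a2 * \<tau> * real k) * Z N)"
  proof (rule sum_mono)
    fix k assume k: "k \<in> {L..<k1}"
    have k1: "1 \<le> real k" using k L_def by (metis atLeastLessThan_iff one_le_numeral one_le_power order.trans real_of_nat_ge_one_iff)
    have d2: "(real d)\<^sup>2 = 4 ^ r" by (simp add: d_def power2_eq_square flip: power_mult_distrib)
    have "16 * ln (1 / l) * 4 ^ r / N \<le> e * (real (k * d))\<^sup>2"
    proof -
      have "(real L)\<^sup>2 = 4 ^ u" by (simp add: L_def power2_eq_square flip: power_mult_distrib)
      then have "4 ^ u \<le> (real k)\<^sup>2" using k power_mono[of "real L" "real k" 2] by simp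
      then have "e * 4 ^ u * N \<le> e * (real k)\<^sup>2 * N" using e by (intro mult_right_mono mult_left_mono) auto
      then have "16 * ln (1 / l) \<le> e * (real k)\<^sup>2 * N" using e(2) by linarith
      then have "16 * ln (1 / l) * 4 ^ r \<le> e * (real k)\<^sup>2 * N * 4 ^ r"
        by (intro mult_right_mono) auto
      then show ?thesis using N0 by (simp add: divide_le_eq power_mult_distrib d2 mult_ac)
    qed
    from cell[OF N this, of "k * d"]
    have "wt (?C (k * d) r (e * (real (k * d))\<^sup>2)) \<le> B * exp (- (e * (real (k * d))\<^sup>2)\<^sup>2 / (128 * 2 ^ r)) * Z N" .
    also have "\<dots> \<le> B * exp (- a2 * \<tau> * real k) * Z N"
    proof -
      have "(e * (real (k * d))\<^sup>2)\<^sup>2 / (128 * 2 ^ r) = e\<^sup>2 / 128 * (real k) ^ 4 * ((real d) ^ 4 / 2 ^ r)"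
        by (simp add: power_mult_distrib)
      also have "(real d) ^ 4 / 2 ^ r = 8 ^ r"
      proof -
        have "(real d) ^ 4 = 8 ^ r * 2 ^ r"
          by (simp add: d_def flip: power_mult_distrib power_mult) (simp add: power_mult mult.commute[of r])
        then show ?thesis by simp
      qed
      also have "e\<^sup>2 / 128 * (real k) ^ 4 * 8 ^ r = a2 * \<tau> * (real k) ^ 4"
        using N0 by (simp add: a2 \<tau> power_mult_distrib)
      finally have eq: "(e * (real (k * d))\<^sup>2)\<^sup>2 / (128 * 2 ^ r) = a2 * \<tau> * (real k) ^ 4" .
      have "real k ^ 1 \<le> real k ^ 4" using k1 by (intro power_increasing) auto
      then have "a2 * \<tau> * real k \<le> a2 * \<tau> * (real k) ^ 4"
        using \<tau> by (intro mult_left_mono) (auto simp: a2)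
      then have "- (e * (real (k * d))\<^sup>2)\<^sup>2 / (128 * 2 ^ r) \<le> - a2 * \<tau> * real k" using eq by simp
      then show ?thesis using B Z_pos[of N] by (intro mult_right_mono mult_left_mono) auto
    qed
    finally show "wt (?C (k * d) r (e * (real (k * d))\<^sup>2)) \<le> B * exp (- a2 * \<tau> * real k) * Z N" .
  qed
  also have "\<dots> = B * (\<Sum>k\<in>{L..<k1}. exp (- a2 * \<tau> * real k)) * Z N"
    by (simp add: sum_distrib_left sum_distrib_right)
  also have "\<dots> \<le> B * (exp (- a2 * \<tau>) / (1 - exp (- a2))) * Z N"
  proof -
    have "1 \<le> L" by (simp add: L_def)
    then have "{L..<k1} \<subseteq> {1..k1}" by auto
    then show ?thesis
      using B Z_pos[of N] e N0 \<tau> by (intro mult_right_mono mult_left_mono sum_exp_le) (auto simp: a2)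
  qed
  also have "wt (?C 0 (r + u) (h / 2)) \<le> B * exp (- a1 * \<tau>) * Z N"
  proof -
    have "16 * ln (1 / l) * 4 ^ (r + u) / N \<le> h / 2" by (simp add: h power_add)
    from cell[OF N this, of 0]
    have "wt (?C 0 (r + u) (h / 2)) \<le> B * exp (- (h / 2)\<^sup>2 / (128 * 2 ^ (r + u))) * Z N" .
    moreover have "(h / 2)\<^sup>2 / (128 * 2 ^ (r + u)) = a1 * \<tau>"
    proof -
      have "(h / 2)\<^sup>2 = 256 * (ln (1 / l))\<^sup>2 * (16 ^ u * 16 ^ r) / (real N)\<^sup>2"
      proof -
        have "(16::real) ^ u = 4 ^ u * 4 ^ u" "(16::real) ^ r = 4 ^ r * 4 ^ r"
          by (simp_all flip: power_mult_distrib)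
        then show ?thesis by (simp add: h power2_eq_square mult_ac)
      qed
      moreover have "(16::real) ^ u = 8 ^ u * 2 ^ u" "(16::real) ^ r = 8 ^ r * 2 ^ r"
        by (simp_all flip: power_mult_distrib)
      ultimately show ?thesis by (simp add: a1 \<tau> power_add)
    qed
    then have "- (h / 2)\<^sup>2 / (128 * 2 ^ (r + u)) = - a1 * \<tau>" by simp
    ultimately show ?thesis by simp
  qed
  finally show ?thesis by (simp add: algebra_simps)
qed


text \<open>For two multiples k d and m d the exponent is c \<tau> times min(k, m) max(k, m)^2 >= (k
  + m) / 2, so the double sum splits into two geometric series. If one end is of order N, the
  exponent is of order d, while \<tau> >= 1 bounds the number of pairs by K^2 d^3.\<close>

lemma wt_grid_flip:
  fixes \<theta> c C \<tau> :: real
  assumes flip: "\<And>N i j :: nat. 1 \<le> N \<Longrightarrow> 1 \<le> i \<Longrightarrow> 1 \<le> j \<Longrightarrow>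
    wt (\<lambda>n S. (real N)\<^sup>2 \<le> area n S \<and> n \<le> K * N \<and> i \<le> n - card S \<and> j \<le> card S \<and>
      real (left_steps n S i) / real i \<le> real (right_steps n S j) / real j + \<theta> * real (max i j) / real N)
    \<le> C * exp (- c * (real (min i j) * (real (max i j))\<^sup>2 / (real N)\<^sup>2)) * Z N"
    and c: "0 < c" "0 < C" and N: "1 \<le> N" and K: "1 \<le> K"
    and d: "1 \<le> d" "d \<le> N" and L: "1 \<le> L" "L \<le> k1" and k1: "k1 * d * K \<le> N" "N \<le> 2 * (k1 * d * K)"
    and \<tau>: "\<tau> = (real d) ^ 3 / (real N)\<^sup>2" "1 \<le> \<tau>" and a3: "a3 = c / (4 * (real K)\<^sup>2)"
  shows "wt (\<lambda>n S. (real N)\<^sup>2 \<le> area n S \<and> n \<le> K * N \<and>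
      (\<exists>i\<in>grid d L k1 (K * N). \<exists>j\<in>grid d L k1 (K * N). i \<le> n - card S \<and> j \<le> card S \<and>
        real (left_steps n S i) / real i \<le> real (right_steps n S j) / real j + \<theta> * real (max i j) / real N))
    \<le> (C * (exp (- (c / 2) * \<tau>) / (1 - exp (- (c / 2)))) ^ 2
       + C * (real K)\<^sup>2 * (6 / a3) ^ 3 * exp (- (a3 / 2) * \<tau>)) * Z N"
    (is "wt ?P \<le> _")
proof -
  have N0: "0 < real N" and d0: "0 < real d" and K0: "0 < real K" using N d K by auto
  let ?F = "\<lambda>i j n S. (real N)\<^sup>2 \<le> area n S \<and> n \<le> K * N \<and> i \<le> n - card S \<and> j \<le> card S \<and>
      real (left_steps n S i) / real i \<le> real (right_steps n S j) / real j + \<theta> * real (max i j) / real N"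
  \<comment> \<open>The size conditions are made part of the event, so that pairs violating them
    contribute nothing to the sum over all integers.\<close>
  let ?G = "\<lambda>i j n S. (d \<le> min i j \<and> k1 * d \<le> max i j) \<and> ?F i j n S"
  have in_grid: "(\<exists>k\<in>{L..k1}. i = k * d) \<or> (k1 * d \<le> i \<and> i \<le> K * N)" if "i \<in> grid d L k1 (K * N)" for i
    using that by (auto simp: grid_def)
  have "?P n S \<Longrightarrow> (\<exists>k\<in>{L..k1}. \<exists>m\<in>{L..k1}. ?F (k * d) (m * d) n S) \<or>
      (\<exists>i\<in>{1..K * N}. \<exists>j\<in>{1..K * N}. ?G i j n S)" for n S
  proof -
    assume P: "?P n S"
    then obtain i j where i: "i \<in> grid d L k1 (K * N)" and j: "j \<in> grid d L k1 (K * N)" and F: "?F i j n S"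
      by blast
    have kd: "k * d \<le> k1 * d" if "k \<in> {L..k1}" for k using that by (intro mult_right_mono) auto
    have "k1 * d * 1 \<le> k1 * d * K" using K by (intro mult_left_mono) auto
    moreover have "1 * N \<le> K * N" using K by (intro mult_right_mono) auto
    ultimately have k1d: "k1 * d \<le> K * N" using k1 by linarith
    have "1 * d \<le> k1 * d" using L by (intro mult_right_mono) auto
    then have dk: "d \<le> k1 * d" by simp
    have range: "d \<le> i \<and> i \<le> K * N" if "i \<in> grid d L k1 (K * N)" for i
      using in_grid[OF that]
    proof
      assume "\<exists>k\<in>{L..k1}. i = k * d"
      then obtain k where k: "k \<in> {L..k1}" "i = k * d" by blast
      have "1 * d \<le> k * d" using k L by (intro mult_right_mono) auto
      then have "d \<le> k * d" by simp
      moreover have "k * d \<le> K * N" using kd[OF k(1)] k1d by linarith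
      ultimately show ?thesis unfolding k(2) by blast
    qed (use dk le_trans in blast)
    show ?thesis
    proof (cases "k1 * d \<le> max i j")
      case True
      then show ?thesis using range[OF i] range[OF j] d F by (intro disjI2 bexI[of _ i] bexI[of _ j]) auto
    next
      case False
      then show ?thesis using in_grid[OF i] in_grid[OF j] F by fastforce
    qed
  qed
  then have "wt ?P \<le> wt (\<lambda>n S. (\<exists>k\<in>{L..k1}. \<exists>m\<in>{L..k1}. ?F (k * d) (m * d) n S) \<or>
      (\<exists>i\<in>{1..K * N}. \<exists>j\<in>{1..K * N}. ?G i j n S))"
    by (intro wt_mono)
  also have "\<dots> \<le> wt (\<lambda>n S. \<exists>k\<in>{L..k1}. \<exists>m\<in>{L..k1}. ?F (k * d) (m * d) n S)
      + wt (\<lambda>n S. \<exists>i\<in>{1..K * N}. \<exists>j\<in>{1..K * N}. ?G i j n S)"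
    by (rule wt_disj)
  also have "wt (\<lambda>n S. \<exists>k\<in>{L..k1}. \<exists>m\<in>{L..k1}. ?F (k * d) (m * d) n S)
      \<le> C * (exp (- (c / 2) * \<tau>) / (1 - exp (- (c / 2)))) ^ 2 * Z N"
  proof -
    have "wt (\<lambda>n S. \<exists>k\<in>{L..k1}. \<exists>m\<in>{L..k1}. ?F (k * d) (m * d) n S)
        \<le> (\<Sum>k\<in>{L..k1}. wt (\<lambda>n S. \<exists>m\<in>{L..k1}. ?F (k * d) (m * d) n S))"
      by (rule wt_Ex) simp
    also have "\<dots> \<le> (\<Sum>k\<in>{L..k1}. \<Sum>m\<in>{L..k1}. wt (?F (k * d) (m * d)))"
      by (intro sum_mono wt_Ex) simp
    also have "\<dots> \<le> (\<Sum>k\<in>{L..k1}. \<Sum>m\<in>{L..k1}. C * Z N * (exp (- (c / 2) * \<tau> * real k) * exp (- (c / 2) * \<tau> * real m)))"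
    proof (intro sum_mono)
      fix k m assume km: "k \<in> {L..k1}" "m \<in> {L..k1}"
      then have km1: "1 \<le> k" "1 \<le> m" using L by auto
      have "wt (?F (k * d) (m * d))
          \<le> C * exp (- c * (min (k * d) (m * d) * (real (max (k * d) (m * d)))\<^sup>2 / (real N)\<^sup>2)) * Z N"
        using km1 d by (intro flip N) auto
      also have "\<dots> \<le> C * exp (- (c / 2) * \<tau> * real k + - (c / 2) * \<tau> * real m) * Z N"
      proof -
        have min_eq: "min (k * d) (m * d) = min k m * d" and max_eq: "max (k * d) (m * d) = max k m * d"
          by (simp_all add: min_def max_def)
        have "real (min (k * d) (m * d)) * (real (max (k * d) (m * d)))\<^sup>2 / (real N)\<^sup>2
            = \<tau> * (real (min k m) * (real (max k m))\<^sup>2)"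
          unfolding min_eq max_eq by (simp add: \<tau> power_mult_distrib power2_eq_square power3_eq_cube mult_ac)
        moreover have "\<tau> * ((real k + real m) / 2) \<le> \<tau> * (real (min k m) * (real (max k m))\<^sup>2)"
        proof (intro mult_left_mono)
          have "(real k + real m) / 2 \<le> real (max k m) * 1" by simp
          also have "\<dots> \<le> real (max k m) * real (max k m)" using km1 by (intro mult_left_mono) auto
          also have "\<dots> \<le> real (min k m) * (real (max k m))\<^sup>2"
            using km1 mult_right_mono[of 1 "real (min k m)" "(real (max k m))\<^sup>2"] by (simp add: power2_eq_square)
          finally show "(real k + real m) / 2 \<le> real (min k m) * (real (max k m))\<^sup>2" .
        qed (use \<tau> in auto)
        ultimately have "c * (\<tau> * ((real k + real m) / 2))
            \<le> c * (real (min (k * d) (m * d)) * (real (max (k * d) (m * d)))\<^sup>2 / (real N)\<^sup>2)"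
          using c by (intro mult_left_mono) auto
        then have "- c * (real (min (k * d) (m * d)) * (real (max (k * d) (m * d)))\<^sup>2 / (real N)\<^sup>2)
            \<le> - (c / 2) * \<tau> * real k + - (c / 2) * \<tau> * real m"
          by (simp add: field_simps)
        then show ?thesis using c Z_pos[of N] by (intro mult_right_mono mult_left_mono) auto
      qed
      also have "\<dots> = C * Z N * (exp (- (c / 2) * \<tau> * real k) * exp (- (c / 2) * \<tau> * real m))"
        by (simp only: exp_add mult_ac)
      finally show "wt (?F (k * d) (m * d)) \<le> C * Z N * (exp (- (c / 2) * \<tau> * real k) * exp (- (c / 2) * \<tau> * real m))" .
    qed
    also have "\<dots> = C * Z N * (\<Sum>k\<in>{L..k1}. exp (- (c / 2) * \<tau> * real k)) ^ 2"
      unfolding power2_eq_square sum_product by (simp add: sum_distrib_left)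
    also have "\<dots> \<le> C * Z N * (exp (- (c / 2) * \<tau>) / (1 - exp (- (c / 2)))) ^ 2"
    proof -
      have "{L..k1} \<subseteq> {1..k1}" using L by auto
      then show ?thesis
        using c \<tau> Z_pos[of N] by (intro mult_left_mono power_mono sum_exp_le sum_nonneg) auto
    qed
    finally show ?thesis by (simp add: mult_ac)
  qed
  also have "wt (\<lambda>n S. \<exists>i\<in>{1..K * N}. \<exists>j\<in>{1..K * N}. ?G i j n S)
      \<le> C * (real K)\<^sup>2 * (6 / a3) ^ 3 * exp (- (a3 / 2) * \<tau>) * Z N"
  proof -
    have a30: "0 < a3" using c K0 by (simp add: a3)
    have "wt (\<lambda>n S. \<exists>i\<in>{1..K * N}. \<exists>j\<in>{1..K * N}. ?G i j n S)
        \<le> (\<Sum>i\<in>{1..K * N}. wt (\<lambda>n S. \<exists>j\<in>{1..K * N}. ?G i j n S))"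
      by (rule wt_Ex) simp
    also have "\<dots> \<le> (\<Sum>i\<in>{1..K * N}. \<Sum>j\<in>{1..K * N}. wt (?G i j))"
      by (intro sum_mono wt_Ex) simp
    also have "\<dots> \<le> (\<Sum>i\<in>{1..K * N}. \<Sum>j\<in>{1..K * N}. C * exp (- a3 * d) * Z N)"
    proof (intro sum_mono)
      fix i j assume ij: "i \<in> {1..K * N}" "j \<in> {1..K * N}"
      show "wt (?G i j) \<le> C * exp (- a3 * d) * Z N"
      proof (cases "d \<le> min i j \<and> k1 * d \<le> max i j")
        case False
        then show ?thesis using c Z_pos[of N] by (intro wt_absurd) (blast, simp)
      next
        case True
        have "real N \<le> 2 * (real (k1 * d) * real K)" using k1(2) by (metis of_nat_le_iff of_nat_mult of_nat_numeral)
        also have "real (k1 * d) \<le> real (max i j)" using True by (simp only: of_nat_le_iff)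
        then have "2 * (real (k1 * d) * real K) \<le> 2 * (real (max i j) * real K)"
          by (intro mult_left_mono mult_right_mono) auto
        finally have "(real N)\<^sup>2 \<le> (2 * (real (max i j) * real K))\<^sup>2" by (intro power_mono) auto
        then have "real d * (real N)\<^sup>2 \<le> real (min i j) * (2 * (real (max i j) * real K))\<^sup>2"
          using True by (intro mult_mono) auto
        then have "d / (4 * (real K)\<^sup>2) \<le> min i j * (real (max i j))\<^sup>2 / (real N)\<^sup>2"
          using N0 K0 by (simp add: field_simps power_mult_distrib)
        then have "c * (d / (4 * (real K)\<^sup>2)) \<le> c * (real (min i j) * (real (max i j))\<^sup>2 / (real N)\<^sup>2)"
          using c by (intro mult_left_mono) auto
        then have ex: "- c * (real (min i j) * (real (max i j))\<^sup>2 / (real N)\<^sup>2) \<le> - a3 * d" by (simp add: a3)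
        have "wt (?G i j) \<le> wt (?F i j)" by (rule wt_mono) blast
        also have "\<dots> \<le> C * exp (- c * (real (min i j) * (real (max i j))\<^sup>2 / (real N)\<^sup>2)) * Z N"
          using ij by (intro flip N) auto
        also have "\<dots> \<le> C * exp (- a3 * d) * Z N"
          using ex c Z_pos[of N] by (intro mult_right_mono mult_left_mono) auto
        finally show ?thesis .
      qed
    qed
    also have "\<dots> = C * (real K)\<^sup>2 * ((real N)\<^sup>2 * exp (- a3 * d)) * Z N"
      by (simp add: power2_eq_square)
    also have "\<dots> \<le> C * (real K)\<^sup>2 * ((6 / a3) ^ 3 * exp (- (a3 / 2) * \<tau>)) * Z N"
    proof -
      have "1 * (real N)\<^sup>2 \<le> \<tau> * (real N)\<^sup>2" using \<tau> by (intro mult_right_mono) auto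
      then have "(real N)\<^sup>2 \<le> (real d) ^ 3" using N0 by (simp add: \<tau>(1))
      then have "(real N)\<^sup>2 * exp (- a3 * d) \<le> (real d) ^ 3 * exp (- a3 * d)"
        by (intro mult_right_mono) auto
      also have "\<dots> \<le> (6 / a3) ^ 3 * exp (- (a3 / 2) * d)" using a30 by (intro cube_exp_le) auto
      also have "\<dots> \<le> (6 / a3) ^ 3 * exp (- (a3 / 2) * \<tau>)"
      proof -
        \<comment> \<open>As d <= N, also \<tau> <= d, and decay in d becomes decay in
          \<tau>.\<close>
        have "(real d)\<^sup>2 \<le> (real N)\<^sup>2" using d by (intro power_mono) auto
        then have "real d * (real d)\<^sup>2 \<le> real d * (real N)\<^sup>2" by (intro mult_left_mono) auto
        then have "\<tau> \<le> d" using N0 by (simp add: \<tau> field_simps power2_eq_square power3_eq_cube)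
        then show ?thesis using a30 by (intro mult_left_mono) auto
      qed
      finally show ?thesis using c Z_pos[of N] by (intro mult_right_mono mult_left_mono) auto
    qed
    finally show ?thesis by (simp add: mult_ac)
  qed
  finally show ?thesis by (simp add: algebra_simps)
qed

text \<open>Each end of the chord is moved to the grid on its own, the left one by way of the
  reflected path. The two h-terms of the gap pay for the allowances in \<open>tame\<close>; the two
  remaining errors add up to at most \<theta> \<open>max g' g\<close> / N.\<close>

lemma chord_gap_cases:
  assumes sub: "S \<subseteq> {..<n}" and G: "0 \<notin> G"
    and tame: "tame G h (\<theta> / (2 * real N)) n S" "tame G h (\<theta> / (2 * real N)) n (mirror n S)"
    and gap: "chord_gap h n S" and \<theta>: "0 < \<theta>"
  shows "\<exists>i\<in>G. \<exists>j\<in>G. i \<le> n - card S \<and> j \<le> card S \<and>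
        real (left_steps n S i) / real i \<le> real (right_steps n S j) / real j + \<theta> * real (max i j) / real N"
proof -
  have c: "card (mirror n S) = n - card S" by (rule card_mirror[OF sub])
  obtain i j where i: "1 \<le> i" "i \<le> n - card S" and j: "1 \<le> j" "j \<le> card S"
    and le: "real (left_steps n S i) / i + h / (2 * i) \<le> real (right_steps n S j) / j - h / (2 * j)"
    using gap unfolding chord_gap_def by blast
  obtain g where g: "g \<in> G" "g \<le> card S"
    and g_le: "real (right_steps n S j) / j - h / (2 * j) \<le> real (right_steps n S g) / g + \<theta> / (2 * real N) * g"
    using tame(1)[unfolded tame_def, rule_format, OF j] by (elim bexE conjE)
  obtain g' where g': "g' \<in> G" "g' \<le> n - card S"
    and g'_le: "real (right_steps n (mirror n S) i) / i - h / (2 * i)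
      \<le> real (right_steps n (mirror n S) g') / g' + \<theta> / (2 * real N) * g'"
    using tame(2)[unfolded tame_def c, rule_format, OF i] by (elim bexE conjE)
  have "g' \<noteq> 0" using g'(1) G by metis
  then have "real (right_steps n (mirror n S) g') / g' = 1 - real (left_steps n S g') / g'"
    "real (right_steps n (mirror n S) i) / i = 1 - real (left_steps n S i) / i"
    using right_steps_mirror[OF sub g'(2)] right_steps_mirror[OF sub i(2)] i by (simp_all add: diff_divide_distrib)
  then have "real (left_steps n S g') / g' \<le> real (right_steps n S g) / g + \<theta> / (2 * real N) * (real g + real g')"
    using g_le g'_le le unfolding distrib_left by linarith
  also have "\<theta> / (2 * real N) * (real g + real g') \<le> \<theta> / (2 * real N) * (2 * real (max g' g))"
    using \<theta> by (intro mult_left_mono) auto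
  finally have "real (left_steps n S g') / g' \<le> real (right_steps n S g) / g + \<theta> * max g' g / N" by simp
  then show ?thesis using g g' by blast
qed

lemma wt_chord_gap:
  "\<exists>\<epsilon> H c C :: real. 0 < \<epsilon> \<and> 0 < H \<and> 0 < c \<and> 0 < C \<and> (\<forall>N r. 1 \<le> N \<longrightarrow> 2 ^ r \<le> \<epsilon> * real N \<longrightarrow>
    wt (\<lambda>n S. (real N)\<^sup>2 \<le> area n S \<and> chord_gap (H * 4 ^ r / N) n S)
      \<le> C * exp (- c * (8 ^ r / (real N)\<^sup>2)) * Z N)"
proof -
  obtain K :: nat where K: "1 \<le> K"
    and long: "\<forall>N\<ge>1. wt (\<lambda>n S. K * N < n) \<le> exp (- real N) / (1 - 2 * l) * Z N"
    using ex_length_cutoff by (elim exE conjE)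
  obtain \<theta> cf Cf :: real where pos: "0 < \<theta>" "0 < cf" "0 < Cf" and flip': "\<forall>N i j. 1 \<le> N \<longrightarrow> 1 \<le> i \<longrightarrow> 1 \<le> j \<longrightarrow>
    wt (\<lambda>n S. (real N)\<^sup>2 \<le> area n S \<and> n \<le> K * N \<and> i \<le> n - card S \<and> j \<le> card S \<and>
      real (left_steps n S i) / real i \<le> real (right_steps n S j) / real j + \<theta> * real (max i j) / real N)
    \<le> Cf * exp (- cf * (real (min i j) * (real (max i j))\<^sup>2 / (real N)\<^sup>2)) * Z N"
    using wt_flip[OF K] by (elim exE conjE)
  note flip = flip'[rule_format]
  obtain B :: real where B: "0 < B" and cell': "\<forall>N r x err. 1 \<le> N \<longrightarrow> 16 * ln (1 / l) * 4 ^ r / N \<le> err \<longrightarrow>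
    wt (\<lambda>n S. (real N)\<^sup>2 \<le> area n S \<and> x + 2 ^ r \<le> card S \<and> (\<exists>v\<le>2 ^ r.
        real (right_steps n S x) + v / 2 ^ r * (real (right_steps n S (x + 2 ^ r)) - real (right_steps n S x)) + err
          < real (right_steps n S (x + v))))
    \<le> B * exp (- err\<^sup>2 / (128 * 2 ^ r)) * Z N"
    using wt_cell by (elim exE conjE)
  note cell = cell'[rule_format]
  have K0: "0 < real K" using K by simp
  \<comment> \<open>From distance 2^u d on, the error \<theta> (k d)^2 / (2 N), which the slope
    estimate can afford, dominates the bend of a cell. Up to there a single cell of length 2^u d is
    used.\<close>
  obtain u :: nat where "32 * ln (1 / l) / \<theta> < 4 ^ u"
    using real_arch_pow[of 4 "32 * ln (1 / l) / \<theta>"] by auto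
  then have u: "16 * ln (1 / l) \<le> \<theta> / 2 * 4 ^ u" using pos by (simp add: field_simps)
  define L :: nat where "L = 2 ^ u"
  have L: "1 \<le> L" by (simp add: L_def)
  \<comment> \<open>Leaves room for L cells: \<open>L * (K * d) \<le> N\<close> gives
    \<open>L \<le> k1\<close>.\<close>
  define \<epsilon> where "\<epsilon> = 1 / (real L * real K)"
  define H where "H = 32 * ln (1 / l) * 4 ^ u"
  define a1 where "a1 = 2 * (ln (1 / l))\<^sup>2 * 8 ^ u"
  define a2 where "a2 = (\<theta> / 2)\<^sup>2 / 128"
  define a3 where "a3 = cf / (4 * (real K)\<^sup>2)"
  define c where "c = Min {1, a1, a2, cf / 2, a3 / 2}"
  have a: "0 < a1" "0 < a2" "0 < a3"
    using ln_inverse_pos pos K0 by (auto simp: a1_def a2_def a3_def)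
  have c: "0 < c" "c \<le> 1" "c \<le> a1" "c \<le> a2" "c \<le> cf / 2" "c \<le> a3 / 2"
    using a pos by (auto simp: c_def)
  \<comment> \<open>The summand exp 1 settles \<tau> < 1; the others belong to very long paths, to
    the cells on the two sides of the diagonal, and to the slopes at grid points.\<close>
  define C where "C = exp 1 + 1 / (1 - 2 * l) + 2 * (B + B / (1 - exp (- a2)))
      + (Cf / (1 - exp (- (cf / 2))) ^ 2 + Cf * (real K)\<^sup>2 * (6 / a3) ^ 3)"
  have parts: "0 < 1 / (1 - 2 * l)" "0 < B / (1 - exp (- a2))" "0 < Cf / (1 - exp (- (cf / 2))) ^ 2"
    "0 < Cf * (real K)\<^sup>2 * (6 / a3) ^ 3"
    using l_half B a pos K0 by (auto intro!: divide_pos_pos mult_pos_pos zero_less_power)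
  have C: "exp 1 \<le> C" using parts B by (simp add: C_def)
  then have C0: "0 < C" using exp_gt_zero[of "1::real"] by linarith
  show ?thesis
  proof (intro exI conjI allI impI)
    show "0 < \<epsilon>" using L K0 by (simp add: \<epsilon>_def)
    show "0 < H" using ln_inverse_pos by (simp add: H_def)
    show "0 < c" "0 < C" by fact+
    fix N r :: nat assume N: "1 \<le> N" and r: "2 ^ r \<le> \<epsilon> * real N"
    define \<tau> where "\<tau> = 8 ^ r / (real N)\<^sup>2"
    define d :: nat where "d = 2 ^ r"
    have d: "1 \<le> d" by (simp add: d_def)
    have N0: "0 < real N" using N by simp
    let ?P = "\<lambda>n S. (real N)\<^sup>2 \<le> area n S \<and> chord_gap (H * 4 ^ r / N) n S"
    show "wt ?P \<le> C * exp (- c * (8 ^ r / (real N)\<^sup>2)) * Z N"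
    proof (cases "1 \<le> \<tau>")
      case False
      have "c * \<tau> \<le> 1 * 1" using False c by (intro mult_mono) (auto simp: \<tau>_def)
      then have "0 \<le> 1 + - c * \<tau>" by simp
      then have "1 \<le> exp 1 * exp (- c * \<tau>)" by (simp only: one_le_exp_iff flip: exp_add)
      also have "\<dots> \<le> C * exp (- c * \<tau>)" using C by (intro mult_right_mono) auto
      finally have "1 * Z N \<le> C * exp (- c * \<tau>) * Z N" using Z_pos[of N] by (intro mult_right_mono) auto
      moreover have "wt ?P \<le> Z N" by (rule wt_le_Z)
      ultimately show ?thesis by (simp add: \<tau>_def)
    next
      case True
      define k1 where "k1 = N div (K * d)"
      have "real d * (real L * real K) \<le> real N"
        using r L K0 by (simp add: \<epsilon>_def d_def field_simps)
      then have "real (L * (K * d)) \<le> real N" by (simp add: mult_ac)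
      then have LKd: "L * (K * d) \<le> N" by (simp only: of_nat_le_iff)
      have Kd: "0 < K * d" using K d by simp
      have Lk1: "L \<le> k1" unfolding k1_def using LKd Kd by (simp add: less_eq_div_iff_mult_less_eq)
      have k1a: "k1 * d * K \<le> N"
        using div_times_less_eq_dividend[of N "K * d"] by (simp add: k1_def mult_ac)
      have k1b: "N \<le> 2 * (k1 * d * K)"
      proof -
        have "N = k1 * (K * d) + N mod (K * d)" by (simp only: k1_def div_mult_mod_eq)
        moreover have "N mod (K * d) < K * d" using Kd by simp
        moreover have "1 * (K * d) \<le> k1 * (K * d)" using Lk1 L by (intro mult_right_mono) auto
        moreover have "k1 * d * K = k1 * (K * d)" by (simp add: mult_ac)
        ultimately show ?thesis by linarith
      qed
      have dN: "d \<le> N"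
      proof -
        have "1 * 1 * d \<le> k1 * K * d" using Lk1 L K by (intro mult_mono) auto
        moreover have "k1 * K * d = k1 * d * K" by simp
        ultimately show ?thesis using k1a by linarith
      qed
      define h where "h = H * 4 ^ r / N"
      define e where "e = \<theta> / (2 * real N)"
      define G where "G = grid d L k1 (K * N)"
      have \<tau>d: "\<tau> = (real d) ^ 3 / (real N)\<^sup>2"
        by (simp add: \<tau>_def d_def flip: power_mult) (simp add: mult.commute[of r] power_mult)
      let ?T = "\<lambda>n S. (real N)\<^sup>2 \<le> area n S \<and> n \<le> K * N \<and> \<not> tame G h e n S"
      let ?F = "\<lambda>n S. (real N)\<^sup>2 \<le> area n S \<and> n \<le> K * N \<and>
        (\<exists>i\<in>G. \<exists>j\<in>G. i \<le> n - card S \<and> j \<le> card S \<and>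
          real (left_steps n S i) / real i \<le> real (right_steps n S j) / real j + \<theta> * real (max i j) / real N)"
      have G0: "0 \<notin> G" using d L Lk1 by (auto simp: G_def grid_def)
      have "K * N < n \<or> (?T n S \<or> (?T n (mirror n S) \<or> ?F n S))" if sub: "S \<subseteq> {..<n}" and P: "?P n S" for n S
      proof (rule ccontr)
        assume neg: "\<not> ?thesis"
        then have t: "tame G h e n S" "tame G h e n (mirror n S)" "n \<le> K * N"
          using P area_mirror[OF sub] by auto
        have "\<exists>i\<in>G. \<exists>j\<in>G. i \<le> n - card S \<and> j \<le> card S \<and>
            real (left_steps n S i) / real i \<le> real (right_steps n S j) / real j + \<theta> * real (max i j) / real N"
          by (rule chord_gap_cases[OF sub G0 t(1,2)[unfolded e_def]]) (use P pos in \<open>auto simp: h_def\<close>)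
        then show False using neg P t(3) by blast
      qed
      then have "wt ?P \<le> wt (\<lambda>n S. K * N < n \<or> (?T n S \<or> (?T n (mirror n S) \<or> ?F n S)))"
        by (intro wt_mono) blast
      also have "\<dots> \<le> wt (\<lambda>n S. K * N < n) + (wt ?T + (wt (\<lambda>n S. ?T n (mirror n S)) + wt ?F))"
        by (intro order.trans[OF wt_disj] add_left_mono order.refl)
      also have "\<dots> \<le> wt (\<lambda>n S. K * N < n) + (wt ?T + (wt ?T + wt ?F))"
        by (intro add_left_mono add_right_mono wt_mirror)
      also have "\<dots> \<le> 1 / (1 - 2 * l) * exp (- c * \<tau>) * Z N
          + ((B + B / (1 - exp (- a2))) * exp (- c * \<tau>) * Z N
          + ((B + B / (1 - exp (- a2))) * exp (- c * \<tau>) * Z N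
          + (Cf / (1 - exp (- (cf / 2))) ^ 2 + Cf * (real K)\<^sup>2 * (6 / a3) ^ 3) * exp (- c * \<tau>) * Z N))"
      proof -
        have ex: "exp (- b * \<tau>) \<le> exp (- c * \<tau>)" if "c \<le> b" for b
          using that True by simp
        have "wt (\<lambda>n S. K * N < n) \<le> exp (- real N) / (1 - 2 * l) * Z N" using long N by blast
        also have "\<dots> \<le> 1 / (1 - 2 * l) * exp (- c * \<tau>) * Z N"
        proof -
          have "(real d)\<^sup>2 * real d \<le> (real N)\<^sup>2 * real N" using dN by (intro mult_mono power_mono) auto
          then have "\<tau> \<le> N" using N0 by (simp add: \<tau>d field_simps power2_eq_square power3_eq_cube)
          then have "exp (- real N) \<le> exp (- c * \<tau>)" using ex[of 1] c by simp
          then show ?thesis using l_half Z_pos[of N] by (intro mult_right_mono) (auto simp: divide_right_mono)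
        qed
        finally have 1: "wt (\<lambda>n S. K * N < n) \<le> 1 / (1 - 2 * l) * exp (- c * \<tau>) * Z N" .
        have "wt ?T \<le> (B * exp (- a1 * \<tau>) + B * (exp (- a2 * \<tau>) / (1 - exp (- a2)))) * Z N"
          unfolding G_def d_def L_def
        proof (rule wt_not_tame[OF cell B N K])
          show "2 ^ u \<le> k1" "k1 * 2 ^ r * K \<le> N" using Lk1 k1a by (simp_all add: L_def d_def)
          show "0 < e" using pos N0 by (simp add: e_def)
          show "16 * ln (1 / l) \<le> e * 4 ^ u * N" using u N0 by (simp add: e_def)
          show "h = 32 * ln (1 / l) * 4 ^ u * 4 ^ r / N" by (simp add: h_def H_def)
          show "a2 = (e * N)\<^sup>2 / 128" using N0 by (simp add: a2_def e_def)
        qed (use True in \<open>auto simp: \<tau>_def a1_def\<close>)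
        also have "\<dots> \<le> (B * exp (- c * \<tau>) + B * (exp (- c * \<tau>) / (1 - exp (- a2)))) * Z N"
          using ex[OF c(3)] ex[OF c(4)] B a Z_pos[of N]
          by (intro mult_right_mono add_mono mult_left_mono divide_right_mono) auto
        finally have 2: "wt ?T \<le> (B + B / (1 - exp (- a2))) * exp (- c * \<tau>) * Z N"
          by (simp add: algebra_simps)
        have "wt ?F \<le> (Cf * (exp (- (cf / 2) * \<tau>) / (1 - exp (- (cf / 2)))) ^ 2
            + Cf * (real K)\<^sup>2 * (6 / a3) ^ 3 * exp (- (a3 / 2) * \<tau>)) * Z N"
          unfolding G_def
          by (rule wt_grid_flip[OF flip pos(2,3) N K d dN L Lk1 k1a k1b \<tau>d True a3_def])
        also have "\<dots> \<le> (Cf / (1 - exp (- (cf / 2))) ^ 2 * exp (- c * \<tau>)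
            + Cf * (real K)\<^sup>2 * (6 / a3) ^ 3 * exp (- c * \<tau>)) * Z N"
        proof (intro mult_right_mono add_mono)
          have "exp (- (cf / 2) * \<tau>) ^ 2 \<le> exp (- (cf / 2) * \<tau>) * 1"
            unfolding power2_eq_square using pos True by (intro mult_left_mono) auto
          also have "\<dots> \<le> exp (- c * \<tau>)" using ex[OF c(5)] by simp
          finally have "Cf / (1 - exp (- (cf / 2))) ^ 2 * exp (- (cf / 2) * \<tau>) ^ 2
              \<le> Cf / (1 - exp (- (cf / 2))) ^ 2 * exp (- c * \<tau>)"
            using parts(3) by (intro mult_left_mono) auto
          then show "Cf * (exp (- (cf / 2) * \<tau>) / (1 - exp (- (cf / 2)))) ^ 2
              \<le> Cf / (1 - exp (- (cf / 2))) ^ 2 * exp (- c * \<tau>)"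
            by (simp add: power_divide)
          show "Cf * (real K)\<^sup>2 * (6 / a3) ^ 3 * exp (- (a3 / 2) * \<tau>)
              \<le> Cf * (real K)\<^sup>2 * (6 / a3) ^ 3 * exp (- c * \<tau>)"
            using parts(4) ex[OF c(6)] by (intro mult_left_mono) auto
        qed (use Z_pos[of N] in auto)
        finally have 3: "wt ?F \<le> (Cf / (1 - exp (- (cf / 2))) ^ 2 + Cf * (real K)\<^sup>2 * (6 / a3) ^ 3)
            * exp (- c * \<tau>) * Z N"
          by (simp add: algebra_simps)
        show ?thesis by (intro add_mono 1 2 3)
      qed
      also have "\<dots> = (C - exp 1) * exp (- c * \<tau>) * Z N"
        unfolding C_def by (simp add: algebra_simps)
      also have "\<dots> \<le> C * exp (- c * \<tau>) * Z N"
        using Z_pos[of N] by (intro mult_right_mono) auto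
      finally show ?thesis by (simp add: \<tau>_def)
    qed
  qed
qed

end

section \<open>Lattice paths and step sets\<close>

text \<open>The second coordinate counts the downward steps still to come, so every step set yields
  a path ending on the x-axis.\<close>

definition path_of :: "nat \<Rightarrow> nat set \<Rightarrow> (nat \<times> nat) list" where
  "path_of n S = map (\<lambda>i. (card (S \<inter> {..<i}), card ({i..<n} - S))) [0..<Suc n]"

lemma length_path_of [simp]: "length (path_of n S) = Suc n"
  by (simp add: path_of_def)

lemma path_of_nth: "i \<le> n \<Longrightarrow> path_of n S ! i = (card (S \<inter> {..<i}), card ({i..<n} - S))"
  unfolding path_of_def by (subst nth_map) (auto simp del: upt_Suc)

lemma path_of_step:
  assumes "i < n"
  shows "i \<in> S \<Longrightarrow> path_of n S ! Suc i = (fst (path_of n S ! i) + 1, snd (path_of n S ! i))"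
    and "i \<notin> S \<Longrightarrow> path_of n S ! i = (fst (path_of n S ! Suc i), snd (path_of n S ! Suc i) + 1)"
proof -
  have ivl: "{i..<n} = insert i {Suc i..<n}" "{..<Suc i} = insert i {..<i}" using assms by auto
  show "path_of n S ! Suc i = (fst (path_of n S ! i) + 1, snd (path_of n S ! i))" if "i \<in> S"
  proof -
    have "S \<inter> {..<Suc i} = insert i (S \<inter> {..<i})" "{i..<n} - S = {Suc i..<n} - S"
      using that ivl by auto
    then show ?thesis using assms by (simp add: path_of_nth)
  qed
  show "path_of n S ! i = (fst (path_of n S ! Suc i), snd (path_of n S ! Suc i) + 1)" if "i \<notin> S"
  proof -
    have "{i..<n} - S = insert i ({Suc i..<n} - S)" "S \<inter> {..<Suc i} = S \<inter> {..<i}"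
      using that ivl by auto
    then show ?thesis using assms by (simp add: path_of_nth)
  qed
qed

lemma unit_step_path_of: "i < n \<Longrightarrow> unit_step (path_of n S ! i) (path_of n S ! Suc i)"
  using path_of_step[of i n S] by (cases "i \<in> S") (simp_all add: unit_step_def)

lemma path_of_nonempty [simp]: "path_of n S \<noteq> []"
  by (simp add: path_of_def)

lemma successively_path_of: "successively unit_step (path_of n S)"
  by (simp add: successively_conv_nth unit_step_path_of)

lemma path_of_lattice_path: "path_of n S \<in> lattice_paths"
  by (auto simp: lattice_paths_def hd_conv_nth last_conv_nth path_of_nth successively_path_of)

lemma num_steps_path_of [simp]: "num_steps (path_of n S) = n"
  by (simp add: num_steps_def)

lemma inj_on_path_of: "inj_on (path_of n) (Pow {..<n})"
proof (rule inj_onI)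
  fix S T assume S: "S \<in> Pow {..<n}" "T \<in> Pow {..<n}" and eq: "path_of n S = path_of n T"
  have mem: "i \<in> U \<longleftrightarrow> fst (path_of n U ! Suc i) = Suc (fst (path_of n U ! i))" if "i < n" for i U
    using path_of_step[OF that, of U] by (metis Suc_eq_plus1 fst_conv n_not_Suc_n)
  have "i \<in> S \<longleftrightarrow> i \<in> T" if "i < n" for i
    using mem[OF that, of S] mem[OF that, of T] eq by simp
  then show "S = T" using S by blast
qed

text \<open>Surjectivity by counting: the injective image has 2^n elements, as many as there are
  paths with n steps.\<close>

lemma lattice_paths_eq_image:
  "{\<gamma> \<in> lattice_paths. num_steps \<gamma> = n} = path_of n ` Pow {..<n}"
proof -
  have eq: "{\<gamma> \<in> lattice_paths. num_steps \<gamma> = n} = {\<gamma>. length \<gamma> = Suc n \<and> fst (hd \<gamma>) = 0 \<and>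
      snd (last \<gamma>) = 0 \<and> successively unit_step \<gamma>}"
    by (auto simp: lattice_paths_def num_steps_def)
  have "path_of n ` Pow {..<n} = {\<gamma> \<in> lattice_paths. num_steps \<gamma> = n}"
  proof (rule card_subset_eq)
    show "finite {\<gamma> \<in> lattice_paths. num_steps \<gamma> = n}"
      unfolding eq using card_paths_from[of n 0] by blast
    show "path_of n ` Pow {..<n} \<subseteq> {\<gamma> \<in> lattice_paths. num_steps \<gamma> = n}"
      by (auto simp: path_of_lattice_path)
    show "card (path_of n ` Pow {..<n}) = card {\<gamma> \<in> lattice_paths. num_steps \<gamma> = n}"
      unfolding eq using card_paths_from[of n 0] by (simp add: card_image[OF inj_on_path_of] card_Pow)
  qed
  then show ?thesis by simp
qed

context subcritical
begin

lemma emeasure_path_measure: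
  assumes "X \<subseteq> lattice_paths"
  shows "emeasure (path_measure l) X = ennreal ((1 - 2 * l) * wt (\<lambda>n S. path_of n S \<in> X))"
proof -
  let ?P = "\<lambda>n S. path_of n S \<in> X"
  define A where "A n = {\<gamma> \<in> X. num_steps \<gamma> = n}" for n
  have A: "A n = path_of n ` level ?P n" for n
  proof -
    have "A n = {\<gamma> \<in> lattice_paths. num_steps \<gamma> = n} \<inter> X" using assms by (auto simp: A_def)
    then show ?thesis unfolding lattice_paths_eq_image by (auto simp: level_def)
  qed
  have fin: "finite (A n)" for n unfolding A by simp
  have card: "card (A n) = card (level ?P n)" for n
    unfolding A by (intro card_image inj_on_subset[OF inj_on_path_of]) (auto simp: level_def)
  have em: "emeasure (path_measure l) (A n) = ennreal ((1 - 2 * l) * (l ^ n * real (card (level ?P n))))" for n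
  proof -
    have "emeasure (path_measure l) (A n) = (\<Sum>\<gamma>\<in>A n. ennreal ((1 - 2 * l) * l ^ num_steps \<gamma>))"
      unfolding path_measure_def
      by (rule emeasure_point_measure_finite2) (use fin assms in \<open>auto simp: A_def\<close>)
    also have "\<dots> = (\<Sum>\<gamma>\<in>A n. ennreal ((1 - 2 * l) * l ^ n))"
      by (rule sum.cong) (auto simp: A_def)
    also have "\<dots> = ennreal (\<Sum>\<gamma>\<in>A n. (1 - 2 * l) * l ^ n)"
      using l_pos l_half by (intro sum_ennreal) auto
    finally show ?thesis by (simp add: card mult_ac)
  qed
  have "emeasure (path_measure l) X = emeasure (path_measure l) (\<Union>n. A n)"
    by (rule arg_cong[where f = "emeasure (path_measure l)"]) (auto simp: A_def)
  also have "\<dots> = (\<Sum>n. emeasure (path_measure l) (A n))"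
    by (rule suminf_emeasure[symmetric])
       (use assms in \<open>auto simp: A_def path_measure_def sets_point_measure disjoint_family_on_def\<close>)
  also have "\<dots> = (\<Sum>n. ennreal ((1 - 2 * l) * (l ^ n * real (card (level ?P n)))))"
    by (simp only: em)
  also have "\<dots> = ennreal ((1 - 2 * l) * wt ?P)"
  proof (rule suminf_ennreal_eq)
    show "(\<lambda>n. (1 - 2 * l) * (l ^ n * real (card (level ?P n)))) sums ((1 - 2 * l) * wt ?P)"
      unfolding wt_def by (intro sums_mult summable_sums summable_wt)
  qed (use l_pos l_half in auto)
  finally show ?thesis .
qed

lemma measure_path_measure:
  assumes "X \<subseteq> lattice_paths"
  shows "measure (path_measure l) X = (1 - 2 * l) * wt (\<lambda>n S. path_of n S \<in> X)"
  unfolding measure_def emeasure_path_measure[OF assms]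
  using l_half by (intro enn2real_ennreal mult_nonneg_nonneg) auto

end

section \<open>The enclosed region as a union of rectangles\<close>

lemma polyline_vertices: "set ps \<subseteq> polyline ps"
  by (induction ps rule: polyline.induct) auto

text \<open>On a horizontal step the right end dominates in both coordinates, on a vertical step the
  upper end.\<close>

lemma polyline_dominated:
  assumes "successively unit_step \<gamma>" "z \<in> polyline (map real_point \<gamma>)"
  shows "\<exists>p\<in>set \<gamma>. fst z \<le> real (fst p) \<and> snd z \<le> real (snd p)"
  using assms
proof (induction \<gamma>)
  case (Cons p ps)
  show ?case
  proof (cases ps)
    case Nil
    then show ?thesis using Cons.prems by (auto simp: map_prod_def split_beta)
  next
    case (Cons q qs)
    have step: "unit_step p q" and suc: "successively unit_step ps"
      using Cons.prems(1) Cons by auto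
    have "z \<in> closed_segment (real_point p) (real_point q) \<or> z \<in> polyline (map real_point ps)"
      using Cons.prems(2) Cons by simp
    then show ?thesis
    proof
      assume "z \<in> closed_segment (real_point p) (real_point q)"
      then obtain u where u: "0 \<le> u" "u \<le> 1" "z = (1 - u) *\<^sub>R real_point p + u *\<^sub>R real_point q"
        by (auto simp: closed_segment_def)
      have "fst z = real (fst p) + u * (real (fst q) - real (fst p))"
        "snd z = real (snd q) + (1 - u) * (real (snd p) - real (snd q))"
        unfolding u(3) by (simp_all add: algebra_simps)
      then consider "fst z \<le> real (fst q)" "snd z \<le> real (snd q)" | "fst z \<le> real (fst p)" "snd z \<le> real (snd p)"
        using step u unfolding unit_step_def by fastforce
      then show ?thesis using Cons by cases auto
    next
      assume "z \<in> polyline (map real_point ps)"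
      from Cons.IH[OF suc this] show ?thesis by auto
    qed
  qed
qed simp

lemma enclosed_region_eq:
  assumes "successively unit_step \<gamma>"
  shows "enclosed_region \<gamma> = (\<Union>p\<in>set \<gamma>. {0..real (fst p)} \<times> {0..real (snd p)})"
proof (intro equalityI subsetI)
  fix z assume "z \<in> enclosed_region \<gamma>"
  then obtain a b where z: "0 \<le> fst z" "0 \<le> snd z" "(a, b) \<in> path_graph \<gamma>" "fst z \<le> a" "snd z \<le> b"
    by (auto simp: enclosed_region_def)
  obtain p where "p \<in> set \<gamma>" "a \<le> real (fst p)" "b \<le> real (snd p)"
    using polyline_dominated[OF assms, of "(a, b)"] z(3) by (auto simp: path_graph_def)
  then show "z \<in> (\<Union>p\<in>set \<gamma>. {0..real (fst p)} \<times> {0..real (snd p)})"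
    using z by (intro UN_I[of p]) (auto simp: mem_Times_iff)
next
  fix z assume "z \<in> (\<Union>p\<in>set \<gamma>. {0..real (fst p)} \<times> {0..real (snd p)})"
  then obtain p where p: "p \<in> set \<gamma>" "z \<in> {0..real (fst p)} \<times> {0..real (snd p)}" by blast
  have "real_point p \<in> path_graph \<gamma>"
    using polyline_vertices[of "map real_point \<gamma>"] p(1) by (auto simp: path_graph_def)
  then have "(real (fst p), real (snd p)) \<in> path_graph \<gamma>" by (simp add: map_prod_def split_beta)
  then show "z \<in> enclosed_region \<gamma>"
    using p(2) by (cases z) (force simp: enclosed_region_def)
qed

lemma lborel_rectangle:
  fixes A B :: "real set"
  assumes "A \<in> sets borel" "B \<in> sets borel"
  shows "A \<times> B \<in> sets lborel" "emeasure lborel (A \<times> B) = emeasure lborel A * emeasure lborel B"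
proof -
  have "A \<times> B \<in> sets (lborel \<Otimes>\<^sub>M lborel)" using assms by (intro pair_measureI) auto
  then show "A \<times> B \<in> sets lborel" by (simp only: lborel_prod)
  have "emeasure (lborel \<Otimes>\<^sub>M lborel) (A \<times> B) = emeasure lborel A * emeasure lborel B"
    using assms by (intro lborel.emeasure_pair_measure_Times) auto
  then show "emeasure lborel (A \<times> B) = emeasure lborel A * emeasure lborel B"
    by (simp only: lborel_prod)
qed

text \<open>The rectangles are added in the order of the path. After a downward step the new
  rectangle lies inside the previous one; a rightward step adds a column of width 1, half-open so
  that it is disjoint from the earlier ones.\<close>

lemma path_area_path_of:
  assumes S: "S \<subseteq> {..<n}"
  shows "path_area (path_of n S) = area n S"
proof -
  define x y where "x i = real (card (S \<inter> {..<i}))" and "y i = real (card ({i..<n} - S))" for i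
  define U where "U i = (\<Union>k\<in>{..i}. {0..x k} \<times> {0..y k})" for i
  have x_mono: "x i \<le> x j" if "i \<le> j" for i j
    unfolding x_def using that by (intro of_nat_mono card_mono) auto
  have U_sets: "U i \<in> sets lborel" for i
    unfolding U_def by (intro sets.finite_UN lborel_rectangle(1)) auto
  have "emeasure lborel (U i) = ennreal (\<Sum>k\<in>S \<inter> {..<i}. y k)" if "i \<le> n" for i
    using that
  proof (induction i)
    case 0
    have "U 0 = {0..0} \<times> {0..y 0}" by (simp add: U_def x_def)
    then show ?case by (simp add: lborel_rectangle(2))
  next
    case (Suc i)
    have i: "i < n" using Suc.prems by simp
    have U_Suc: "U (Suc i) = U i \<union> {0..x (Suc i)} \<times> {0..y (Suc i)}"
      unfolding U_def by (simp add: atMost_Suc Un_commute)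
    have xy: "path_of n S ! k = (card (S \<inter> {..<k}), card ({k..<n} - S))" if "k \<le> n" for k
      by (rule path_of_nth[OF that])
    have box: "{0..x i} \<times> {0..y i} \<subseteq> U i" by (auto simp: U_def)
    show ?case
    proof (cases "i \<in> S")
      case False
      have "x (Suc i) = x i" "y i = y (Suc i) + 1"
        using path_of_step(2)[OF i False] xy[of i] xy[of "Suc i"] i by (simp_all add: x_def y_def)
      then have "{0..x (Suc i)} \<times> {0..y (Suc i)} \<subseteq> U i" using box by fastforce
      then have "U (Suc i) = U i" using U_Suc by blast
      moreover have "S \<inter> {..<Suc i} = S \<inter> {..<i}" using False by (auto simp: less_Suc_eq)
      ultimately show ?thesis using Suc by simp
    next
      case True
      have x1: "x (Suc i) = x i + 1" and y1: "y (Suc i) = y i"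
        using path_of_step(1)[OF i True] xy[of i] xy[of "Suc i"] i by (simp_all add: x_def y_def)
      have x0: "0 \<le> x i" and y0: "0 \<le> y i" by (simp_all add: x_def y_def)
      have "{0..x (Suc i)} \<times> {0..y (Suc i)} = {0..x i} \<times> {0..y i} \<union> {x i<..x i + 1} \<times> {0..y i}"
        unfolding x1 y1 using x0 by auto
      then have U_eq: "U (Suc i) = U i \<union> {x i<..x i + 1} \<times> {0..y i}" using U_Suc box by blast
      have disj: "U i \<inter> {x i<..x i + 1} \<times> {0..y i} = {}"
        using x_mono[of _ i] by (fastforce simp: U_def)
      have "emeasure lborel (U (Suc i)) = emeasure lborel (U i) + emeasure lborel ({x i<..x i + 1} \<times> {0..y i})"
        unfolding U_eq by (rule plus_emeasure[symmetric, OF U_sets lborel_rectangle(1) disj]) auto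
      also have "emeasure lborel ({x i<..x i + 1} \<times> {0..y i}) = ennreal (y i)"
        using y0 by (simp add: lborel_rectangle(2))
      also have "emeasure lborel (U i) = ennreal (\<Sum>k\<in>S \<inter> {..<i}. y k)" using Suc by simp
      also have "\<dots> + ennreal (y i) = ennreal ((\<Sum>k\<in>S \<inter> {..<i}. y k) + y i)"
        using y0 by (intro ennreal_plus[symmetric] sum_nonneg) (auto simp: y_def)
      also have "(\<Sum>k\<in>S \<inter> {..<i}. y k) + y i = (\<Sum>k\<in>S \<inter> {..<Suc i}. y k)"
      proof -
        have "S \<inter> {..<Suc i} = insert i (S \<inter> {..<i})" using True by auto
        then show ?thesis by simp
      qed
      finally show ?thesis .
    qed
  qed
  from this[of n] have "emeasure lborel (U n) = ennreal (\<Sum>k\<in>S \<inter> {..<n}. y k)" by simp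
  moreover have "S \<inter> {..<n} = S" using S by blast
  ultimately have em: "emeasure lborel (U n) = ennreal (area n S)"
    by (simp add: area_def y_def)
  have "enclosed_region (path_of n S) = U n"
  proof -
    have "set (path_of n S) = (\<lambda>i. (card (S \<inter> {..<i}), card ({i..<n} - S))) ` {..n}"
      unfolding path_of_def by (simp only: set_map set_upt) (auto simp: atLeast0LessThan lessThan_Suc_atMost)
    then show ?thesis
      unfolding enclosed_region_eq[OF successively_path_of] U_def x_def y_def by simp
  qed
  then show ?thesis
    unfolding path_area_def measure_def using em area_nonneg[of n S] by simp
qed

section \<open>The concave majorant at the diagonal\<close>

text \<open>After rescaling by \<alpha> + \<beta>, such a point lies strictly between 0 and a point
  of the segment from v to w.\<close>

lemma not_extreme_below_chord:
  fixes z v w :: "'a::euclidean_space"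
  assumes "convex H" "0 \<in> H" "v \<in> H" "w \<in> H" "z = \<alpha> *\<^sub>R v + \<beta> *\<^sub>R w"
    and "0 \<le> \<alpha>" "0 \<le> \<beta>" "\<alpha> + \<beta> < 1" "z \<noteq> 0"
  shows "\<not> z extreme_point_of H"
proof
  assume z: "z extreme_point_of H"
  define s where "s = \<alpha> + \<beta>"
  have s: "0 < s" "s < 1"
  proof -
    have "s \<noteq> 0"
    proof
      assume "s = 0"
      then have "\<alpha> = 0" "\<beta> = 0" using assms by (auto simp: s_def)
      then show False using assms by simp
    qed
    then show "0 < s" "s < 1" using assms by (auto simp: s_def)
  qed
  define y where "y = (\<alpha> / s) *\<^sub>R v + (\<beta> / s) *\<^sub>R w"
  have "y \<in> H"
    unfolding y_def using assms s by (intro convexD) (auto simp: s_def simp flip: add_divide_distrib)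
  moreover have zy: "z = s *\<^sub>R y" using s assms(5) by (simp add: y_def scaleR_add_right)
  moreover have "z \<in> open_segment 0 y"
    unfolding in_segment using zy s assms(9) by (intro conjI exI[of _ s]) auto
  ultimately show False using z assms(2) unfolding extreme_point_of_def by blast
qed

lemma closed_segment_subset_polyline:
  "closed_segment p q \<subseteq> polyline (xs @ p # q # ys)"
proof (induction xs)
  case (Cons a xs)
  then show ?case by (cases xs) auto
qed auto

lemma split_at_sign_change:
  fixes d :: "'a \<Rightarrow> real"
  assumes "sorted_wrt (\<lambda>a b. d a < d b) xs" "\<exists>a\<in>set xs. d a < 0" "\<exists>a\<in>set xs. 0 < d a" "\<forall>a\<in>set xs. d a \<noteq> 0"
  shows "\<exists>us p q vs. xs = us @ p # q # vs \<and> d p < 0 \<and> 0 < d q"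
proof -
  let ?A = "takeWhile (\<lambda>a. d a < 0) xs" and ?B = "dropWhile (\<lambda>a. d a < 0) xs"
  have xs: "xs = ?A @ ?B" by simp
  have "?A \<noteq> []"
  proof
    assume "?A = []"
    then have "xs = [] \<or> \<not> d (hd xs) < 0" by (cases xs) auto
    then have "\<forall>a\<in>set xs. \<not> d a < 0" using assms(1) by (cases xs) (auto simp: not_less intro: less_imp_le order.trans)
    then show False using assms(2) by blast
  qed
  then have A: "?A = butlast ?A @ [last ?A]" by simp
  have B: "?B \<noteq> []" using assms(3) by (metis dropWhile_eq_Nil_conv less_asym)
  then have B': "?B = hd ?B # tl ?B" by simp
  have "d (last ?A) < 0" using \<open>?A \<noteq> []\<close> by (meson last_in_set set_takeWhileD)
  moreover have "0 < d (hd ?B)"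
  proof -
    have "\<not> d (hd ?B) < 0" using B hd_dropWhile by blast
    moreover have "hd ?B \<in> set xs" using B by (metis hd_in_set set_dropWhileD)
    ultimately show ?thesis using assms(4) by force
  qed
  moreover have "xs = butlast ?A @ last ?A # hd ?B # tl ?B"
    using xs A B' by (metis append.assoc append_Cons append_Nil)
  ultimately show ?thesis by blast
qed

lemma path_of_diff:
  assumes "S \<subseteq> {..<n}" "i \<le> n"
  shows "real (fst (path_of n S ! i)) - real (snd (path_of n S ! i)) = real i - real (n - card S)"
  using assms(2)
proof (induction i)
  case 0
  have "{0..<n} - S = {..<n} - S" by auto
  then show ?case using card_compl[OF assms(1)] by (simp add: path_of_nth)
next
  case (Suc i)
  then show ?case using path_of_step[of i n S] by (cases "i \<in> S") auto
qed

lemma path_of_mono: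
  assumes "i \<le> j" "j \<le> n"
  shows "fst (path_of n S ! i) \<le> fst (path_of n S ! j)" "snd (path_of n S ! j) \<le> snd (path_of n S ! i)"
  using assms by (auto simp: path_of_nth intro!: card_mono)

lemma x_mid_path_of:
  assumes S: "S \<subseteq> {..<n}"
  shows "x_mid (path_of n S) = path_of n S ! (n - card S)"
    and "fst (path_of n S ! (n - card S)) = snd (path_of n S ! (n - card S))"
proof -
  let ?\<gamma> = "path_of n S" and ?q = "path_of n S ! (n - card S)"
  have q: "?q \<in> set ?\<gamma>" by (intro nth_mem) simp
  have "real (fst ?q) - real (snd ?q) = 0"
    using path_of_diff[OF S, of "n - card S"] by simp
  then show diag: "fst ?q = snd ?q" by simp
  have "is_mid_point ?\<gamma> (x_mid ?\<gamma>)"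
    unfolding x_mid_def by (rule theI'[OF ex1_mid_point[OF path_of_lattice_path]])
  then have mid: "x_mid ?\<gamma> \<in> set ?\<gamma>"
    "infdist (real_point (x_mid ?\<gamma>)) diagonal \<le> infdist (real_point ?q) diagonal"
    unfolding is_mid_point_def using q by (blast, metis less_imp_le order.refl)
  have "infdist (real_point ?q) diagonal = 0" using diag infdist_diagonal_eq_0 by blast
  then have "infdist (real_point (x_mid ?\<gamma>)) diagonal = 0"
    using mid(2) infdist_nonneg[of "real_point (x_mid ?\<gamma>)" diagonal] by linarith
  then have "fst (x_mid ?\<gamma>) = snd (x_mid ?\<gamma>)" using infdist_diagonal_eq_0 by blast
  then show "x_mid ?\<gamma> = ?q"
    by (intro diagonal_point_unique[OF successively_path_of mid(1) q _ diag])
qed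

lemma left_steps_path_of:
  assumes "S \<subseteq> {..<n}" "i \<le> n - card S"
  shows "real (left_steps n S i) = real (fst (path_of n S ! (n - card S))) - real (fst (path_of n S ! (n - card S - i)))"
proof -
  let ?b = "n - card S"
  have eq: "S \<inter> {..<?b} = (S \<inter> {..<?b - i}) \<union> ({?b - i..<?b} \<inter> S)" by auto
  have "card (S \<inter> {..<?b}) = card (S \<inter> {..<?b - i}) + card ({?b - i..<?b} \<inter> S)"
    unfolding eq by (rule card_Un_disjoint) auto
  then show ?thesis by (simp add: path_of_nth left_steps_def)
qed

lemma right_steps_path_of:
  assumes "S \<subseteq> {..<n}" "j \<le> card S"
  shows "real (right_steps n S j) = real (fst (path_of n S ! (n - card S + j))) - real (fst (path_of n S ! (n - card S)))"
proof -
  let ?b = "n - card S"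
  have eq: "S \<inter> {..<?b + j} = (S \<inter> {..<?b}) \<union> ({?b..<?b + j} \<inter> S)" by auto
  have "card (S \<inter> {..<?b + j}) = card (S \<inter> {..<?b}) + card ({?b..<?b + j} \<inter> S)"
    unfolding eq by (rule card_Un_disjoint) auto
  moreover have "?b + j \<le> n" using assms card_compl(2)[OF assms(1)] by linarith
  ultimately show ?thesis by (simp add: path_of_nth right_steps_def)
qed

text \<open>A path that meets the diagonal at the origin first only descends and then only moves
  right, so it encloses nothing.\<close>

lemma mid_pos:
  assumes S: "S \<subseteq> {..<n}" and area: "0 < area n S"
  shows "0 < fst (path_of n S ! (n - card S))"
proof (rule ccontr)
  let ?b = "n - card S"
  assume "\<not> ?thesis"
  then have "fst (path_of n S ! ?b) = 0" "snd (path_of n S ! ?b) = 0"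
    using x_mid_path_of(2)[OF S] by auto
  moreover have "finite S" using S finite_subset by blast
  ultimately have S_eq: "S \<inter> {..<?b} = {}" "{?b..<n} - S = {}" by (auto simp: path_of_nth)
  have "area n S = (\<Sum>k\<in>S. 0)"
    unfolding area_def
  proof (rule sum.cong)
    fix k assume "k \<in> S"
    then have "\<not> k < ?b" using S_eq(1) by blast
    then have "{k..<n} \<subseteq> {?b..<n}" by auto
    then have "{k..<n} - S = {}" using S_eq(2) by blast
    then show "real (card ({k..<n} - S)) = 0" by simp
  qed simp
  then show False using area by simp
qed

text \<open>Consecutive extremal points p and q on opposite sides of the diagonal span a segment of
  the majorant, which crosses the diagonal at (c, c). The roughness is at most the distance from (m,
  m) to this point. That c >= m, and hence that this distance is sqrt 2 (c - m), requires that the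
  path not pass above the line through p and q.\<close>

lemma chord_gap_of_mean_LR:
  assumes S: "S \<subseteq> {..<n}" and area: "0 < area n S" and h: "0 < h" "h \<le> mean_LR (path_of n S)"
  shows "chord_gap h n S"
proof -
  define \<gamma> where "\<gamma> = path_of n S"
  define b where "b = n - card S"
  define P where "P i = real_point (\<gamma> ! i)" for i
  define D where "D z = fst z - snd z" for z :: "real \<times> real"
  define m where "m = fst (P b)"
  have b: "b \<le> n" "n = b + card S" using card_compl(2)[OF S] by (auto simp: b_def)
  have DP: "D (P i) = real i - real b" if "i \<le> n" for i
    using path_of_diff[OF S that] by (simp add: D_def P_def \<gamma>_def b_def)
  have P_mono: "fst (P i) \<le> fst (P j)" "snd (P j) \<le> snd (P i)" if "i \<le> j" "j \<le> n" for i j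
    using path_of_mono[OF that, of S] by (simp_all add: P_def \<gamma>_def)
  have P0: "0 \<le> fst (P i)" "0 \<le> snd (P i)" for i by (simp_all add: P_def)
  have m0: "0 < m" using mid_pos[OF S area] by (simp add: m_def P_def \<gamma>_def b_def)
  have Pb: "P b = (m, m)"
    using x_mid_path_of(2)[OF S] by (simp add: m_def P_def \<gamma>_def b_def prod_eq_iff)
  define ps where "ps = map real_point \<gamma>"
  have len: "length ps = Suc n" by (simp add: ps_def \<gamma>_def)
  have ps_nth: "ps ! i = P i" if "i \<le> n" for i
    using that by (simp add: ps_def P_def \<gamma>_def)
  have ps_idx: "\<exists>i\<le>n. z = P i" if "z \<in> set ps" for z
    using that len ps_nth by (metis in_set_conv_nth less_Suc_eq_le)
  have ps_mem: "P i \<in> set ps" if "i \<le> n" for i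
    using that len ps_nth by (metis le_imp_less_Suc nth_mem)
  have ps_sorted: "sorted_wrt (\<lambda>a b. D a < D b) ps"
    unfolding sorted_wrt_iff_nth_less len using ps_nth DP by simp
  define H where "H = convex hull (set ps \<union> {(0, 0)})"
  define E where "E = path_Ext \<gamma>"
  have E_def': "E = {p. p extreme_point_of H \<and> p \<noteq> 0}"
    by (simp add: E_def path_Ext_def H_def ps_def zero_prod_def)
  have H: "convex H" "0 \<in> H" "set ps \<subseteq> H"
    unfolding H_def by (auto intro: hull_inc simp: zero_prod_def)
  have "compact H" unfolding H_def by (intro finite_imp_compact_convex_hull) auto
  then have H_eq: "H = convex hull {z. z extreme_point_of H}"
    by (rule Krein_Milman_Minkowski[OF _ H(1)])
  have E_ps: "z \<in> set ps" if "z \<in> E" for z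
    using that extreme_point_of_convex_hull[of z "set ps \<union> {(0, 0)}"]
    unfolding E_def' H_def by (auto simp: zero_prod_def)
  have E_H: "z \<in> H" if "z \<in> E" for z using E_ps[OF that] H(3) by blast
  \<comment> \<open>If no extremal point lay strictly beyond the diagonal, neither would any point
    of the hull, although the two ends of the path lie strictly on opposite sides.\<close>
  have half_plane: "D z \<le> 0" if "\<forall>e\<in>E. D e \<le> 0" "z \<in> H" for z
  proof -
    have "convex {z. D z \<le> 0}"
      unfolding convex_def D_def
    proof (clarsimp)
      fix a1 a2 b1 b2 u v :: real
      assume "a1 \<le> a2" "b1 \<le> b2" "0 \<le> u" "0 \<le> v"
      then show "u * a1 + v * b1 \<le> u * a2 + v * b2" by (intro add_mono mult_left_mono)
    qed
    moreover have "{z. z extreme_point_of H} \<subseteq> {z. D z \<le> 0}"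
    proof clarify
      fix z assume "z extreme_point_of H"
      then show "D z \<le> 0" using that(1) by (cases "z = 0") (simp_all add: E_def' D_def)
    qed
    ultimately have "H \<subseteq> {z. D z \<le> 0}" using H_eq by (metis hull_minimal)
    then show ?thesis using that(2) by blast
  qed
  have half_plane': "0 \<le> D z" if "\<forall>e\<in>E. 0 \<le> D e" "z \<in> H" for z
  proof -
    have "convex {z. 0 \<le> D z}"
      unfolding convex_def D_def
    proof (clarsimp)
      fix a1 a2 b1 b2 u v :: real
      assume "a2 \<le> a1" "b2 \<le> b1" "0 \<le> u" "0 \<le> v"
      then show "u * a2 + v * b2 \<le> u * a1 + v * b1" by (intro add_mono mult_left_mono)
    qed
    moreover have "{z. z extreme_point_of H} \<subseteq> {z. 0 \<le> D z}"
    proof clarify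
      fix z assume "z extreme_point_of H"
      then show "0 \<le> D z" using that(1) by (cases "z = 0") (simp_all add: E_def' D_def)
    qed
    ultimately have "H \<subseteq> {z. 0 \<le> D z}" using H_eq by (metis hull_minimal)
    then show ?thesis using that(2) by blast
  qed
  define fl where "fl = filter (\<lambda>p. p \<in> E) ps"
  have fl_set: "set fl = E" using E_ps by (auto simp: fl_def)
  have LR: "h \<le> infdist (P b) (polyline fl)"
    using h(2) x_mid_path_of(1)[OF S]
    by (simp add: mean_LR_def local_roughness_def concave_majorant_def fl_def ps_def E_def P_def \<gamma>_def b_def)
  \<comment> \<open>An extremal point on the diagonal would be a vertex of the majorant and give
    roughness zero.\<close>
  have no_mid: "P b \<notin> E"
  proof
    assume "P b \<in> E"
    then have "P b \<in> polyline fl" using polyline_vertices[of fl] fl_set by blast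
    then have "infdist (P b) (polyline fl) = 0" by simp
    then show False using LR h(1) by simp
  qed
  have ends: "0 < b" "b < n"
  proof -
    have "real (fst (\<gamma> ! b)) \<le> real b"
      unfolding \<gamma>_def path_of_nth[OF b(1)] fst_conv
      using card_mono[of "{..<b}" "S \<inter> {..<b}"] by simp
    then show "0 < b" using m0 by (simp add: m_def P_def)
    have "snd (P n) = 0" by (simp add: P_def \<gamma>_def path_of_nth)
    then show "b < n" using m0 Pb b by (metis le_neq_implies_less less_irrefl snd_conv)
  qed
  have "\<exists>us p q vs. fl = us @ p # q # vs \<and> D p < 0 \<and> 0 < D q"
  proof (rule split_at_sign_change)
    show "sorted_wrt (\<lambda>a b. D a < D b) fl" unfolding fl_def using ps_sorted by (rule sorted_wrt_filter)
    show "\<exists>a\<in>set fl. D a < 0"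
    proof (rule ccontr)
      assume "\<not> ?thesis"
      then have "0 \<le> D (P 0)" using half_plane'[of "P 0"] ps_mem[of 0] H(3) fl_set by force
      then show False using DP[of 0] ends by simp
    qed
    show "\<exists>a\<in>set fl. 0 < D a"
    proof (rule ccontr)
      assume "\<not> ?thesis"
      then have "D (P n) \<le> 0" using half_plane[of "P n"] ps_mem[of n] H(3) fl_set by force
      then show False using DP[of n] ends by simp
    qed
    show "\<forall>a\<in>set fl. D a \<noteq> 0"
    proof
      fix a assume "a \<in> set fl"
      then have a: "a \<in> E" using fl_set by blast
      then obtain i where "i \<le> n" "a = P i" using ps_idx E_ps by blast
      then show "D a \<noteq> 0" using DP no_mid a by auto
    qed
  qed
  then obtain us p q vs where fl: "fl = us @ p # q # vs" and Dp: "D p < 0" and Dq: "0 < D q" by blast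
  have pE: "p \<in> E" and qE: "q \<in> E" using fl fl_set by auto
  obtain ip where ip: "ip \<le> n" "p = P ip" using ps_idx[OF E_ps[OF pE]] by blast
  obtain iq where iq: "iq \<le> n" "q = P iq" using ps_idx[OF E_ps[OF qE]] by blast
  have ipb: "ip < b" using Dp ip DP by simp
  have iqb: "b < iq" using Dq iq DP by simp
  obtain p1 p2 where p: "p = (p1, p2)" by (cases p)
  obtain q1 q2 where q: "q = (q1, q2)" by (cases q)
  have Pp: "P ip = (p1, p2)" and Pq: "P iq = (q1, q2)" using ip iq p q by simp_all
  have pq: "p1 \<le> q1" "q2 \<le> p2" "0 \<le> p1" "0 \<le> q2"
    using P_mono[of ip iq] P0[of ip] P0[of iq] iq(1) ipb iqb by (simp_all add: Pp Pq)
  have dp: "p1 < p2" "q2 < q1" using Dp Dq p q by (auto simp: D_def)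
  define \<Delta> where "\<Delta> = q1 * p2 - q2 * p1"
  have \<Delta>0: "0 < \<Delta>"
  proof -
    have "q2 * p1 \<le> q1 * p1" using dp pq by (intro mult_right_mono) auto
    also have "\<dots> < q1 * p2" using dp pq by (intro mult_strict_left_mono) auto
    finally show ?thesis by (simp add: \<Delta>_def)
  qed
  \<comment> \<open>\<open>f z = \<Delta>\<close> is the line through p and q, with
    \<open>\<Delta>\<close> the determinant of the two points.\<close>
  define f where "f z = (p2 - q2) * fst z + (q1 - p1) * snd z" for z :: "real \<times> real"
  \<comment> \<open>An extremal point e beyond this line and before p would leave p strictly below
    the chord from e to q, so p would not be extremal; likewise for q if e comes after it. The
    coefficients of the combinations come from Cramer's rule.\<close>
  have fE: "f e \<le> \<Delta>" if e: "e \<in> E" for e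
  proof (rule ccontr)
    assume "\<not> f e \<le> \<Delta>"
    obtain e1 e2 where e12: "e = (e1, e2)" by (cases e)
    have big: "q1 * p2 - q2 * p1 < (p2 - q2) * e1 + (q1 - p1) * e2"
      using \<open>\<not> f e \<le> \<Delta>\<close> by (simp add: f_def \<Delta>_def e12)
    have "e \<noteq> p" "e \<noteq> q" using \<open>\<not> f e \<le> \<Delta>\<close> by (auto simp: f_def \<Delta>_def p q algebra_simps)
    then have "e \<in> set us \<or> e \<in> set vs" using e fl fl_set by auto
    have srt: "sorted_wrt (\<lambda>a b. D a < D b) (us @ p # q # vs)"
      using ps_sorted unfolding fl[symmetric] fl_def by (rule sorted_wrt_filter)
    obtain ie where ie: "ie \<le> n" "e = P ie" using ps_idx[OF E_ps[OF e]] by blast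
    have Pe: "P ie = (e1, e2)" using ie(2) e12 by simp
    from \<open>e \<in> set us \<or> e \<in> set vs\<close> show False
    proof
      assume "e \<in> set us"
      then have "D e < D p" using srt by (auto simp: sorted_wrt_append)
      then have "ie < ip" using ie ip DP by simp
      then have ep: "e1 \<le> p1" "p2 \<le> e2" "0 \<le> e1"
        using P_mono[of ie ip] P0[of ie] ip(1) by (simp_all add: Pe Pp)
      have c: "0 \<le> e2 * p1 - e1 * p2"
        using mult_mono[OF ep(1,2)] pq dp ep by (simp add: mult.commute)
      define W where "W = e2 * q1 - e1 * q2"
      have less: "\<Delta> + (e2 * p1 - e1 * p2) < W"
        using big by (simp add: \<Delta>_def W_def algebra_simps)
      then have W0: "0 < W" using c \<Delta>0 by linarith
      have "p = (\<Delta> / W) *\<^sub>R e + ((e2 * p1 - e1 * p2) / W) *\<^sub>R q"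
      proof -
        have "\<Delta> * e1 + (e2 * p1 - e1 * p2) * q1 = p1 * W"
          "\<Delta> * e2 + (e2 * p1 - e1 * p2) * q2 = p2 * W"
          by (simp_all add: \<Delta>_def W_def algebra_simps)
        then show ?thesis using W0 by (simp add: p q e12 field_simps)
      qed
      moreover have "\<Delta> / W + (e2 * p1 - e1 * p2) / W < 1"
        using less W0 by (simp flip: add_divide_distrib)
      ultimately have "\<not> p extreme_point_of H"
        using c \<Delta>0 W0 pE E_H[OF e] E_H[OF qE]
        by (intro not_extreme_below_chord[OF H(1,2), of e q p]) (auto simp: E_def')
      then show False using pE by (simp add: E_def')
    next
      assume "e \<in> set vs"
      then have "D q < D e" using srt by (auto simp: sorted_wrt_append)
      then have "iq < ie" using ie iq DP by simp
      then have eq: "q1 \<le> e1" "e2 \<le> q2" "0 \<le> e2"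
        using P_mono[of iq ie] P0[of ie] ie(1) by (simp_all add: Pe Pq)
      have c: "0 \<le> q2 * e1 - q1 * e2"
        using mult_mono[OF eq(1,2)] pq dp eq by (simp add: mult.commute)
      define W where "W = p2 * e1 - p1 * e2"
      have less: "\<Delta> + (q2 * e1 - q1 * e2) < W"
        using big by (simp add: \<Delta>_def W_def algebra_simps)
      then have W0: "0 < W" using c \<Delta>0 by linarith
      have "q = ((q2 * e1 - q1 * e2) / W) *\<^sub>R p + (\<Delta> / W) *\<^sub>R e"
      proof -
        have "(q2 * e1 - q1 * e2) * p1 + \<Delta> * e1 = q1 * W"
          "(q2 * e1 - q1 * e2) * p2 + \<Delta> * e2 = q2 * W"
          by (simp_all add: \<Delta>_def W_def algebra_simps)
        then show ?thesis using W0 by (simp add: p q e12 field_simps)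
      qed
      moreover have "(q2 * e1 - q1 * e2) / W + \<Delta> / W < 1"
        using less W0 by (simp flip: add_divide_distrib)
      ultimately have "\<not> q extreme_point_of H"
        using c \<Delta>0 W0 qE E_H[OF e] E_H[OF pE]
        by (intro not_extreme_below_chord[OF H(1,2), of p e q]) (auto simp: E_def')
      then show False using qE by (simp add: E_def')
    qed
  qed
  have "f (P b) \<le> \<Delta>"
  proof -
    have "convex {z. f z \<le> \<Delta>}"
      unfolding convex_def
    proof (intro ballI allI impI)
      fix x y :: "real \<times> real" and u v :: real
      assume "x \<in> {z. f z \<le> \<Delta>}" "y \<in> {z. f z \<le> \<Delta>}" and uv: "0 \<le> u" "0 \<le> v" "u + v = 1"
      then have "u * f x + v * f y \<le> u * \<Delta> + v * \<Delta>" by (intro add_mono mult_left_mono) auto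
      also have "\<dots> = \<Delta>" using uv by (simp flip: distrib_right)
      also have "u * f x + v * f y = f (u *\<^sub>R x + v *\<^sub>R y)" by (simp add: f_def algebra_simps)
      finally show "u *\<^sub>R x + v *\<^sub>R y \<in> {z. f z \<le> \<Delta>}" by simp
    qed
    moreover have "{z. z extreme_point_of H} \<subseteq> {z. f z \<le> \<Delta>}"
    proof clarify
      fix z assume "z extreme_point_of H"
      then show "f z \<le> \<Delta>" using fE[of z] \<Delta>0 by (cases "z = 0") (simp_all add: E_def' f_def)
    qed
    ultimately have "H \<subseteq> {z. f z \<le> \<Delta>}" using H_eq by (metis hull_minimal)
    then show ?thesis using ps_mem[OF b(1)] H(3) by blast
  qed
  define A B where "A = p2 - p1" and "B = q1 - q2"
  have AB: "0 < A" "0 < B" using dp by (auto simp: A_def B_def)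
  have m_le: "(A + B) * m \<le> \<Delta>" using \<open>f (P b) \<le> \<Delta>\<close> by (simp add: f_def Pb A_def B_def algebra_simps)
  \<comment> \<open>The intersection with the diagonal, as
    \<open>f (c, c) = (A + B) * c\<close>.\<close>
  define c where "c = \<Delta> / (A + B)"
  have c: "(A + B) * c = \<Delta>" "m \<le> c"
    using AB m_le by (simp_all add: c_def field_simps)
  have "(c, c) \<in> closed_segment p q"
  proof -
    have "(c, c) = (1 - A / (A + B)) *\<^sub>R p + (A / (A + B)) *\<^sub>R q"
    proof -
      have "c * (A + B) = B * p1 + A * q1" "c * (A + B) = B * p2 + A * q2"
        using c(1) by (simp_all add: \<Delta>_def A_def B_def algebra_simps)
      then have "c = (B * p1 + A * q1) / (A + B)" "c = (B * p2 + A * q2) / (A + B)"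
        using AB by (simp_all add: eq_divide_eq)
      then have "c = B / (A + B) * p1 + A / (A + B) * q1" "c = B / (A + B) * p2 + A / (A + B) * q2"
        by (simp_all add: add_divide_distrib)
      moreover have "1 - A / (A + B) = B / (A + B)" using AB by (simp add: field_simps)
      ultimately show ?thesis by (simp add: p q)
    qed
    moreover have "0 \<le> A / (A + B)" "A / (A + B) \<le> 1" using AB by auto
    ultimately show ?thesis unfolding closed_segment_def by blast
  qed
  then have "(c, c) \<in> polyline fl" using closed_segment_subset_polyline fl by blast
  then have "infdist (P b) (polyline fl) \<le> dist (P b) (c, c)" by (rule infdist_le)
  also have "dist (P b) (c, c) = sqrt 2 * (c - m)"
  proof -
    have "dist (P b) (c, c) = sqrt (2 * (c - m)\<^sup>2)"
      by (simp add: Pb dist_Pair_Pair dist_real_def power2_commute)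
    then show ?thesis using c by (simp add: real_sqrt_mult)
  qed
  also have "\<dots> \<le> 2 * (c - m)" using c sqrt2_less_2 by (intro mult_right_mono) auto
  finally have "infdist (P b) (polyline fl) \<le> 2 * (c - m)" .
  with LR have "h \<le> 2 * (c - m)" by (rule order.trans)
  then have hc: "m + h / 2 \<le> c" by (simp add: field_simps)
  \<comment> \<open>The difference x - y grows by one at every step, so these numbers of steps equal
    p2 - p1 and q1 - q2, the weights A and B of the chord.\<close>
  define i j where "i = b - ip" and "j = iq - b"
  have i: "1 \<le> i" "i \<le> b" "real i = A" "b - i = ip"
    using ipb DP[OF ip(1)] by (simp_all add: i_def A_def D_def Pp)
  have j: "1 \<le> j" "j \<le> card S" "real j = B" "b + j = iq"
    using iqb DP[OF iq(1)] iq(1) b by (simp_all add: j_def B_def D_def Pq)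
  have left: "real (left_steps n S i) = m - p1"
    using left_steps_path_of[OF S, of i] i Pp by (simp add: b_def[symmetric] \<gamma>_def[symmetric] m_def P_def map_prod_def split_beta)
  have right: "real (right_steps n S j) = q1 - m"
    using right_steps_path_of[OF S, of j] j Pq by (simp add: b_def[symmetric] \<gamma>_def[symmetric] m_def P_def map_prod_def split_beta)
  have "(A + B) * (m + h / 2) \<le> (A + B) * c" using hc AB by (intro mult_left_mono) auto
  also have "\<dots> = A * q1 + B * p1" using c(1) by (simp add: \<Delta>_def A_def B_def algebra_simps)
  finally have "((A + B) * (m + h / 2) - (A * q1 + B * p1)) / (A * B) \<le> 0"
    using AB by (intro divide_nonpos_pos mult_pos_pos) auto
  moreover have "(m - p1) / A + h / (2 * A) - ((q1 - m) / B - h / (2 * B))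
      = ((A + B) * (m + h / 2) - (A * q1 + B * p1)) / (A * B)"
    using AB by (simp add: field_simps)
  ultimately have "(m - p1) / A + h / (2 * A) \<le> (q1 - m) / B - h / (2 * B)" by linarith
  then have "real (left_steps n S i) / i + h / (2 * i) \<le> real (right_steps n S j) / j - h / (2 * j)"
    using i(3) j(3) by (simp add: left right)
  then show ?thesis unfolding chord_gap_def using i j by (auto simp: b_def)
qed


lemma chord_gap_antimono:
  assumes "chord_gap h n S" "h' \<le> h"
  shows "chord_gap h' n S"
proof -
  obtain i j where ij: "1 \<le> i" "i \<le> n - card S" "1 \<le> j" "j \<le> card S"
    and le: "real (left_steps n S i) / i + h / real (2 * i) \<le> real (right_steps n S j) / j - h / real (2 * j)"
    using assms(1) unfolding chord_gap_def by blast
  have "h' / real (2 * i) \<le> h / real (2 * i)" "h' / real (2 * j) \<le> h / real (2 * j)"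
    using assms(2) by (auto intro: divide_right_mono)
  then have "real (left_steps n S i) / i + h' / real (2 * i) \<le> real (right_steps n S j) / j - h' / real (2 * j)"
    using le by linarith
  then show ?thesis unfolding chord_gap_def using ij by blast
qed

lemma ex_power_of_four:
  fixes y :: real
  assumes "1 \<le> y"
  shows "\<exists>r::nat. 4 ^ r \<le> y \<and> y < 4 ^ Suc r"
proof -
  obtain n :: nat where "y < 4 ^ n" using real_arch_pow[of 4 y] by auto
  then have least: "y < 4 ^ (LEAST n. y < 4 ^ n)" by (rule LeastI)
  have "(LEAST n. y < 4 ^ n) \<noteq> 0"
  proof
    assume "(LEAST n. y < 4 ^ n) = 0"
    then show False using least assms by simp
  qed
  then obtain r where r: "(LEAST n. y < 4 ^ n) = Suc r" using not0_implies_Suc by blast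
  have "\<not> y < 4 ^ r" by (rule not_less_Least) (simp add: r)
  then show ?thesis using least r by (intro exI[of _ r]) auto
qed

section \<open>The tail of the roughness\<close>

context subcritical
begin

text \<open>The factor 1 - 2 l of the path measure cancels in the quotient.\<close>

lemma conditional_prob_eq:
  assumes "1 \<le> N"
  shows "\<P>(\<gamma> in large_area_measure l N. h \<le> mean_LR \<gamma>)
    = wt (\<lambda>n S. (real N)\<^sup>2 \<le> area n S \<and> h \<le> mean_LR (path_of n S)) / Z N"
proof -
  let ?A = "{\<gamma> \<in> lattice_paths. path_area \<gamma> \<ge> (real N)\<^sup>2}"
  let ?B = "{\<gamma> \<in> lattice_paths. h \<le> mean_LR \<gamma>}"
  have sets: "sets (path_measure l) = Pow lattice_paths" and space: "space (path_measure l) = lattice_paths"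
    by (simp_all add: path_measure_def sets_point_measure space_point_measure)
  have wt_cong: "wt (\<lambda>n S. P n S) = wt Q" if "\<And>n S. S \<subseteq> {..<n} \<Longrightarrow> P n S = Q n S" for P Q
    using that by (intro antisym wt_mono) auto
  have "measure (path_measure l) ?A = (1 - 2 * l) * wt (\<lambda>n S. path_of n S \<in> ?A)"
    by (rule measure_path_measure) auto
  also have "wt (\<lambda>n S. path_of n S \<in> ?A) = Z N"
    unfolding Z_def by (rule wt_cong) (simp add: path_of_lattice_path path_area_path_of)
  finally have mA: "measure (path_measure l) ?A = (1 - 2 * l) * Z N" .
  have "measure (path_measure l) (?A \<inter> ?B) = (1 - 2 * l) * wt (\<lambda>n S. path_of n S \<in> ?A \<inter> ?B)"
    by (rule measure_path_measure) auto
  also have "wt (\<lambda>n S. path_of n S \<in> ?A \<inter> ?B)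
      = wt (\<lambda>n S. (real N)\<^sup>2 \<le> area n S \<and> h \<le> mean_LR (path_of n S))"
    by (rule wt_cong) (simp add: path_of_lattice_path path_area_path_of)
  finally have mAB: "measure (path_measure l) (?A \<inter> ?B)
      = (1 - 2 * l) * wt (\<lambda>n S. (real N)\<^sup>2 \<le> area n S \<and> h \<le> mean_LR (path_of n S))" .
  have "emeasure (path_measure l) ?A = ennreal ((1 - 2 * l) * wt (\<lambda>n S. path_of n S \<in> ?A))"
    by (rule emeasure_path_measure) auto
  then have fin: "emeasure (path_measure l) ?A \<noteq> \<infinity>" by simp
  have pos: "0 < (1 - 2 * l) * Z N" using l_half Z_pos[of N] by simp
  have ne: "emeasure (path_measure l) ?A \<noteq> 0"
  proof
    assume "emeasure (path_measure l) ?A = 0"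
    then have "measure (path_measure l) ?A = 0" by (simp add: measure_def)
    then show False using mA pos by linarith
  qed
  have "\<P>(\<gamma> in large_area_measure l N. h \<le> mean_LR \<gamma>) = measure (large_area_measure l N) ?B"
    by (simp add: large_area_measure_def space)
  also have "\<dots> = measure (path_measure l) (?A \<inter> ?B) / measure (path_measure l) ?A"
    unfolding large_area_measure_def using ne fin sets by (intro measure_uniform_measure) auto
  also have "\<dots> = wt (\<lambda>n S. (real N)\<^sup>2 \<le> area n S \<and> h \<le> mean_LR (path_of n S)) / Z N"
    unfolding mA mAB using l_half by simp
  finally show ?thesis .
qed

lemma mean_LR_tail:
  "\<exists>c C \<epsilon> :: real. 0 < c \<and> 0 < C \<and> 0 < \<epsilon> \<and> (\<forall>N t. 1 \<le> N \<longrightarrow> 0 < t \<longrightarrow> t \<le> \<epsilon> * real N powr (2 / 3) \<longrightarrow>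
    \<P>(\<gamma> in large_area_measure l N. t * real N powr (1 / 3) \<le> mean_LR \<gamma>) \<le> C * exp (- c * t powr (3 / 2)))"
proof -
  obtain \<epsilon> H c C :: real where pos: "0 < \<epsilon>" "0 < H" "0 < c" "0 < C" and gap': "\<forall>N r. 1 \<le> N \<longrightarrow> 2 ^ r \<le> \<epsilon> * real N \<longrightarrow>
    wt (\<lambda>n S. (real N)\<^sup>2 \<le> area n S \<and> chord_gap (H * 4 ^ r / N) n S)
      \<le> C * exp (- c * (8 ^ r / (real N)\<^sup>2)) * Z N"
    using wt_chord_gap by (elim exE conjE)
  note gap = gap'[rule_format]
  define c1 where "c1 = c / (4 * H) powr (3 / 2)"
  have c1: "0 < c1" using pos by (simp add: c1_def)
  define C1 where "C1 = C + exp (c1 * H powr (3 / 2))"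
  have C1: "0 < C1" using pos by (simp add: C1_def add_pos_pos)
  have "\<P>(\<gamma> in large_area_measure l N. t * real N powr (1 / 3) \<le> mean_LR \<gamma>) \<le> C1 * exp (- c1 * t powr (3 / 2))"
    if N: "1 \<le> N" and t: "0 < t" "t \<le> \<epsilon>\<^sup>2 * H * real N powr (2 / 3)" for N t
  proof -
    define h where "h = t * real N powr (1 / 3)"
    \<comment> \<open>\<open>wt_chord_gap\<close> handles the heights H 4^r / N only. Rounding h
      down to such a height means choosing 4^r <= y < 4^(r + 1), which is the origin of the 4 in
      c1.\<close>
    define y where "y = h * N / H"
    have N0: "0 < real N" using N by simp
    have h0: "0 < h" using t N0 by (simp add: h_def)
    have powr43: "real N powr (1 / 3) * real N = real N powr (4 / 3)"
      using N0 powr_add[of "real N" "1 / 3" 1] by simp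
    have y_eq: "y = t * real N powr (4 / 3) / H" by (simp add: y_def h_def flip: powr43)
    have prob: "\<P>(\<gamma> in large_area_measure l N. h \<le> mean_LR \<gamma>)
        = wt (\<lambda>n S. (real N)\<^sup>2 \<le> area n S \<and> h \<le> mean_LR (path_of n S)) / Z N" (is "_ = wt ?P / _")
      by (rule conditional_prob_eq[OF N])
    show ?thesis
    proof (cases "1 \<le> y")
      case True
      obtain r :: nat where r: "4 ^ r \<le> y" "y < 4 ^ Suc r" using ex_power_of_four[OF True] by blast
      \<comment> \<open>The upper bound on t was chosen for this: it keeps y below (\<epsilon>
        N)^2.\<close>
      have "2 ^ r \<le> \<epsilon> * real N"
      proof -
        have "(2 ^ r)\<^sup>2 = (4::real) ^ r" by (simp add: power2_eq_square flip: power_mult_distrib)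
        also have "\<dots> \<le> t * real N powr (4 / 3) / H" using r(1) y_eq by simp
        also have "\<dots> \<le> \<epsilon>\<^sup>2 * H * real N powr (2 / 3) * real N powr (4 / 3) / H"
          using t pos by (intro divide_right_mono mult_right_mono) auto
        also have "\<dots> = \<epsilon>\<^sup>2 * (real N powr (2 / 3) * real N powr (4 / 3))" using pos by simp
        also have "real N powr (2 / 3) * real N powr (4 / 3) = (real N)\<^sup>2"
          using N0 powr_add[of "real N" "2 / 3" "4 / 3"] by simp
        also have "\<epsilon>\<^sup>2 * (real N)\<^sup>2 = (\<epsilon> * real N)\<^sup>2" by (simp add: power_mult_distrib)
        finally show ?thesis by (rule power2_le_imp_le) (use pos in simp)
      qed
      note bound = gap[OF N this]
      have hr: "H * 4 ^ r / N \<le> h" using r(1) pos N0 by (simp add: y_def field_simps)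
      have "wt ?P \<le> wt (\<lambda>n S. (real N)\<^sup>2 \<le> area n S \<and> chord_gap (H * 4 ^ r / N) n S)"
      proof (rule wt_mono, intro conjI)
        fix n S assume S: "S \<subseteq> {..<n}" and P: "?P n S"
        have "0 < (real N)\<^sup>2" using N0 by simp
        then have "0 < area n S" using P by linarith
        then have "chord_gap h n S" using P by (intro chord_gap_of_mean_LR[OF S _ h0]) auto
        then show "chord_gap (H * 4 ^ r / N) n S" using hr by (rule chord_gap_antimono)
      qed auto
      also have "\<dots> \<le> C * exp (- c * (8 ^ r / (real N)\<^sup>2)) * Z N" by (rule bound)
      also have "\<dots> \<le> C1 * exp (- c1 * t powr (3 / 2)) * Z N"
      proof (intro mult_right_mono mult_mono)
        have "t powr (3 / 2) / (4 * H) powr (3 / 2) * (real N)\<^sup>2 = (y / 4) powr (3 / 2)"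
        proof -
          have "(real N powr (4 / 3)) powr (3 / 2) = (real N)\<^sup>2"
            using N0 by (simp add: powr_powr)
          moreover have "y / 4 = t * real N powr (4 / 3) / (4 * H)" by (simp add: y_eq)
          ultimately show ?thesis using t pos N0 by (simp add: powr_divide powr_mult)
        qed
        also have "\<dots> \<le> (4 ^ r) powr (3 / 2)"
          using r(2) True by (intro powr_mono2) auto
        also have "\<dots> = 8 ^ r"
        proof -
          have "(4::real) powr (3 / 2) = 8"
          proof -
            have "(4::real) powr (3 / 2) = (2 powr 2) powr (3 / 2)" by simp
            also have "\<dots> = 2 powr 3" by (simp only: powr_powr) simp
            finally show ?thesis by simp
          qed
          moreover have "((4::real) ^ r) powr (3 / 2) = (4 powr (3 / 2)) ^ r"
          proof -
            have "((4::real) ^ r) powr (3 / 2) = (4 powr real r) powr (3 / 2)" by (simp add: powr_realpow)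
            also have "\<dots> = (4 powr (3 / 2)) powr real r" by (simp only: powr_powr mult.commute)
            also have "\<dots> = (4 powr (3 / 2)) ^ r" by (rule powr_realpow) simp
            finally show ?thesis .
          qed
          ultimately show ?thesis by simp
        qed
        finally have "t powr (3 / 2) / (4 * H) powr (3 / 2) \<le> 8 ^ r / (real N)\<^sup>2"
          using N0 by (simp add: pos_le_divide_eq)
        then have "c * (t powr (3 / 2) / (4 * H) powr (3 / 2)) \<le> c * (8 ^ r / (real N)\<^sup>2)"
          using pos by (intro mult_left_mono) auto
        then show "exp (- c * (8 ^ r / (real N)\<^sup>2)) \<le> exp (- c1 * t powr (3 / 2))"
          by (simp add: c1_def)
      qed (use pos Z_pos[of N] in \<open>auto simp: C1_def\<close>)
      finally have "wt ?P / Z N \<le> C1 * exp (- c1 * t powr (3 / 2))"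
        using Z_pos[of N] by (simp add: pos_divide_le_eq)
      then show ?thesis using prob by (simp add: h_def)
    next
      case False
      \<comment> \<open>For heights below the smallest admissible one t is bounded, and the second
        summand of C1 makes the estimate trivial.\<close>
      have "t \<le> H"
      proof -
        have "1 \<le> real N powr (4 / 3)" using N by (intro ge_one_powr_ge_zero) auto
        then have "t * 1 \<le> t * real N powr (4 / 3)" using t by (intro mult_left_mono) auto
        also have "\<dots> \<le> H" using False pos by (simp add: y_eq field_simps)
        finally show ?thesis by simp
      qed
      then have "t powr (3 / 2) \<le> H powr (3 / 2)" using t by (intro powr_mono2) auto
      then have "c1 * t powr (3 / 2) \<le> c1 * H powr (3 / 2)" using c1 by (intro mult_left_mono) auto
      then have "1 \<le> exp (c1 * H powr (3 / 2) + - c1 * t powr (3 / 2))"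
        unfolding one_le_exp_iff by simp
      also have "\<dots> = exp (c1 * H powr (3 / 2)) * exp (- c1 * t powr (3 / 2))" by (rule exp_add)
      also have "\<dots> \<le> C1 * exp (- c1 * t powr (3 / 2))"
        using pos by (intro mult_right_mono) (auto simp: C1_def)
      finally have "1 \<le> C1 * exp (- c1 * t powr (3 / 2))" .
      moreover have "wt ?P / Z N \<le> 1"
        using wt_le_Z[of N "\<lambda>n S. h \<le> mean_LR (path_of n S)"] Z_pos[of N] by simp
      ultimately show ?thesis using prob by (simp add: h_def)
    qed
  qed
  moreover have "0 < \<epsilon>\<^sup>2 * H" using pos by simp
  ultimately show ?thesis using c1 C1 by blast
qed

end

theorem proposition3p2:
  fixes l :: real
  assumes "0 < l" and "l < 1 / 2"
  shows "\<exists>c' c C :: real. c' > 0 \<and> c > 0 \<and> C > 0 \<and>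
    (\<forall>N :: nat. \<forall>t :: real. N \<ge> 1 \<longrightarrow> c' \<le> t \<longrightarrow> t \<le> real N powr (5 / 6) \<longrightarrow>
      \<P>(\<gamma> in large_area_measure l N. mean_LR \<gamma> \<ge> t * real N powr (1 / 3))
        \<le> C * exp (- c * t powr (6 / 5)))"
proof -
  interpret subcritical l using assms by unfold_locales
  obtain c C \<epsilon> :: real where pos: "0 < c" "0 < C" "0 < \<epsilon>" and tail': "\<forall>N t. 1 \<le> N \<longrightarrow> 0 < t \<longrightarrow> t \<le> \<epsilon> * real N powr (2 / 3) \<longrightarrow>
    \<P>(\<gamma> in large_area_measure l N. t * real N powr (1 / 3) \<le> mean_LR \<gamma>) \<le> C * exp (- c * t powr (3 / 2))"
    using mean_LR_tail by (elim exE conjE)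
  note tail = tail'[rule_format]
  \<comment> \<open>m covers two ranges. Where \<open>mean_LR_tail\<close> applies to t itself, t >=
    1 gives t^(6/5) <= t^(3/2). Beyond, it is applied at \<epsilon> N^(2/3), where its exponent
    contains \<epsilon>^(3/2) N, and N >= t^(6/5).\<close>
  define m where "m = min 1 (\<epsilon> powr (3 / 2))"
  have m: "0 < m" "m \<le> 1" "m \<le> \<epsilon> powr (3 / 2)" using pos by (auto simp: m_def)
  have main: "\<P>(\<gamma> in large_area_measure l N. t * real N powr (1 / 3) \<le> mean_LR \<gamma>)
      \<le> C * exp (- (c * m) * t powr (6 / 5))"
    if N: "1 \<le> N" and t: "1 \<le> t" "t \<le> real N powr (5 / 6)" for N :: nat and t :: real
  proof -
    have N0: "0 < real N" using N by simp
    define u where "u = min t (\<epsilon> * real N powr (2 / 3))"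
    have u: "0 < u" "u \<le> \<epsilon> * real N powr (2 / 3)" "u \<le> t" using t pos N0 by (auto simp: u_def)
    have mu: "m * t powr (6 / 5) \<le> u powr (3 / 2)"
    proof (cases "t \<le> \<epsilon> * real N powr (2 / 3)")
      case True
      have "m * t powr (6 / 5) \<le> 1 * t powr (6 / 5)" using m by (intro mult_right_mono) auto
      also have "\<dots> \<le> t powr (3 / 2)" using t by (simp add: powr_mono)
      finally show ?thesis using True by (simp add: u_def)
    next
      case False
      have "t powr (6 / 5) \<le> (real N powr (5 / 6)) powr (6 / 5)" using t by (intro powr_mono2) auto
      then have tN: "t powr (6 / 5) \<le> real N" using N0 by (simp add: powr_powr)
      have "m * t powr (6 / 5) \<le> \<epsilon> powr (3 / 2) * real N"
        using m tN by (intro mult_mono) auto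
      also have "\<dots> = u powr (3 / 2)" using False pos N0 by (simp add: u_def powr_mult powr_powr)
      finally show ?thesis .
    qed
    have uncond: "\<P>(\<gamma> in large_area_measure l N. x * real N powr (1 / 3) \<le> mean_LR \<gamma>)
        = wt (\<lambda>n S. (real N)\<^sup>2 \<le> area n S \<and> x * real N powr (1 / 3) \<le> mean_LR (path_of n S)) / Z N" for x
      by (rule conditional_prob_eq[OF N])
    have "\<P>(\<gamma> in large_area_measure l N. t * real N powr (1 / 3) \<le> mean_LR \<gamma>)
        \<le> \<P>(\<gamma> in large_area_measure l N. u * real N powr (1 / 3) \<le> mean_LR \<gamma>)"
      unfolding uncond
    proof (intro divide_right_mono wt_mono conjI)
      fix n S
      assume "(real N)\<^sup>2 \<le> area n S \<and> t * real N powr (1 / 3) \<le> mean_LR (path_of n S)"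
      moreover have "u * real N powr (1 / 3) \<le> t * real N powr (1 / 3)" using u by (intro mult_right_mono) auto
      ultimately show "(real N)\<^sup>2 \<le> area n S" "u * real N powr (1 / 3) \<le> mean_LR (path_of n S)" by auto
    qed (use Z_pos[of N] in auto)
    also have "\<dots> \<le> C * exp (- c * u powr (3 / 2))" by (rule tail[OF N u(1,2)])
    also have "\<dots> \<le> C * exp (- (c * m) * t powr (6 / 5))"
      using mult_left_mono[OF mu, of c] pos by (intro mult_left_mono) (auto simp: mult_ac)
    finally show ?thesis .
  qed
  show ?thesis
    by (intro exI[of _ 1] exI[of _ "c * m"] exI[of _ C] conjI allI impI main) (use pos m in auto)
qed

end
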